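(* For every $\bar H\in\mathbb{R}$ one can find a constant $C(\bar H)>0$ depending only on $\bar H$ such that for all $f=f(v)\ge 0$ on $\mathbb{R}^3$ satisfying $$\int_{\mathbb{R}^3} f(v)\,dv=1,\qquad \int_{\mathbb{R}^3} f(v)\,v\,dv=0,\qquad \int_{\mathbb{R}^3} f(v)\,|v|^2\,dv=3,$$ and $H(f):=\int_{\mathbb{R}^3} f\log f\,dv\le\bar H$, the following inequality holds: $$D(f)\ \ge\ C(\bar H)\,(M_5(f))^{-1}\int_{\mathbb{R}^3}\left\{ f\log\left(\frac{Z_1}{Z_2}\frac{f}{\mu}\right)+\frac{Z_2}{Z_1}\mu-f\right\}\langle v\rangle^{-3}\,dv,$$ with $Z_1=\int_{\mathbb{R}^3}\langle v\rangle^{-3}\mu(v)\,dv$ and $Z_2=\int_{\mathbb{R}^3}\langle v\rangle^{-3}f(v)\,dv$. As a consequence, for any $R>0$ (and some absolute constant $C>0$), $$D(f)\ \ge\ C(\bar H)\,(M_5(f))^{-1}R^{-3}\left(\int_{\mathbb{R}^3} f\log(f/\mu)\,dv-\int_{\langle v\rangle\ge R} f\log f\,dv-C\int_{\langle v\rangle\ge R}\langle v\rangle^2 f\,dv-C\int_{\langle v\rangle\ge R}\mu\,dv\right).$$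
   Context: Notation: $\langle v\rangle=(1+|v|^2)^{1/2}$, $M_\ell(f)=\int_{\mathbb{R}^3}\langle v\rangle^{\ell} f(v)\,dv$, and $\mu(v)=(2\pi)^{-3/2}e^{-|v|^2/2}$. The entropy dissipation of the Landau operator with Coulomb potential is $$D(f)=\frac12\sum_{i=1}^3\sum_{j=1}^3\iint_{\mathbb{R}^3\times\mathbb{R}^3} a_{ij}(v-w)\left\{\frac{\partial_i f}{f}(v)-\frac{\partial_i f}{f}(w)\right\}\left\{\frac{\partial_j f}{f}(v)-\frac{\partial_j f}{f}(w)\right\} f(v)f(w)\,dv\,dw,$$ where $a_{ij}(z)=|z|^{-1}\Pi_{ij}(z)$ and $\Pi_{ij}(z)=\delta_{ij}-\frac{z_iz_j}{|z|^2}$. *)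

theory Defs
  imports "HOL-Analysis.Analysis"
begin

definition jbracket :: "real^3 \<Rightarrow> real" where
  "jbracket v = sqrt (1 + (norm v)\<^sup>2)"

definition maxwellian :: "real^3 \<Rightarrow> real" where
  "maxwellian v = (2 * pi) powr (-3/2) * exp (- (norm v)\<^sup>2 / 2)"

(* For f \<ge> 0 the moment is an extended nonnegative number: it may be infinite. *)
definition moment :: "real \<Rightarrow> (real^3 \<Rightarrow> real) \<Rightarrow> ennreal" where
  "moment l f = (\<integral>\<^sup>+ v. ennreal (jbracket v powr l * f v) \<partial>lborel)"

(* Since ln 0 = 0, this uses the convention 0 log 0 = 0. *)
definition entropy :: "(real^3 \<Rightarrow> real) \<Rightarrow> real" where
  "entropy f = (LINT v|lborel. f v * ln (f v))"

(* phi is a compactly supported C^1 function with gradient psi. *)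
definition test_function :: "(real^3 \<Rightarrow> real) \<Rightarrow> (real^3 \<Rightarrow> real^3) \<Rightarrow> bool" where
  "test_function \<phi> \<psi> \<longleftrightarrow>
     (\<forall>v. GDERIV \<phi> v :> \<psi> v) \<and> continuous_on UNIV \<psi> \<and> compact (closure {v. \<phi> v \<noteq> 0})"

(* f lies in W^{1,1}_loc and has distributional gradient g.  Testing against compactly
   supported C^1 functions is, by mollification, the same as testing against smooth ones. *)
definition has_weak_gradient :: "(real^3 \<Rightarrow> real) \<Rightarrow> (real^3 \<Rightarrow> real^3) \<Rightarrow> bool" where
  "has_weak_gradient f g \<longleftrightarrow>
     (\<forall>K. compact K \<longrightarrow> set_integrable lborel K f \<and> set_integrable lborel K g) \<and>
     (\<forall>\<phi> \<psi>. test_function \<phi> \<psi> \<longrightarrow>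
        (LINT v|lborel. f v *\<^sub>R \<psi> v) = - (LINT v|lborel. \<phi> v *\<^sub>R g v))"

definition weakly_differentiable :: "(real^3 \<Rightarrow> real) \<Rightarrow> bool" where
  "weakly_differentiable f \<longleftrightarrow> (\<exists>g. has_weak_gradient f g)"

(* The weak gradient is unique up to null sets, so the choice of representative does not
   affect the integrals below. *)
definition weak_gradient :: "(real^3 \<Rightarrow> real) \<Rightarrow> real^3 \<Rightarrow> real^3" where
  "weak_gradient f = (SOME g. has_weak_gradient f g)"

definition landau_proj :: "real^3 \<Rightarrow> 3 \<Rightarrow> 3 \<Rightarrow> real" where
  "landau_proj z i j = (if i = j then 1 else 0) - z $ i * z $ j / (norm z)\<^sup>2"

definition landau_kernel :: "real^3 \<Rightarrow> 3 \<Rightarrow> 3 \<Rightarrow> real" where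
  "landau_kernel z i j = inverse (norm z) * landau_proj z i j"

lemma landau_kernel_nonneg:
  "0 \<le> (\<Sum>i\<in>UNIV. \<Sum>j\<in>UNIV. landau_kernel z i j * x $ i * x $ j)"
proof (cases "z = 0")
  case False
  have "(\<Sum>i\<in>UNIV. \<Sum>j\<in>UNIV. landau_kernel z i j * x $ i * x $ j)
      = inverse (norm z) * (x \<bullet> x - (z \<bullet> x)\<^sup>2 / (norm z)\<^sup>2)"
    by (simp add: landau_kernel_def landau_proj_def inner_vec_def sum_3 divide_inverse
        algebra_simps power2_eq_square)
  moreover have "(z \<bullet> x)\<^sup>2 / (norm z)\<^sup>2 \<le> x \<bullet> x"
    using Cauchy_Schwarz_ineq[of z x] False
    by (simp add: divide_le_eq power2_norm_eq_inner mult.commute)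
  ultimately show ?thesis by simp
qed (simp add: landau_kernel_def)

(* By landau_kernel_nonneg the double sum is nonnegative, so D(f) is a well-defined element
   of [0, infinity].  The sum has to stay under the integral: its individual terms are signed
   and need not be integrable.  On {f = 0} the factor f(v) f(w) makes the integrand vanish,
   whatever value the quotient takes. *)
definition entropy_dissipation :: "(real^3 \<Rightarrow> real) \<Rightarrow> ennreal" where
  "entropy_dissipation f =
     (\<integral>\<^sup>+ (v, w). ennreal (1/2 * (\<Sum>i\<in>UNIV. \<Sum>j\<in>UNIV.
          landau_kernel (v - w) i j
          * (weak_gradient f v $ i / f v - weak_gradient f w $ i / f w)
          * (weak_gradient f v $ j / f v - weak_gradient f w $ j / f w)
          * f v * f w)) \<partial>(lborel \<Otimes>\<^sub>M lborel))"

(* The entropy bound includes integrability of f log f: the second moment makes its negative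
   part integrable, so this is exactly finiteness of H(f). *)
definition admissible :: "real \<Rightarrow> (real^3 \<Rightarrow> real) \<Rightarrow> bool" where
  "admissible Hbar f \<longleftrightarrow>
     (\<forall>v. 0 \<le> f v) \<and> weakly_differentiable f \<and>
     has_bochner_integral lborel f 1 \<and>
     has_bochner_integral lborel (\<lambda>v. f v *\<^sub>R v) 0 \<and>
     has_bochner_integral lborel (\<lambda>v. f v * (norm v)\<^sup>2) 3 \<and>
     integrable lborel (\<lambda>v. f v * ln (f v)) \<and> entropy f \<le> Hbar"

end

theory Submission
  imports Defs "HOL-Probability.Distributions"
begin

text \<open>
  The proof joins two inequalities through the weighted Fisher information
  I(f) = integral of f |grad f / f + v|^2 <v>^(-3) of f relative to the Maxwellian mu.

  From dissipation to Fisher information (weighted_Fisher_information_bound).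
  Write b = grad f / f, z = v - w and x = b(v) - b(w).  The integrand of D(f) is
  |z|^(-3) times the squared area of the parallelogram spanned by z and x, hence it dominates
  |z|^(-3) q^2, where q = (z.a)(x.c) - (z.c)(x.a) for orthonormal a, c.  Multiplying q by
  (w.a) f(w) and integrating in w removes b(w): integration by parts turns grad f(w) into
  moments of f, and the normalisation of mass and momentum leaves only -(T_a (b.c) + v.c), where
  T_a is the temperature in the direction a and a, c are principal axes of the second moment of f.
  By Cauchy-Schwarz, with |z|^3 |w|^2 <= 8 <v>^3 <w>^5, the function T_a (b.c) + v.c is
  controlled in the space L^2(f <v>^(-3)) by M_5(f) D(f).  For a fixed axis c the two other axes
  both serve as a; comparing them bounds (T_a - T_a') (v.c), so that the three temperatures, whose
  sum is 3, are all close to 1, and b.c + v.c is controlled as well.  The entropy bound enters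
  only here: it prevents f from concentrating near a plane through the origin
  (directional_spread_lower_bound), which bounds T_a and the weighted integral of (v.c)^2 f
  from below.

  From Fisher information to entropy (log_Sobolev_weak).  The measure <v>^(-3) mu has the density
  exp(-V) up to a constant, with V = |v|^2/2 + (3/2) log(1 + |v|^2), and the Hessian of V is at
  least 5/8.  A uniformly convex potential gives a logarithmic Sobolev inequality by mass
  transport.  A triangular (Knothe) map between densities on a cube is enough, because only the
  diagonal of its Jacobian matrix occurs in the entropy inequality; it is built one coordinate at a
  time from monotone rearrangements of the line (transport_step), and on a cube every
  rearrangement fixes the end points, so no boundary terms appear.  Mollification and exhaustion
  by cubes extend the inequality from positive C^1 functions to weakly differentiable densities.
  The joint convexity of |k|^2/h makes mollification harmless for the Fisher information, once the
  weak gradient is known to vanish where the density does (weak_gradient_eq_0_on_zero_set); the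
  same fact justifies grad f = f b in the integration by parts above.

  The second bound follows from the first: the integrand of the weighted relative entropy without
  its weight is nonnegative, and <v>^(-3) >= R^(-3) where <v> < R.
\<close>

section \<open>Monotone rearrangement on an interval\<close>

lemma integral_pos_continuous:
  fixes r :: "real \<Rightarrow> real"
  assumes ab: "a < b" and r: "continuous_on {a..b} r" "\<And>x. x \<in> {a..b} \<Longrightarrow> 0 < r x"
  shows "0 < integral {a..b} r"
proof -
  have "integral {a..b} r \<ge> 0"
    using r by (intro integral_nonneg integrable_continuous_interval) (auto simp: less_imp_le)
  moreover have "integral {a..b} r \<noteq> 0"
  proof
    assume "integral {a..b} r = 0"
    hence "\<forall>x\<in>{a..b}. r x = 0"
      using integral_eq_0_iff[of a b r] r ab by (auto simp: less_imp_le)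
    with r(2)[of a] ab show False by auto
  qed
  ultimately show ?thesis by simp
qed

text \<open>
  T is the monotone map that transports p to q, both normalised to mass one, so that
  T' = (p / P) / (q(T) / Q).  Since ln T' <= T' - 1, the relative entropy of the densities along T is at
  most the integral of p (T' - 1), which integration by parts turns into minus the integral of
  p' (T - x).  The boundary terms vanish because T fixes both end points.
\<close>

lemma rearrangement_entropy_inequality:
  fixes p q p' :: "real \<Rightarrow> real"
  assumes ab: "a < b"
    and p: "continuous_on {a..b} p" "\<And>x. x \<in> {a..b} \<Longrightarrow> 0 < p x"
    and q: "continuous_on {a..b} q" "\<And>x. x \<in> {a..b} \<Longrightarrow> 0 < q x"
    and p': "continuous_on {a..b} p'"
      "\<And>x. x \<in> {a..b} \<Longrightarrow> (p has_real_derivative p' x) (at x within {a..b})"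
  obtains T where "continuous_on {a..b} T" "\<And>x. x \<in> {a..b} \<Longrightarrow> T x \<in> {a..b}"
    "integral {a..b} (\<lambda>x. p x * (ln (p x / integral {a..b} p) - ln (q (T x) / integral {a..b} q))
        + p' x * (T x - x)) \<le> 0"
proof -
  define P where "P = integral {a..b} p"
  define Q where "Q = integral {a..b} q"
  define \<Psi> where "\<Psi> x = integral {a..x} p / P" for x
  define \<Phi> where "\<Phi> x = integral {a..x} q / Q" for x
  have intp: "p integrable_on {a..b}" and intq: "q integrable_on {a..b}"
    by (auto intro: integrable_continuous_interval p q)
  have P: "P > 0" and Q: "Q > 0" unfolding P_def Q_def by (intro integral_pos_continuous ab p q; simp)+
  have der: "((\<lambda>x. integral {a..x} r / R) has_real_derivative r x / R) (at x within {a..b})"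
    if "continuous_on {a..b} r" "x \<in> {a..b}" for r :: "real \<Rightarrow> real" and R x
    by (intro DERIV_cdivide integral_has_real_derivative that)
  have contPhi: "continuous_on {a..b} \<Phi>" and contPsi: "continuous_on {a..b} \<Psi>"
    unfolding \<Phi>_def \<Psi>_def
    by (rule DERIV_continuous_on, rule der[OF q(1)], assumption)
       (rule DERIV_continuous_on, rule der[OF p(1)], assumption)
  have mono: "integral {a..x} r / R < integral {a..y} r / R"
    if "continuous_on {a..b} r" "\<And>x. x \<in> {a..b} \<Longrightarrow> 0 < r x" "a \<le> x" "x < y" "y \<le> b" "R > 0"
    for r :: "real \<Rightarrow> real" and R x y
  proof (rule DERIV_pos_imp_increasing_open[OF \<open>x < y\<close>])
    fix u assume "x < u" "u < y"
    then have "u \<in> {a<..<b}" using that by auto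
    then show "\<exists>d. ((\<lambda>x. integral {a..x} r / R) has_real_derivative d) (at u) \<and> 0 < d"
      using der[OF that(1), of u R] that(2)[of u] \<open>R > 0\<close>
      by (intro exI[of _ "r u / R"]) (auto simp: at_within_Icc_at)
  next
    have "continuous_on {a..b} (\<lambda>x. integral {a..x} r / R)"
      by (rule DERIV_continuous_on) (rule der[OF that(1)])
    then show "continuous_on {x..y} (\<lambda>x. integral {a..x} r / R)"
      by (rule continuous_on_subset) (use that in auto)
  qed
  have Phi_mono: "\<Phi> x < \<Phi> y" if "a \<le> x" "x < y" "y \<le> b" for x y
    unfolding \<Phi>_def using mono[OF q that Q] .
  have Psi_mono: "\<Psi> x < \<Psi> y" if "a \<le> x" "x < y" "y \<le> b" for x y
    unfolding \<Psi>_def using mono[OF p that P] .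
  have ends: "\<Phi> a = 0" "\<Phi> b = 1" "\<Psi> a = 0" "\<Psi> b = 1"
    using P Q by (auto simp: \<Phi>_def \<Psi>_def P_def Q_def)
  have inj: "inj_on \<Phi> {a..b}"
    by (intro linorder_inj_onI) (use Phi_mono in \<open>force\<close>)+
  have img: "\<Phi> ` {a..b} = {0..1}"
  proof
    show "\<Phi> ` {a..b} \<subseteq> {0..1}"
    proof safe
      fix x assume "x \<in> {a..b}"
      with Phi_mono[of a x] Phi_mono[of x b] ends show "\<Phi> x \<in> {0..1}"
        by (cases "x = a"; cases "x = b") auto
    qed
    show "{0..1} \<subseteq> \<Phi> ` {a..b}"
    proof
      fix y :: real assume "y \<in> {0..1}"
      with IVT'[of \<Phi> a y b] ends contPhi ab show "y \<in> \<Phi> ` {a..b}" by (force)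
    qed
  qed
  define T where "T x = the_inv_into {a..b} \<Phi> (\<Psi> x)" for x
  have Psi01: "\<Psi> x \<in> {0..1}" if "x \<in> {a..b}" for x
    using Psi_mono[of a x] Psi_mono[of x b] ends that
    by (cases "x = a"; cases "x = b") auto
  have T_in: "T x \<in> {a..b}" and T_eq: "\<Phi> (T x) = \<Psi> x" if "x \<in> {a..b}" for x
    using Psi01[OF that] unfolding img[symmetric] T_def
    by (rule the_inv_into_into[OF inj _ order_refl], rule f_the_inv_into_f[OF inj])
  have Ta: "T a = a" "T b = b"
    using the_inv_into_f_f[OF inj, of a] the_inv_into_f_f[OF inj, of b] ab ends
    by (auto simp: T_def)
  have cinv: "continuous_on {0..1} (the_inv_into {a..b} \<Phi>)"
    using continuous_on_inv_into[OF contPhi compact_Icc inj] img by simp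
  have contT: "continuous_on {a..b} T"
    unfolding T_def
    by (rule continuous_on_compose2[OF cinv contPsi]) (use Psi01 in auto)
  define T' where "T' x = (p x / P) / (q (T x) / Q)" for x
  have derT: "(T has_real_derivative T' x) (at x)" if x: "x \<in> {a<..<b}" for x
  proof -
    have xI: "x \<in> {a..b}" using x by auto
    have px: "\<Psi> x \<in> {0<..<1}"
      using Psi_mono[of a x] Psi_mono[of x b] ends x by auto
    have Tx: "T x \<in> {a<..<b}"
      using T_in[OF xI] T_eq[OF xI] px ends by (cases "T x = a"; cases "T x = b") auto
    have d\<Phi>: "(\<Phi> has_real_derivative q (T x) / Q) (at (T x))"
      using der[OF q(1) T_in[OF xI], of Q] Tx by (auto simp: \<Phi>_def[abs_def] at_within_Icc_at)
    have inv: "(the_inv_into {a..b} \<Phi> has_real_derivative inverse (q (T x) / Q)) (at (\<Psi> x))"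
    proof (rule DERIV_inverse_function[where a=0 and b=1 and f=\<Phi>])
      show "(\<Phi> has_real_derivative q (T x) / Q) (at (the_inv_into {a..b} \<Phi> (\<Psi> x)))"
        using d\<Phi> by (simp add: T_def)
      show "q (T x) / Q \<noteq> 0" using q(2)[OF T_in[OF xI]] Q by auto
      show "\<Phi> (the_inv_into {a..b} \<Phi> y) = y" if "0 < y" "y < 1" for y
        using that by (intro f_the_inv_into_f inj) (auto simp: img)
      show "isCont (the_inv_into {a..b} \<Phi>) (\<Psi> x)"
        using continuous_on_interior[OF cinv] px by simp
    qed (use px in auto)
    have d\<Psi>: "(\<Psi> has_real_derivative p x / P) (at x)"
      using der[OF p(1) xI, of P] x by (auto simp: \<Psi>_def[abs_def] at_within_Icc_at)
    show ?thesis
      using DERIV_chain2[OF inv d\<Psi>] by (simp add: T_def[abs_def] T'_def divide_inverse mult.commute)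
  qed
  have contT': "continuous_on {a..b} T'"
    unfolding T'_def
    using P Q q(2)[OF T_in]
    by (intro continuous_intros p continuous_on_compose2[OF q(1) contT]) (use T_in in force)+
  \<comment> \<open>Derivatives are only available inside the interval: the inverse of the distribution
    function of q is differentiated at interior points.\<close>
  have "((\<lambda>x. p' x * (T x - x) + p x * (T' x - 1)) has_integral
      (p b * (T b - b) - p a * (T a - a))) {a..b}"
  proof (rule fundamental_theorem_of_calculus_interior)
    show "continuous_on {a..b} (\<lambda>x. p x * (T x - x))"
      by (intro continuous_intros p contT)
    fix x assume x: "x \<in> {a<..<b}"
    have "(p has_real_derivative p' x) (at x)"
      using p'(2)[of x] x by (auto simp: at_within_Icc_at)
    then show "((\<lambda>x. p x * (T x - x)) has_vector_derivative p' x * (T x - x) + p x * (T' x - 1)) (at x)"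
      unfolding has_real_derivative_iff_has_vector_derivative[symmetric]
      by (auto intro!: derivative_eq_intros derT x)
  qed (use ab in auto)
  then have I0: "((\<lambda>x. p' x * (T x - x) + p x * (T' x - 1)) has_integral 0) {a..b}"
    by (simp add: Ta)
  have le: "p x * (ln (p x / P) - ln (q (T x) / Q)) \<le> p x * (T' x - 1)" if "x \<in> {a..b}" for x
  proof -
    have "ln (p x / P) - ln (q (T x) / Q) = ln (T' x)"
      unfolding T'_def using p(2)[OF that] q(2)[OF T_in[OF that]] P Q
      by (intro ln_divide_pos[symmetric]) auto
    also have "\<dots> \<le> T' x - 1"
      using p(2)[OF that] q(2)[OF T_in[OF that]] P Q
      by (intro ln_le_minus_one) (auto simp: T'_def)
    finally show ?thesis using p(2)[OF that] by simp
  qed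
  have "integral {a..b} (\<lambda>x. p x * (ln (p x / P) - ln (q (T x) / Q)) + p' x * (T x - x)) \<le>
      integral {a..b} (\<lambda>x. p' x * (T x - x) + p x * (T' x - 1))"
  proof (rule integral_le)
    have qT: "continuous_on {a..b} (\<lambda>x. q (T x))"
      by (rule continuous_on_compose2[OF q(1) contT]) (use T_in in auto)
    have "continuous_on {a..b} (\<lambda>x. p x * (ln (p x / P) - ln (q (T x) / Q)) + p' x * (T x - x))"
      using P Q p(2) q(2)[OF T_in]
      by (intro continuous_intros p p' contT qT) (force)+
    then show "(\<lambda>x. p x * (ln (p x / P) - ln (q (T x) / Q)) + p' x * (T x - x)) integrable_on {a..b}"
      by (rule integrable_continuous_interval)
    show "(\<lambda>x. p' x * (T x - x) + p x * (T' x - 1)) integrable_on {a..b}"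
      using I0 by blast
    show "p x * (ln (p x / P) - ln (q (T x) / Q)) + p' x * (T x - x) \<le> p' x * (T x - x) + p x * (T' x - 1)"
      if "x \<in> {a..b}" for x using le[OF that] by simp
  qed
  also have "\<dots> = 0" using I0 by (rule integral_unique)
  finally show ?thesis using that[OF contT T_in] by (simp add: P_def Q_def)
qed

text \<open>
  One coordinate of the Knothe argument.  The premise transport bounds, for every possible image
  y of x, what remains of the entropy after the coordinates below have been integrated out, and
  the premise square completes the square in the displacement.  Choosing y = T x with the
  rearrangement T and integrating in x eliminates T from the conclusion, so that T never has to
  be considered as a function of further variables.
\<close>

lemma transport_step:
  fixes p q p' A m S :: "real \<Rightarrow> real"
  assumes ab: "a < b"
    and p: "continuous_on {a..b} p" "\<And>x. x \<in> {a..b} \<Longrightarrow> 0 < p x"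
    and q: "continuous_on {a..b} q" "\<And>x. x \<in> {a..b} \<Longrightarrow> 0 < q x"
    and p': "continuous_on {a..b} p'"
      "\<And>x. x \<in> {a..b} \<Longrightarrow> (p has_real_derivative p' x) (at x within {a..b})"
    and cont: "continuous_on {a..b} A" "continuous_on {a..b} m" "continuous_on {a..b} S"
    and transport: "\<And>x y. x \<in> {a..b} \<Longrightarrow> y \<in> {a..b} \<Longrightarrow>
        A x + p x * ln (q y) + m x * (y - x) + c / 2 * p x * (y - x)\<^sup>2 \<le> 0"
    and square: "\<And>x t. x \<in> {a..b} \<Longrightarrow> 0 \<le> (m x + p' x) * t + c / 2 * p x * t\<^sup>2 + S x"
  shows "integral {a..b} (\<lambda>x. A x + p x * ln (p x) - S x)
      \<le> integral {a..b} p * ln (integral {a..b} p) - integral {a..b} p * ln (integral {a..b} q)"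
proof -
  define P where "P = integral {a..b} p"
  define Q where "Q = integral {a..b} q"
  obtain T where T: "continuous_on {a..b} T" "\<And>x. x \<in> {a..b} \<Longrightarrow> T x \<in> {a..b}"
    and le0: "integral {a..b} (\<lambda>x. p x * (ln (p x / P) - ln (q (T x) / Q)) + p' x * (T x - x)) \<le> 0"
    unfolding P_def Q_def
    using rearrangement_entropy_inequality[OF ab p q p'] by blast
  have P: "P > 0" and Q: "Q > 0" unfolding P_def Q_def by (intro integral_pos_continuous ab p q; simp)+
  have qT: "continuous_on {a..b} (\<lambda>x. q (T x))"
    by (rule continuous_on_compose2[OF q(1) T(1)]) (use T in auto)
  let ?f = "\<lambda>x. p x * (ln (p x / P) - ln (q (T x) / Q)) + p' x * (T x - x)"
  have c1: "continuous_on {a..b} ?f"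
    using P Q p(2) q(2)[OF T(2)]
    by (intro continuous_intros p p' T qT) (force)+
  have "integral {a..b} (\<lambda>x. A x + p x * ln (p x) - S x - (ln P - ln Q) * p x) \<le> integral {a..b} ?f"
  proof (intro integral_le integrable_continuous_interval c1)
    show "continuous_on {a..b} (\<lambda>x. A x + p x * ln (p x) - S x - (ln P - ln Q) * p x)"
      using p(2) by (intro continuous_intros cont p) force+
    fix x assume x: "x \<in> {a..b}"
    have e: "ln (p x / P) - ln (q (T x) / Q) = ln (p x) - ln P - ln (q (T x)) + ln Q"
      using p(2)[OF x] q(2)[OF T(2)[OF x]] P Q by (simp add: ln_divide_pos)
    show "A x + p x * ln (p x) - S x - (ln P - ln Q) * p x \<le> ?f x"
      unfolding e using transport[OF x T(2)[OF x]] square[OF x, of "T x - x"]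
      by (simp add: algebra_simps)
  qed
  also have "\<dots> \<le> 0" by (rule le0)
  finally have "integral {a..b} (\<lambda>x. A x + p x * ln (p x) - S x - (ln P - ln Q) * p x) \<le> 0" .
  moreover have "integral {a..b} (\<lambda>x. A x + p x * ln (p x) - S x - (ln P - ln Q) * p x)
      = integral {a..b} (\<lambda>x. A x + p x * ln (p x) - S x) - (ln P - ln Q) * P"
    unfolding P_def[symmetric]
    by (subst integral_diff)
      (use p(2) in \<open>force intro!: integrable_continuous_interval continuous_intros cont p simp: P_def\<close>)+
  ultimately show ?thesis by (simp add: P_def Q_def algebra_simps)
qed

section \<open>Knothe transport on a cube\<close>

text \<open>
  Iterated integrals over a cube are taken one real variable at a time, and continuity is recorded
  for the uncurried functions so that parameter integrals inherit it.
\<close>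

definition cont3 :: "real set \<Rightarrow> (real \<Rightarrow> real \<Rightarrow> real \<Rightarrow> real) \<Rightarrow> bool" where
  "cont3 I f \<longleftrightarrow> continuous_on (I \<times> I \<times> I) (\<lambda>p. f (fst p) (fst (snd p)) (snd (snd p)))"

definition cont2 :: "real set \<Rightarrow> (real \<Rightarrow> real \<Rightarrow> real) \<Rightarrow> bool" where
  "cont2 I f \<longleftrightarrow> continuous_on (I \<times> I) (\<lambda>p. f (fst p) (snd p))"

lemma cont3_slice1: "cont3 I f \<Longrightarrow> x \<in> I \<Longrightarrow> cont2 I (f x)"
  unfolding cont3_def cont2_def
  by (rule continuous_on_compose2[where f="\<lambda>p. (x, p)"
      and g="\<lambda>p. f (fst p) (fst (snd p)) (snd (snd p))", simplified])
     (auto intro!: continuous_intros)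

lemma cont3_slice2: "cont3 I f \<Longrightarrow> y \<in> I \<Longrightarrow> cont2 I (\<lambda>x. f x y)"
  unfolding cont3_def cont2_def
  by (rule continuous_on_compose2[where f="\<lambda>p. (fst p, y, snd p)"
      and g="\<lambda>p. f (fst p) (fst (snd p)) (snd (snd p))", simplified])
     (auto intro!: continuous_intros)

lemma cont2_slice: "cont2 I f \<Longrightarrow> x \<in> I \<Longrightarrow> continuous_on I (f x)"
  unfolding cont2_def
  by (rule continuous_on_compose2[where f="\<lambda>y. (x, y)" and g="\<lambda>p. f (fst p) (snd p)", simplified])
     (auto intro!: continuous_intros)

lemma cont2_integral: "cont2 {a..b} f \<Longrightarrow> continuous_on {a..b} (\<lambda>x. integral {a..b} (f x))"
  using integral_continuous_on_param[of "{a..b}" a b f] unfolding cont2_def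
  by (simp add: split_beta)

lemma cont3_integral:
  assumes "cont3 {a..b} f"
  shows "cont2 {a..b} (\<lambda>x y. integral {a..b} (f x y))"
proof -
  have "continuous_on (({a..b} \<times> {a..b}) \<times> cbox a b) (\<lambda>(p, t). f (fst p) (snd p) t)"
    unfolding split_beta
    using assms unfolding cont3_def
    by (rule continuous_on_compose2[where f="\<lambda>q. (fst (fst q), snd (fst q), snd q)"
      and g="\<lambda>p. f (fst p) (fst (snd p)) (snd (snd p))", simplified])
     (auto intro!: continuous_intros)
  from integral_continuous_on_param[OF this] show ?thesis
    unfolding cont2_def by simp
qed

lemma integral_quadratic:
  fixes B U F :: "real \<Rightarrow> real"
  assumes "continuous_on {a..b} B" "continuous_on {a..b} U" "continuous_on {a..b} F"
  shows "integral {a..b} (\<lambda>z. B z + U z * s + F z * t) =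
    integral {a..b} B + integral {a..b} U * s + integral {a..b} F * t"
  using assms
  by (intro integral_unique has_integral_add has_integral_mult_left integrable_integral
      integrable_continuous_interval)

text \<open>
  The entropy of F relative to exp(-V) on a cube, bounded by the masses and the sum of the
  (F_i + F V_i)^2 / (2 c F).  The marginals of F and of G = exp(-V) in the first
  coordinates take the role of p and q in transport_step, which is applied in the order
  third, second, first coordinate; the points x', y', z' stand for the images under the triangular
  map.  The convexity of V supplies the inequality at the innermost level, and at each level the
  quadratic term c/2 (displacement)^2 absorbs the displacement of the coordinate that is integrated.
\<close>

lemma cube_transport_inequality:
  fixes F F1 F2 F3 V V1 V2 V3 :: "real \<Rightarrow> real \<Rightarrow> real \<Rightarrow> real" and a b c :: real
  defines "I \<equiv> {a..b}"
  defines "S \<equiv> \<lambda>G x y z. (G x y z)\<^sup>2 / (2 * c * F x y z)"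
  assumes ab: "a < b" and c: "c > 0"
    and F: "cont3 I F" "\<And>x y z. x \<in> I \<Longrightarrow> y \<in> I \<Longrightarrow> z \<in> I \<Longrightarrow> 0 < F x y z"
    and F123: "cont3 I F1" "cont3 I F2" "cont3 I F3"
    and V: "cont3 I V" and V123: "cont3 I V1" "cont3 I V2" "cont3 I V3"
    and dF1: "\<And>x y z. x \<in> I \<Longrightarrow> y \<in> I \<Longrightarrow> z \<in> I \<Longrightarrow>
        ((\<lambda>x. F x y z) has_real_derivative F1 x y z) (at x within I)"
    and dF2: "\<And>x y z. x \<in> I \<Longrightarrow> y \<in> I \<Longrightarrow> z \<in> I \<Longrightarrow>
        ((\<lambda>y. F x y z) has_real_derivative F2 x y z) (at y within I)"
    and dF3: "\<And>x y z. x \<in> I \<Longrightarrow> y \<in> I \<Longrightarrow> z \<in> I \<Longrightarrow>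
        ((\<lambda>z. F x y z) has_real_derivative F3 x y z) (at z within I)"
    and convex: "\<And>x y z x' y' z'. x \<in> I \<Longrightarrow> y \<in> I \<Longrightarrow> z \<in> I \<Longrightarrow> x' \<in> I \<Longrightarrow> y' \<in> I \<Longrightarrow> z' \<in> I \<Longrightarrow>
        V x y z + V1 x y z * (x' - x) + V2 x y z * (y' - y) + V3 x y z * (z' - z)
          + c / 2 * ((x' - x)\<^sup>2 + (y' - y)\<^sup>2 + (z' - z)\<^sup>2) \<le> V x' y' z'"
  shows "integral I (\<lambda>x. integral I (\<lambda>y. integral I (\<lambda>z.
           F x y z * ln (F x y z) + F x y z * V x y z
            - S (\<lambda>x y z. F3 x y z + F x y z * V3 x y z) x y z
            - S (\<lambda>x y z. F2 x y z + F x y z * V2 x y z) x y z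
            - S (\<lambda>x y z. F1 x y z + F x y z * V1 x y z) x y z)))
     \<le> integral I (\<lambda>x. integral I (\<lambda>y. integral I (F x y)))
         * ln (integral I (\<lambda>x. integral I (\<lambda>y. integral I (F x y))))
       - integral I (\<lambda>x. integral I (\<lambda>y. integral I (F x y)))
         * ln (integral I (\<lambda>x. integral I (\<lambda>y. integral I (\<lambda>z. exp (- V x y z)))))"
proof -
  define S1 where "S1 = S (\<lambda>x y z. F1 x y z + F x y z * V1 x y z)"
  define S2 where "S2 = S (\<lambda>x y z. F2 x y z + F x y z * V2 x y z)"
  define S3 where "S3 = S (\<lambda>x y z. F3 x y z + F x y z * V3 x y z)"
  define G where "G x y z = exp (- V x y z)" for x y z
  define FF where "FF x y = integral I (F x y)" for x y
  define FFF where "FFF x = integral I (FF x)" for x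
  define GG where "GG x y = integral I (G x y)" for x y
  define GGG where "GGG x = integral I (GG x)" for x
  have Ie: "I = {a..b}" by (simp add: I_def)
  note Fc = F(1)[unfolded cont3_def] and F1c = F123(1)[unfolded cont3_def]
    and F2c = F123(2)[unfolded cont3_def] and F3c = F123(3)[unfolded cont3_def]
    and Vc = V[unfolded cont3_def] and V1c = V123(1)[unfolded cont3_def]
    and V2c = V123(2)[unfolded cont3_def] and V3c = V123(3)[unfolded cont3_def]
  have Fne: "\<And>p. p \<in> I \<times> I \<times> I \<Longrightarrow> F (fst p) (fst (snd p)) (snd (snd p)) \<noteq> 0"
    using F(2) by force
  have S: "cont3 I S1" "cont3 I S2" "cont3 I S3"
    unfolding S1_def S2_def S3_def S_def cont3_def
    using Fne c by (auto intro!: continuous_intros Fc F1c F2c F3c V1c V2c V3c)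
  note Sc = S[unfolded cont3_def]
  have FL: "cont3 I (\<lambda>x y z. F x y z * ln (F x y z))"
    unfolding cont3_def using Fne by (auto intro!: continuous_intros Fc)
  note FLc = FL[unfolded cont3_def]
  have G: "cont3 I G" unfolding G_def[abs_def] cont3_def by (intro continuous_intros Vc)
  have Gpos: "G x y z > 0" for x y z by (simp add: G_def)
  have FV: "cont3 I (\<lambda>x y z. F x y z * V x y z)" "cont3 I (\<lambda>x y z. F x y z * V1 x y z)"
    "cont3 I (\<lambda>x y z. F x y z * V2 x y z)" "cont3 I (\<lambda>x y z. F x y z * V3 x y z)"
    unfolding cont3_def by (intro continuous_intros Fc Vc V1c V2c V3c)+
  note FVc = FV[unfolded cont3_def]
  note int2 = cont3_integral[where a=a and b=b, folded Ie]
  note int1 = cont2_integral[where a=a and b=b, folded Ie]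
  have FF: "cont2 I FF" and GG: "cont2 I GG"
    unfolding FF_def[abs_def] GG_def[abs_def] by (intro int2 F G)+
  have FFF: "continuous_on I FFF" and GGG: "continuous_on I GGG"
    unfolding FFF_def[abs_def] GGG_def[abs_def] by (intro int1 FF GG)+
  note pos = integral_pos_continuous[OF ab, folded Ie]
  have FFpos: "FF x y > 0" if "x \<in> I" "y \<in> I" for x y
    unfolding FF_def using that F by (intro pos cont2_slice[OF cont3_slice1]) auto
  have GGpos: "GG x y > 0" if "x \<in> I" "y \<in> I" for x y
    unfolding GG_def using that G Gpos by (intro pos cont2_slice[OF cont3_slice1]) auto
  have FFFpos: "FFF x > 0" if "x \<in> I" for x
    unfolding FFF_def using that FF FFpos by (intro pos cont2_slice) auto
  have GGGpos: "GGG x > 0" if "x \<in> I" for x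
    unfolding GGG_def using that GG GGpos by (intro pos cont2_slice) auto
  note sl = cont2_slice[OF cont3_slice1]
  have square: "0 \<le> (U * V' + W) * t + c / 2 * U * t\<^sup>2 + (W + U * V')\<^sup>2 / (2 * c * U)"
    if "U > 0" for U V' W t :: real
  proof -
    have "(U * V' + W) * t + c / 2 * U * t\<^sup>2 + (W + U * V')\<^sup>2 / (2 * c * U)
       = ((W + U * V') + c * U * t)\<^sup>2 / (2 * c * U)"
      using that c by (simp add: field_simps power2_eq_square)
    also have "\<dots> \<ge> 0" using that c by simp
    finally show ?thesis .
  qed
  \<comment> \<open>Here the images x' and y' of the first two coordinates are still free parameters.\<close>
  define B2 where "B2 x x' y z =
    F x y z * (V x y z + V1 x y z * (x' - x) + c / 2 * (x' - x)\<^sup>2) + F x y z * ln (F x y z) - S3 x y z"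
    for x x' y z
  have B2: "cont2 I (B2 x x')" if "x \<in> I" for x x'
    unfolding cont2_def B2_def
    by (intro continuous_intros that cont3_slice1[OF FL, unfolded cont2_def]
        cont3_slice1[OF S(3), unfolded cont2_def] cont3_slice1[OF F(1), unfolded cont2_def]
        cont3_slice1[OF V, unfolded cont2_def] cont3_slice1[OF V123(1), unfolded cont2_def])
  have level3: "integral I (B2 x x' y) + integral I (\<lambda>z. F x y z * V2 x y z) * (y' - y)
       + FF x y * (c / 2 * (y' - y)\<^sup>2) \<le> FF x y * ln (FF x y) - FF x y * ln (GG x' y')"
    if x: "x \<in> I" and y: "y \<in> I" and x': "x' \<in> I" and y': "y' \<in> I" for x y x' y'
  proof -
    define A where "A z = F x y z * (V x y z + V1 x y z * (x' - x) + V2 x y z * (y' - y)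
      + c / 2 * ((x' - x)\<^sup>2 + (y' - y)\<^sup>2))" for z
    have cA: "continuous_on I A"
      unfolding A_def
      by (intro continuous_intros sl[OF F(1) x y] sl[OF V x y] sl[OF V123(1) x y] sl[OF V123(2) x y])
    have "integral I (\<lambda>z. A z + F x y z * ln (F x y z) - S3 x y z)
        \<le> integral I (F x y) * ln (integral I (F x y)) - integral I (F x y) * ln (integral I (G x' y'))"
    proof (rule transport_step[where a=a and b=b and p'="F3 x y" and m="\<lambda>z. F x y z * V3 x y z" and c=c, folded Ie])
      fix z z' assume z: "z \<in> I" "z' \<in> I"
      have "F x y z * (V x y z + V1 x y z * (x' - x) + V2 x y z * (y' - y) + V3 x y z * (z' - z)
          + c / 2 * ((x' - x)\<^sup>2 + (y' - y)\<^sup>2 + (z' - z)\<^sup>2)) \<le> F x y z * V x' y' z'"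
        using convex[OF x y z(1) x' y' z(2)] F(2)[OF x y z(1)] by simp
      then show "A z + F x y z * ln (G x' y' z') + F x y z * V3 x y z * (z' - z)
          + c / 2 * F x y z * (z' - z)\<^sup>2 \<le> 0"
        by (simp add: A_def G_def algebra_simps)
    next
      fix z t assume z: "z \<in> I"
      show "0 \<le> (F x y z * V3 x y z + F3 x y z) * t + c / 2 * F x y z * t\<^sup>2 + S3 x y z"
        using square[OF F(2)[OF x y z]] by (simp add: S3_def S_def)
    qed (use ab F G F123 V123 S FV Gpos dF3 x y x' y' in \<open>auto intro: sl cA\<close>)
    also have "(\<lambda>z. A z + F x y z * ln (F x y z) - S3 x y z) =
      (\<lambda>z. B2 x x' y z + (F x y z * V2 x y z) * (y' - y) + F x y z * (c / 2 * (y' - y)\<^sup>2))"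
      by (auto simp: fun_eq_iff A_def B2_def algebra_simps)
    also have "integral I \<dots> = integral I (B2 x x' y) + integral I (\<lambda>z. F x y z * V2 x y z) * (y' - y)
       + integral I (F x y) * (c / 2 * (y' - y)\<^sup>2)"
      unfolding Ie
      by (rule integral_quadratic; fold Ie) (intro cont2_slice[OF B2] sl[OF FV(3)] sl[OF F(1)] x y)+
    finally show ?thesis by (simp add: FF_def GG_def)
  qed
  \<comment> \<open>The marginal of F in the first two coordinates is differentiated under the integral, so that
    the square is completed after integration in z.\<close>
  define B1 where "B1 x y z =
    F x y z * V x y z + F x y z * ln (F x y z) - S3 x y z - S2 x y z" for x y z
  have B1: "cont3 I B1"
    unfolding cont3_def B1_def by (intro continuous_intros FVc FLc Sc)
  have level2: "integral I (\<lambda>y. integral I (B1 x y))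
       + integral I (\<lambda>y. integral I (\<lambda>z. F x y z * V1 x y z)) * (x' - x)
       + FFF x * (c / 2 * (x' - x)\<^sup>2) \<le> FFF x * ln (FFF x) - FFF x * ln (GGG x')"
    if x: "x \<in> I" and x': "x' \<in> I" for x x'
  proof -
    let ?A = "\<lambda>y. integral I (B2 x x' y) - FF x y * ln (FF x y)"
    have cB2: "continuous_on I (\<lambda>y. integral I (B2 x x' y))" by (rule int1[OF B2[OF x]])
    have cL: "continuous_on I (\<lambda>y. FF x y * ln (FF x y))"
      using FFpos[OF x] by (auto intro!: continuous_intros cont2_slice[OF FF x] simp: less_imp_neq[symmetric])
    have cS2: "continuous_on I (\<lambda>y. integral I (S2 x y))" by (intro int1 cont3_slice1 S x)
    have "integral I (\<lambda>y. ?A y + FF x y * ln (FF x y) - integral I (S2 x y))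
        \<le> integral I (FF x) * ln (integral I (FF x)) - integral I (FF x) * ln (integral I (GG x'))"
    proof (rule transport_step[where a=a and b=b and p'="\<lambda>y. integral I (F2 x y)"
          and m="\<lambda>y. integral I (\<lambda>z. F x y z * V2 x y z)" and c=c, folded Ie])
      show "continuous_on I (\<lambda>y. integral I (F2 x y))"
        "continuous_on I (\<lambda>y. integral I (\<lambda>z. F x y z * V2 x y z))"
        by (intro int1 cont3_slice1 F123 FV x)+
      show "continuous_on I ?A" by (intro continuous_intros cB2 cL)
      show "(FF x has_real_derivative integral I (F2 x y)) (at y within I)" if y: "y \<in> I" for y
        unfolding FF_def[abs_def]
      proof (rule leibniz_rule_field_derivative[where a="a::real" and b=b and 'a=real, unfolded cbox_interval, folded Ie])
        show "continuous_on (I \<times> I) (\<lambda>(y, z). F2 x y z)"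
          using cont3_slice1[OF F123(2) x] by (simp add: cont2_def split_beta)
        show "F x y integrable_on I" if "y \<in> I" for y
          unfolding Ie by (rule integrable_continuous_interval) (use sl[OF F(1) x that] Ie in simp)
      qed (use dF2 x y in \<open>auto simp: Ie\<close>)
    next
      fix y y' assume y: "y \<in> I" "y' \<in> I"
      show "?A y + FF x y * ln (GG x' y') + integral I (\<lambda>z. F x y z * V2 x y z) * (y' - y)
          + c / 2 * FF x y * (y' - y)\<^sup>2 \<le> 0"
        using level3[OF x y(1) x' y(2)] by (simp add: algebra_simps)
    next
      fix y t assume y: "y \<in> I"
      have "0 \<le> integral I (\<lambda>z. S2 x y z + (F x y z * V2 x y z + F2 x y z) * t + F x y z * (c / 2 * t\<^sup>2))"
      proof (rule integral_nonneg)
        show "(\<lambda>z. S2 x y z + (F x y z * V2 x y z + F2 x y z) * t + F x y z * (c / 2 * t\<^sup>2)) integrable_on I"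
          unfolding Ie by (rule integrable_continuous_interval; fold Ie)
            (intro continuous_intros sl[OF S(2)] sl[OF FV(3)] sl[OF F123(2)] sl[OF F(1)] x y)
        fix z assume z: "z \<in> I"
        show "0 \<le> S2 x y z + (F x y z * V2 x y z + F2 x y z) * t + F x y z * (c / 2 * t\<^sup>2)"
          using square[OF F(2)[OF x y z], of "V2 x y z" "F2 x y z" t] by (simp add: S2_def S_def algebra_simps)
      qed
      also have "\<dots> = integral I (S2 x y) + integral I (\<lambda>z. F x y z * V2 x y z + F2 x y z) * t
          + FF x y * (c / 2 * t\<^sup>2)"
        unfolding Ie FF_def by (rule integral_quadratic; fold Ie)
          (intro continuous_intros sl[OF S(2)] sl[OF FV(3)] sl[OF F123(2)] sl[OF F(1)] x y)+
      also have "integral I (\<lambda>z. F x y z * V2 x y z + F2 x y z) =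
          integral I (\<lambda>z. F x y z * V2 x y z) + integral I (F2 x y)"
        unfolding Ie by (rule integral_add; rule integrable_continuous_interval; fold Ie)
          (intro sl[OF FV(3)] sl[OF F123(2)] x y)+
      finally show "0 \<le> (integral I (\<lambda>z. F x y z * V2 x y z) + integral I (F2 x y)) * t
          + c / 2 * FF x y * t\<^sup>2 + integral I (S2 x y)" by (simp add: algebra_simps)
    qed (use ab FF GG FFpos GGpos x x' cS2 in \<open>auto intro: cont2_slice\<close>)
    also have "integral I (\<lambda>y. ?A y + FF x y * ln (FF x y) - integral I (S2 x y)) =
       integral I (\<lambda>y. integral I (B1 x y) + integral I (\<lambda>z. F x y z * V1 x y z) * (x' - x)
       + FF x y * (c / 2 * (x' - x)\<^sup>2))"
    proof (rule integral_cong)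
      fix y assume y: "y \<in> I"
      have "integral I (\<lambda>z. B1 x y z + (F x y z * V1 x y z) * (x' - x) + F x y z * (c / 2 * (x' - x)\<^sup>2))
         = integral I (B1 x y) + integral I (\<lambda>z. F x y z * V1 x y z) * (x' - x) + FF x y * (c / 2 * (x' - x)\<^sup>2)"
        unfolding Ie FF_def by (rule integral_quadratic; fold Ie)
          (intro sl[OF B1] sl[OF FV(2)] sl[OF F(1)] x y)+
      moreover have "(\<lambda>z. B1 x y z + (F x y z * V1 x y z) * (x' - x) + F x y z * (c / 2 * (x' - x)\<^sup>2))
         = (\<lambda>z. B2 x x' y z - S2 x y z)"
        by (auto simp: fun_eq_iff B1_def B2_def algebra_simps)
      moreover have "integral I (\<lambda>z. B2 x x' y z - S2 x y z) = integral I (B2 x x' y) - integral I (S2 x y)"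
        unfolding Ie by (rule integral_diff; rule integrable_continuous_interval; fold Ie)
          (intro cont2_slice[OF B2] sl[OF S(2)] x y)+
      ultimately show "?A y + FF x y * ln (FF x y) - integral I (S2 x y) =
        integral I (B1 x y) + integral I (\<lambda>z. F x y z * V1 x y z) * (x' - x)
       + FF x y * (c / 2 * (x' - x)\<^sup>2)" by simp
    qed
    also have "\<dots> = integral I (\<lambda>y. integral I (B1 x y))
       + integral I (\<lambda>y. integral I (\<lambda>z. F x y z * V1 x y z)) * (x' - x) + integral I (FF x) * (c / 2 * (x' - x)\<^sup>2)"
      unfolding Ie by (rule integral_quadratic; fold Ie)
        (intro int1 cont3_slice1 B1 FV x cont2_slice[OF FF])+
    finally show ?thesis by (simp add: FFF_def GGG_def)
  qed
  \<comment> \<open>No free image is left: the last rearrangement turns the bound into one between the total masses.\<close>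
  let ?B = "\<lambda>x y z. B1 x y z - S1 x y z"
  have "integral I (\<lambda>x. (integral I (\<lambda>y. integral I (B1 x y)) - FFF x * ln (FFF x)) + FFF x * ln (FFF x)
        - integral I (\<lambda>y. integral I (S1 x y)))
      \<le> integral I FFF * ln (integral I FFF) - integral I FFF * ln (integral I GGG)"
  proof (rule transport_step[where a=a and b=b and p'="\<lambda>x. integral I (\<lambda>y. integral I (F1 x y))"
        and m="\<lambda>x. integral I (\<lambda>y. integral I (\<lambda>z. F x y z * V1 x y z))" and c=c, folded Ie])
    show "continuous_on I (\<lambda>x. integral I (\<lambda>y. integral I (F1 x y)))"
      "continuous_on I (\<lambda>x. integral I (\<lambda>y. integral I (\<lambda>z. F x y z * V1 x y z)))"
      "continuous_on I (\<lambda>x. integral I (\<lambda>y. integral I (S1 x y)))"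
      by (intro int1 int2 F123 FV S)+
    show "continuous_on I (\<lambda>x. integral I (\<lambda>y. integral I (B1 x y)) - FFF x * ln (FFF x))"
      using FFFpos by (auto intro!: continuous_intros FFF int1 int2 B1 simp: less_imp_neq[symmetric])
    show "(FFF has_real_derivative integral I (\<lambda>y. integral I (F1 x y))) (at x within I)" if x: "x \<in> I" for x
      unfolding FFF_def[abs_def]
    proof (rule leibniz_rule_field_derivative[where a="a::real" and b=b and 'a=real, unfolded cbox_interval, folded Ie])
      show "continuous_on (I \<times> I) (\<lambda>(x, y). integral I (F1 x y))"
        using int2[OF F123(1)] by (simp add: cont2_def split_beta)
      show "FF x integrable_on I" if "x \<in> I" for x
        unfolding Ie by (rule integrable_continuous_interval) (use cont2_slice[OF FF that] Ie in simp)
      show "((\<lambda>x. FF x y) has_real_derivative integral I (F1 x y)) (at x within I)"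
        if x: "x \<in> I" and y: "y \<in> I" for x y
        unfolding FF_def[abs_def]
      proof (rule leibniz_rule_field_derivative[where a="a::real" and b=b and 'a=real, unfolded cbox_interval, folded Ie])
        show "continuous_on (I \<times> I) (\<lambda>(x, z). F1 x y z)"
          using cont3_slice2[OF F123(1) y] by (simp add: cont2_def split_beta)
        show "F x y integrable_on I" if "x \<in> I" for x
          unfolding Ie by (rule integrable_continuous_interval) (use sl[OF F(1) that y] Ie in simp)
      qed (use dF1 x y in \<open>auto simp: Ie\<close>)
    qed (use x in \<open>auto simp: Ie\<close>)
  next
    fix x x' assume x: "x \<in> I" "x' \<in> I"
    show "integral I (\<lambda>y. integral I (B1 x y)) - FFF x * ln (FFF x) + FFF x * ln (GGG x')
       + integral I (\<lambda>y. integral I (\<lambda>z. F x y z * V1 x y z)) * (x' - x) + c / 2 * FFF x * (x' - x)\<^sup>2 \<le> 0"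
      using level2[OF x] by (simp add: algebra_simps)
  next
    fix x t assume x: "x \<in> I"
    have "0 \<le> integral I (\<lambda>y. integral I (\<lambda>z. S1 x y z + (F x y z * V1 x y z + F1 x y z) * t + F x y z * (c / 2 * t\<^sup>2)))"
    proof (rule integral_nonneg)
      show "(\<lambda>y. integral I (\<lambda>z. S1 x y z + (F x y z * V1 x y z + F1 x y z) * t + F x y z * (c / 2 * t\<^sup>2))) integrable_on I"
        unfolding Ie
        by (rule integrable_continuous_interval; fold Ie; intro int1 cont3_slice1 x)
          (auto simp: cont3_def intro!: continuous_intros Sc FVc F1c Fc)
      fix y assume y: "y \<in> I"
      show "0 \<le> integral I (\<lambda>z. S1 x y z + (F x y z * V1 x y z + F1 x y z) * t + F x y z * (c / 2 * t\<^sup>2))"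
      proof (rule integral_nonneg)
        show "(\<lambda>z. S1 x y z + (F x y z * V1 x y z + F1 x y z) * t + F x y z * (c / 2 * t\<^sup>2)) integrable_on I"
          unfolding Ie by (rule integrable_continuous_interval; fold Ie)
            (intro continuous_intros sl[OF S(1)] sl[OF FV(2)] sl[OF F123(1)] sl[OF F(1)] x y)
        fix z assume z: "z \<in> I"
        show "0 \<le> S1 x y z + (F x y z * V1 x y z + F1 x y z) * t + F x y z * (c / 2 * t\<^sup>2)"
          using square[OF F(2)[OF x y z], of "V1 x y z" "F1 x y z" t] by (simp add: S1_def S_def algebra_simps)
      qed
    qed
    also have "\<dots> = integral I (\<lambda>y. integral I (S1 x y)
       + integral I (\<lambda>z. F x y z * V1 x y z + F1 x y z) * t + FF x y * (c / 2 * t\<^sup>2))"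
    proof (rule integral_cong)
      fix y assume y: "y \<in> I"
      show "integral I (\<lambda>z. S1 x y z + (F x y z * V1 x y z + F1 x y z) * t + F x y z * (c / 2 * t\<^sup>2)) =
        integral I (S1 x y) + integral I (\<lambda>z. F x y z * V1 x y z + F1 x y z) * t + FF x y * (c / 2 * t\<^sup>2)"
        unfolding Ie FF_def by (rule integral_quadratic; fold Ie)
          (intro continuous_intros sl[OF S(1)] sl[OF FV(2)] sl[OF F123(1)] sl[OF F(1)] x y)+
    qed
    also have "\<dots> = integral I (\<lambda>y. integral I (S1 x y))
       + integral I (\<lambda>y. integral I (\<lambda>z. F x y z * V1 x y z + F1 x y z)) * t + integral I (FF x) * (c / 2 * t\<^sup>2)"
      unfolding Ie by (rule integral_quadratic; fold Ie; (intro int1 cont3_slice1 S x cont2_slice[OF FF])?)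
        (auto simp: cont3_def intro!: continuous_intros FVc F1c)
    also have "integral I (\<lambda>y. integral I (\<lambda>z. F x y z * V1 x y z + F1 x y z)) =
        integral I (\<lambda>y. integral I (\<lambda>z. F x y z * V1 x y z) + integral I (F1 x y))"
      by (rule integral_cong, unfold Ie, rule integral_add; rule integrable_continuous_interval; fold Ie)
        (intro sl[OF FV(2)] sl[OF F123(1)] x, assumption)+
    also have "\<dots> = integral I (\<lambda>y. integral I (\<lambda>z. F x y z * V1 x y z)) + integral I (\<lambda>y. integral I (F1 x y))"
      unfolding Ie by (rule integral_add; rule integrable_continuous_interval; fold Ie)
        (intro int1 cont3_slice1 FV F123 x)+
    finally show "0 \<le> (integral I (\<lambda>y. integral I (\<lambda>z. F x y z * V1 x y z)) + integral I (\<lambda>y. integral I (F1 x y))) * t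
      + c / 2 * FFF x * t\<^sup>2 + integral I (\<lambda>y. integral I (S1 x y))"
      by (simp add: algebra_simps FFF_def)
  qed (use ab FFF GGG FFFpos GGGpos in auto)
  also have "integral I (\<lambda>x. (integral I (\<lambda>y. integral I (B1 x y)) - FFF x * ln (FFF x)) + FFF x * ln (FFF x)
        - integral I (\<lambda>y. integral I (S1 x y))) = integral I (\<lambda>x. integral I (\<lambda>y. integral I (?B x y)))"
  proof (rule integral_cong)
    fix x assume x: "x \<in> I"
    have "integral I (\<lambda>y. integral I (?B x y)) = integral I (\<lambda>y. integral I (B1 x y) - integral I (S1 x y))"
      by (rule integral_cong, unfold Ie, rule integral_diff; rule integrable_continuous_interval; fold Ie)
        (intro sl[OF B1] sl[OF S(1)] x, assumption)+
    also have "\<dots> = integral I (\<lambda>y. integral I (B1 x y)) - integral I (\<lambda>y. integral I (S1 x y))"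
      unfolding Ie by (rule integral_diff; rule integrable_continuous_interval; fold Ie)
        (intro int1 cont3_slice1 B1 S x)+
    finally show "(integral I (\<lambda>y. integral I (B1 x y)) - FFF x * ln (FFF x)) + FFF x * ln (FFF x)
        - integral I (\<lambda>y. integral I (S1 x y)) = integral I (\<lambda>y. integral I (?B x y))" by simp
  qed
  finally show ?thesis
    by (simp add: FFF_def[abs_def] FF_def[abs_def] GGG_def[abs_def] GG_def[abs_def] G_def[abs_def]
        B1_def S1_def S2_def S3_def algebra_simps)
qed

section \<open>Logarithmic Sobolev inequality on a cube\<close>

definition vec3 :: "real \<Rightarrow> real \<Rightarrow> real \<Rightarrow> real^3" where
  "vec3 x y z = x *\<^sub>R axis 1 1 + y *\<^sub>R axis 2 1 + z *\<^sub>R axis 3 1"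

lemma vec3_nth [simp]: "vec3 x y z $ 1 = x" "vec3 x y z $ 2 = y" "vec3 x y z $ 3 = z"
  by (simp_all add: vec3_def axis_def)

lemma inner_3: "(x::real^3) \<bullet> y = x $ 1 * y $ 1 + x $ 2 * y $ 2 + x $ 3 * y $ 3"
  by (simp add: inner_vec_def sum_3)

lemma vec3_in_cbox_iff:
  "vec3 x y z \<in> cbox (vec3 a a a) (vec3 b b b) \<longleftrightarrow> x \<in> {a..b} \<and> y \<in> {a..b} \<and> z \<in> {a..b}"
  by (auto simp: mem_box_cart forall_3)

lemma emeasure_lborel_Times:
  fixes A :: "'a::euclidean_space set" and B :: "'b::euclidean_space set"
  assumes "A \<in> sets borel" "B \<in> sets borel"
  shows "emeasure lborel (A \<times> B) = emeasure lborel A * emeasure lborel B"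
  using assms by (simp add: lborel_prod[symmetric] lborel.emeasure_pair_measure_Times)

text \<open>
  Identifies integrals over the vector type with integrals over triples, for which Fubini's theorem
  and parameter integrals are available.
\<close>

lemma lborel_vec3: "lborel = distr lborel borel (\<lambda>p. vec3 (fst p) (fst (snd p)) (snd (snd p)))"
proof (rule lborel_eqI)
  let ?T = "\<lambda>p. vec3 (fst p) (fst (snd p)) (snd (snd p))"
  have [measurable]: "?T \<in> borel_measurable borel"
    unfolding vec3_def by (intro borel_measurable_continuous_onI continuous_intros)
  fix l u :: "real^3" assume le: "\<And>b. b \<in> Basis \<Longrightarrow> l \<bullet> b \<le> u \<bullet> b"
  have le': "l $ i \<le> u $ i" for i using le[of "axis i 1"] by (auto simp: inner_axis axis_in_Basis_iff)
  have pre: "?T -` box l u = box (l $ 1, l $ 2, l $ 3) (u $ 1, u $ 2, u $ 3)"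
  proof -
    have "(?T p \<in> box l u) = (p \<in> box (l $ 1, l $ 2, l $ 3) (u $ 1, u $ 2, u $ 3))" for p
      by (cases p) (auto simp: mem_box_cart forall_3 mem_box Basis_prod_def)
    then show ?thesis by auto
  qed
  have "emeasure (distr lborel borel ?T) (box l u) =
      emeasure lborel (box (l $ 1, l $ 2, l $ 3) (u $ 1, u $ 2, u $ 3))"
    by (simp add: emeasure_distr pre)
  also have "\<dots> = ennreal ((u $ 1 - l $ 1) * (u $ 2 - l $ 2) * (u $ 3 - l $ 3))"
  proof -
    have bx: "box (l $ 1, l $ 2, l $ 3) (u $ 1, u $ 2, u $ 3) =
        {l $ 1<..<u $ 1} \<times> {l $ 2<..<u $ 2} \<times> {l $ 3<..<u $ 3}"
      by (auto simp: mem_box Basis_prod_def)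
    show ?thesis
      using le' unfolding bx
      by (simp add: emeasure_lborel_Times ennreal_mult mult.assoc borel_open open_Times)
  qed
  also have "(u $ 1 - l $ 1) * (u $ 2 - l $ 2) * (u $ 3 - l $ 3) = (\<Prod>b\<in>Basis. (u - l) \<bullet> b)"
  proof -
    have B: "(Basis :: (real^3) set) = range (\<lambda>i. axis i 1)" by (auto simp: Basis_vec_def)
    have "(\<Prod>b\<in>Basis. (u - l) \<bullet> b) = (\<Prod>i\<in>UNIV. (u - l) $ i)"
      unfolding B by (subst prod.reindex) (auto simp: inj_on_def axis_eq_axis inner_axis)
    then show ?thesis unfolding UNIV_3 by (simp add: mult.assoc)
  qed
  finally show "emeasure (distr lborel borel ?T) (box l u) = ennreal (\<Prod>b\<in>Basis. (u - l) \<bullet> b)" .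
qed simp

lemma continuous_on_vec3 [continuous_intros]:
  "continuous_on S f \<Longrightarrow> continuous_on S g \<Longrightarrow> continuous_on S h \<Longrightarrow>
   continuous_on S (\<lambda>p. vec3 (f p) (g p) (h p))"
  unfolding vec3_def by (intro continuous_intros)

lemma set_integral_cube_iterated:
  fixes \<phi> :: "real^3 \<Rightarrow> real"
  assumes \<phi>: "continuous_on (cbox (vec3 a a a) (vec3 b b b)) \<phi>"
  shows "(LINT v:cbox (vec3 a a a) (vec3 b b b)|lborel. \<phi> v) =
     integral {a..b} (\<lambda>x. integral {a..b} (\<lambda>y. integral {a..b} (\<lambda>z. \<phi> (vec3 x y z))))"
proof -
  let ?T = "\<lambda>p. vec3 (fst p) (fst (snd p)) (snd (snd p))"
  let ?Q = "cbox (vec3 a a a) (vec3 b b b)" and ?C = "cbox (a, a, a) (b, b, b)"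
  have [measurable]: "?T \<in> borel_measurable borel"
    unfolding vec3_def by (intro borel_measurable_continuous_onI continuous_intros)
  have inC: "(p \<in> ?C) = (?T p \<in> ?Q)" for p
    by (cases p) (auto simp: vec3_in_cbox_iff cbox_Pair_eq)
  have cont: "continuous_on ?C (\<lambda>p. \<phi> (?T p))"
    by (rule continuous_on_compose2[OF \<phi>]) (auto intro!: continuous_intros simp: vec3_in_cbox_iff cbox_Pair_eq)
  have m: "(\<lambda>v. indicator ?Q v *\<^sub>R \<phi> v) \<in> borel_measurable borel"
    by (rule borel_measurable_continuous_on_indicator[OF _ \<phi>]) simp
  have "(LINT v:?Q|lborel. \<phi> v) = (LINT p|lborel. indicator ?Q (?T p) *\<^sub>R \<phi> (?T p))"
    unfolding set_lebesgue_integral_def by (subst lborel_vec3, subst integral_distr[OF _ m]) auto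
  also have "\<dots> = (LINT p:?C|lborel. \<phi> (?T p))"
    unfolding set_lebesgue_integral_def by (rule Bochner_Integration.integral_cong) (auto simp: inC indicator_def)
  also have "\<dots> = integral ?C (\<lambda>p. \<phi> (?T p))"
    using borel_integrable_compact[OF compact_cbox cont]
    by (intro set_borel_integral_eq_integral) (simp add: set_integrable_def)
  also have "\<dots> = integral {a..b} (\<lambda>x. integral (cbox (a, a) (b, b)) (\<lambda>q. \<phi> (?T (x, q))))"
    by (subst integral_prod_continuous[OF cont]) simp
  also have "\<dots> = integral {a..b} (\<lambda>x. integral {a..b} (\<lambda>y. integral {a..b} (\<lambda>z. \<phi> (vec3 x y z))))"
  proof (rule integral_cong)
    fix x assume "x \<in> {a..b}"
    then have "continuous_on (cbox (a, a) (b, b)) (\<lambda>q. \<phi> (?T (x, q)))"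
      by (intro continuous_on_compose2[OF \<phi>])
        (auto intro!: continuous_intros simp: cbox_Pair_eq vec3_in_cbox_iff)
    from integral_prod_continuous[OF this]
    show "integral (cbox (a, a) (b, b)) (\<lambda>q. \<phi> (?T (x, q))) =
      integral {a..b} (\<lambda>y. integral {a..b} (\<lambda>z. \<phi> (vec3 x y z)))" by simp
  qed
  finally show ?thesis .
qed

lemma GDERIV_has_derivative_line:
  assumes "GDERIV f (x + t *\<^sub>R e) :> D"
  shows "((\<lambda>s. f (x + s *\<^sub>R e)) has_real_derivative (D \<bullet> e)) (at t within S)"
proof -
  have "((\<lambda>s. x + s *\<^sub>R e) has_derivative (\<lambda>h. h *\<^sub>R e)) (at t within S)"
    by (auto intro!: derivative_eq_intros)
  moreover have "(f has_derivative (\<lambda>h. h \<bullet> D)) (at (x + t *\<^sub>R e))"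
    using assms by (simp add: gderiv_def)
  ultimately have "((\<lambda>s. f (x + s *\<^sub>R e)) has_derivative (\<lambda>h. (h *\<^sub>R e) \<bullet> D)) (at t within S)"
    by (rule has_derivative_compose)
  then show ?thesis
    by (simp add: has_field_derivative_def inner_commute mult.commute[of _ "D \<bullet> e"])
qed

lemma vec3_partials:
  assumes f: "\<And>v. GDERIV f v :> D v"
  shows "((\<lambda>x. f (vec3 x y z)) has_real_derivative D (vec3 x y z) $ 1) (at x within S)"
    "((\<lambda>y. f (vec3 x y z)) has_real_derivative D (vec3 x y z) $ 2) (at y within S)"
    "((\<lambda>z. f (vec3 x y z)) has_real_derivative D (vec3 x y z) $ 3) (at z within S)"
proof -
  have *: "vec3 x y z = vec3 0 y z + x *\<^sub>R axis 1 1" "vec3 x y z = vec3 x 0 z + y *\<^sub>R axis 2 1"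
    "vec3 x y z = vec3 x y 0 + z *\<^sub>R axis 3 1" for x y z
    by (simp_all add: vec3_def)
  show "((\<lambda>x. f (vec3 x y z)) has_real_derivative D (vec3 x y z) $ 1) (at x within S)"
    using GDERIV_has_derivative_line[OF f, of "vec3 0 y z" "axis 1 1" x S]
    by (simp add: *(1)[symmetric] inner_axis)
  show "((\<lambda>y. f (vec3 x y z)) has_real_derivative D (vec3 x y z) $ 2) (at y within S)"
    using GDERIV_has_derivative_line[OF f, of "vec3 x 0 z" "axis 2 1" y S]
    by (simp add: *(2)[symmetric] inner_axis)
  show "((\<lambda>z. f (vec3 x y z)) has_real_derivative D (vec3 x y z) $ 3) (at z within S)"
    using GDERIV_has_derivative_line[OF f, of "vec3 x y 0" "axis 3 1" z S]
    by (simp add: *(3)[symmetric] inner_axis)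
qed

lemma GDERIV_continuous: "(\<And>v. GDERIV f v :> D v) \<Longrightarrow> continuous_on S f"
  unfolding gderiv_def by (meson differentiableI differentiable_imp_continuous_on differentiable_on_def differentiable_at_withinI)

lemma cont3_vec3: "continuous_on UNIV f \<Longrightarrow> cont3 I (\<lambda>x y z. f (vec3 x y z))"
  unfolding cont3_def by (rule continuous_on_compose2[where g=f]) (auto intro!: continuous_intros)

text \<open>
  With F = h exp(-V) one has grad F + F grad V = exp(-V) grad h, so that the quadratic terms of the
  transport inequality become the Fisher information of h and the entropy of F relative to
  exp(-V) becomes the integral of h ln h exp(-V).
\<close>

lemma log_Sobolev_cube:
  fixes V h :: "real^3 \<Rightarrow> real" and V' h' :: "real^3 \<Rightarrow> real^3"
  assumes R: "R > 0" and c: "c > 0"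
    and V: "\<And>v. GDERIV V v :> V' v" "continuous_on UNIV V'"
    and convex: "\<And>v w. V v + V' v \<bullet> (w - v) + c / 2 * (norm (w - v))\<^sup>2 \<le> V w"
    and h: "\<And>v. GDERIV h v :> h' v" "continuous_on UNIV h'" "\<And>v. h v > 0"
  defines "Q \<equiv> cbox (vec3 (-R) (-R) (-R)) (vec3 R R R)"
  shows "(LINT v:Q|lborel. h v * ln (h v) * exp (- V v))
    \<le> (LINT v:Q|lborel. h v * exp (- V v)) * ln (LINT v:Q|lborel. h v * exp (- V v))
      - (LINT v:Q|lborel. h v * exp (- V v)) * ln (LINT v:Q|lborel. exp (- V v))
      + 1 / (2 * c) * (LINT v:Q|lborel. (norm (h' v))\<^sup>2 / h v * exp (- V v))"
proof -
  let ?I = "{-R..R}"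
  have cV: "continuous_on S V" and ch: "continuous_on S h" for S
    using GDERIV_continuous V(1) h(1) by blast+
  have cV': "continuous_on S V'" and ch': "continuous_on S h'" for S
    using V(2) h(2) by (auto intro: continuous_on_subset)
  have hne: "h v \<noteq> 0" for v using h(3)[of v] by simp
  define F where "F v = h v * exp (- V v)" for v
  define F' where "F' v = exp (- V v) *\<^sub>R (h' v - h v *\<^sub>R V' v)" for v
  have F: "GDERIV F v :> F' v" for v
  proof -
    have "GDERIV (\<lambda>v. exp (- V v)) v :> exp (- V v) *\<^sub>R (- V' v)"
      by (rule GDERIV_DERIV_compose[OF GDERIV_minus[OF V(1)] DERIV_exp])
    from GDERIV_mult[OF h(1) this] show ?thesis
      unfolding F_def[abs_def] F'_def by (rule GDERIV_subst) (simp add: algebra_simps)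
  qed
  have cF: "continuous_on S F" and cF': "continuous_on S F'" for S
    unfolding F_def[abs_def] F'_def[abs_def] by (intro continuous_intros cV ch cV' ch')+
  have Fpos: "F v > 0" for v using h(3) by (simp add: F_def)
  define L where "L v = F v * ln (F v) + F v * V v
      - (F' v $ 3 + F v * V' v $ 3)\<^sup>2 / (2 * c * F v)
      - (F' v $ 2 + F v * V' v $ 2)\<^sup>2 / (2 * c * F v)
      - (F' v $ 1 + F v * V' v $ 1)\<^sup>2 / (2 * c * F v)" for v
  have cnth: "continuous_on S (\<lambda>v. f v $ i)" if "continuous_on S f" for f :: "real^3 \<Rightarrow> real^3" and i S
    by (intro continuous_intros that)
  have cL: "continuous_on S L" for S
    unfolding L_def using Fpos c less_imp_neq[OF Fpos] by (intro continuous_intros cF cF' cV cV' cnth) auto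
  have L: "L v = h v * ln (h v) * exp (- V v) - 1 / (2 * c) * ((norm (h' v))\<^sup>2 / h v * exp (- V v))" for v
  proof -
    have e1: "F' v $ i + F v * V' v $ i = exp (- V v) * h' v $ i" for i
      by (simp add: F'_def F_def algebra_simps)
    have e2: "(exp (- V v) * t)\<^sup>2 / (2 * c * F v) = 1 / (2 * c) * (t\<^sup>2 / h v * exp (- V v))" for t
      using c hne[of v] by (simp add: F_def field_simps power2_eq_square)
    have e3: "(norm (h' v))\<^sup>2 = (h' v $ 1)\<^sup>2 + (h' v $ 2)\<^sup>2 + (h' v $ 3)\<^sup>2"
      unfolding power2_norm_eq_inner inner_3 by (simp add: power2_eq_square)
    have e4: "F v * ln (F v) + F v * V v = h v * ln (h v) * exp (- V v)"
      using h(3)[of v] by (simp add: F_def ln_mult algebra_simps)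
    show ?thesis unfolding L_def e1 e2 e3 e4 by (simp add: algebra_simps add_divide_distrib)
  qed
  note it = set_integral_cube_iterated[where a="-R" and b=R, folded Q_def]
  have "(LINT v:Q|lborel. L v) \<le> (LINT v:Q|lborel. F v) * ln (LINT v:Q|lborel. F v)
     - (LINT v:Q|lborel. F v) * ln (LINT v:Q|lborel. exp (- V v))"
    unfolding it[OF cL] it[OF cF] it[OF continuous_on_exp[OF continuous_on_minus[OF cV]]]
    unfolding L_def
  proof (rule cube_transport_inequality)
    show "V (vec3 x y z) + V' (vec3 x y z) $ 1 * (x' - x) + V' (vec3 x y z) $ 2 * (y' - y)
        + V' (vec3 x y z) $ 3 * (z' - z) + c / 2 * ((x' - x)\<^sup>2 + (y' - y)\<^sup>2 + (z' - z)\<^sup>2) \<le> V (vec3 x' y' z')"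
      for x y z x' y' z'
      using convex[of "vec3 x y z" "vec3 x' y' z'"] unfolding power2_norm_eq_inner inner_3
      by (simp add: power2_eq_square)
  qed (use R c Fpos in \<open>auto intro!: cont3_vec3 cF cF' cV cV' cnth vec3_partials[OF F] \<close>)
  moreover have "(LINT v:Q|lborel. L v) = (LINT v:Q|lborel. h v * ln (h v) * exp (- V v))
      - 1 / (2 * c) * (LINT v:Q|lborel. (norm (h' v))\<^sup>2 / h v * exp (- V v))"
  proof -
    have si: "set_integrable lborel Q f" if "continuous_on Q f" for f :: "real^3 \<Rightarrow> real"
      using borel_integrable_compact[OF compact_cbox that[unfolded Q_def]] by (simp add: set_integrable_def Q_def)
    have "(LINT v:Q|lborel. L v) = (LINT v:Q|lborel. h v * ln (h v) * exp (- V v))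
      - (LINT v:Q|lborel. 1 / (2 * c) * ((norm (h' v))\<^sup>2 / h v * exp (- V v)))"
      unfolding L using hne c
      by (intro set_integral_diff si) (auto intro!: continuous_intros ch cV ch')
    then show ?thesis by (simp only: set_integral_mult_right)
  qed
  ultimately show ?thesis by (simp add: F_def)
qed

section \<open>The potential of the weighted Maxwellian\<close>

definition weighted_potential :: "real^3 \<Rightarrow> real" where
  "weighted_potential v = (norm v)\<^sup>2 / 2 + 3/2 * ln (1 + (norm v)\<^sup>2)"

definition weighted_force :: "real^3 \<Rightarrow> real^3" where
  "weighted_force v = (1 + 3 / (1 + (norm v)\<^sup>2)) *\<^sub>R v"

lemma GDERIV_norm_sq: "GDERIV (\<lambda>v. (norm v)\<^sup>2) v :> 2 *\<^sub>R v"
  unfolding gderiv_def power2_norm_eq_inner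
  by (auto intro!: derivative_eq_intros simp: inner_commute)

lemma one_plus_norm_sq_pos [simp]: "0 < 1 + (norm v)\<^sup>2" "1 + (norm v)\<^sup>2 \<noteq> 0"
  by (auto simp: add_pos_nonneg add_nonneg_eq_0_iff)

lemma GDERIV_weighted_potential: "GDERIV weighted_potential v :> weighted_force v"
proof -
  have "((\<lambda>s. s / 2 + 3/2 * ln (1 + s)) has_real_derivative (1/2 + 3/2 * (1 / (1 + (norm v)\<^sup>2)))) (at ((norm v)\<^sup>2))"
    by (auto intro!: derivative_eq_intros simp: add_pos_nonneg)
      (simp add: divide_simps add_pos_nonneg add_nonneg_eq_0_iff)
  from GDERIV_DERIV_compose[OF GDERIV_norm_sq this]
  show ?thesis unfolding weighted_potential_def[abs_def] weighted_force_def
    by (rule GDERIV_subst)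
      (use mult_divide_mult_cancel_left[of 2 3 "1 + (norm v)\<^sup>2"] in \<open>auto simp: algebra_simps\<close>)
qed

lemma continuous_on_weighted_force: "continuous_on S weighted_force"
  unfolding weighted_force_def by (intro continuous_intros) simp

lemma exp_weighted_potential:
  "exp (- weighted_potential v) = jbracket v powr (-3) * exp (- (norm v)\<^sup>2 / 2)"
proof -
  have "exp (- weighted_potential v) = exp (- (3/2 * ln (1 + (norm v)\<^sup>2))) * exp (- (norm v)\<^sup>2 / 2)"
    by (simp add: weighted_potential_def exp_add[symmetric])
  also have "exp (- (3/2 * ln (1 + (norm v)\<^sup>2))) = jbracket v powr (-3)"
    by (simp add: jbracket_def powr_def ln_sqrt)
  finally show ?thesis .
qed

text \<open>
  Along a line the second derivative of ln X with X = 1 + |v|^2 is at least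
  |d|^2 (2/X - 4 (X - 1)/X^2), whose minimum over X >= 1 is -|d|^2/4, attained at X = 4.  Adding
  |d|^2 s^2 / 8 therefore makes the function convex, and a convex function lies above its tangent.
\<close>

lemma ln_one_plus_norm_sq_tangent:
  fixes v w :: "real^3"
  shows "ln (1 + (norm v)\<^sup>2) + 2 / (1 + (norm v)\<^sup>2) * (v \<bullet> (w - v)) - (norm (w - v))\<^sup>2 / 8
    \<le> ln (1 + (norm w)\<^sup>2)"
proof -
  define d where "d = w - v"
  define X where "X s = 1 + (norm (v + s *\<^sub>R d))\<^sup>2" for s
  have X: "X s = 1 + v \<bullet> v + 2 * s * (v \<bullet> d) + s\<^sup>2 * (d \<bullet> d)" for s
    unfolding X_def power2_norm_eq_inner
    by (simp add: inner_simps algebra_simps power2_eq_square inner_commute)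
  have Xpos: "X s \<ge> 1" for s by (simp add: X_def)
  define X' where "X' s = 2 * (v \<bullet> d) + 2 * s * (d \<bullet> d)" for s
  have dX: "(X has_real_derivative X' s) (at s)" for s
    unfolding X[abs_def] X'_def by (auto intro!: derivative_eq_intros)
  have dX': "(X' has_real_derivative 2 * (d \<bullet> d)) (at s)" for s
    unfolding X'_def[abs_def] by (auto intro!: derivative_eq_intros)
  define \<phi> where "\<phi> s = ln (X s) + (d \<bullet> d) / 8 * s\<^sup>2" for s
  define \<phi>' where "\<phi>' s = X' s / X s + (d \<bullet> d) / 4 * s" for s
  define \<phi>'' where "\<phi>'' s = (2 * (d \<bullet> d) * X s - X' s * X' s) / (X s * X s) + (d \<bullet> d) / 4" for s
  have X0: "X s \<noteq> 0" "X s > 0" for s using Xpos[of s] by auto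
  have d1: "(\<phi> has_real_derivative \<phi>' s) (at s)" for s
    unfolding \<phi>_def[abs_def] \<phi>'_def using X0
    by (auto intro!: derivative_eq_intros dX simp: field_simps)
  have d2: "(\<phi>' has_real_derivative \<phi>'' s) (at s)" for s
    unfolding \<phi>'_def[abs_def] \<phi>''_def using X0
    by (auto intro!: derivative_eq_intros dX dX')
  have "convex_on UNIV \<phi>"
  proof (rule f''_ge0_imp_convex[OF _ d1 d2])
    fix s
    have "X' s = 2 * ((v + s *\<^sub>R d) \<bullet> d)" by (simp add: X'_def inner_simps algebra_simps)
    then have "X' s * X' s = 4 * ((v + s *\<^sub>R d) \<bullet> d)\<^sup>2" by (simp add: power2_eq_square)
    also have "\<dots> \<le> 4 * ((X s - 1) * (d \<bullet> d))"
      using Cauchy_Schwarz_ineq[of "v + s *\<^sub>R d" d] by (simp add: X_def power2_norm_eq_inner)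
    finally have le: "X' s * X' s \<le> 4 * ((X s - 1) * (d \<bullet> d))" .
    have "0 \<le> (X s - 4)\<^sup>2 * (d \<bullet> d) / 4" by simp
    also have "\<dots> = 2 * (d \<bullet> d) * X s - 4 * ((X s - 1) * (d \<bullet> d)) + (d \<bullet> d) / 4 * (X s * X s)"
      by (simp add: power2_eq_square field_simps)
    also have "\<dots> \<le> 2 * (d \<bullet> d) * X s - X' s * X' s + (d \<bullet> d) / 4 * (X s * X s)" using le by simp
    also have "\<dots> = \<phi>'' s * (X s * X s)"
      using X0 by (simp add: \<phi>''_def field_simps)
    finally show "\<phi>'' s \<ge> 0" using X0(2)[of s] by (smt (verit) zero_le_mult_iff mult_pos_pos)
  qed auto
  from convex_on_imp_above_tangent[OF this, of 0 1 "\<phi>' 0"] d1[of 0]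
  have "\<phi> 1 - \<phi> 0 \<ge> \<phi>' 0" by auto
  then show ?thesis
    by (simp add: \<phi>_def \<phi>'_def X_def X'_def d_def power2_norm_eq_inner algebra_simps)
qed

text \<open>
  The quadratic part contributes 1 to the modulus of convexity and the logarithm takes away at
  most (3/2) / 4 = 3/8.
\<close>

lemma weighted_potential_strongly_convex:
  "weighted_potential v + weighted_force v \<bullet> (w - v) + (5/8) / 2 * (norm (w - v))\<^sup>2 \<le> weighted_potential w"
proof -
  have "(norm w)\<^sup>2 = (norm v)\<^sup>2 + 2 * (v \<bullet> (w - v)) + (norm (w - v))\<^sup>2"
    by (simp add: power2_norm_eq_inner inner_simps algebra_simps inner_commute)
  moreover have "weighted_force v \<bullet> (w - v) = v \<bullet> (w - v) + 3/2 * (2 / (1 + (norm v)\<^sup>2) * (v \<bullet> (w - v)))"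
    unfolding weighted_force_def inner_scaleR_left by (simp add: distrib_right)
  ultimately show ?thesis
    using ln_one_plus_norm_sq_tangent[of v w] unfolding weighted_potential_def by argo
qed

section \<open>Continuity of translations in the mean\<close>

lemma lborel_reflect: "distr lborel borel (\<lambda>y. x - y) = (lborel :: 'a::euclidean_space measure)"
  using lborel_affine[of "-1" x] by (simp add: density_1)

lemma lborel_translate: "distr lborel borel (\<lambda>y. y + x) = (lborel :: 'a::euclidean_space measure)"
  using lborel_affine[of 1 x] by (simp add: density_1 add.commute)

lemma nn_integral_reflect:
  fixes f :: "'a::euclidean_space \<Rightarrow> ennreal"
  assumes [measurable]: "f \<in> borel_measurable borel"
  shows "(\<integral>\<^sup>+y. f (x - y) \<partial>lborel) = (\<integral>\<^sup>+y. f y \<partial>lborel)"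
  by (subst (2) lborel_reflect[of x, symmetric], subst nn_integral_distr) auto

lemma integrable_translate:
  fixes f :: "'a::euclidean_space \<Rightarrow> 'b::{banach, second_countable_topology}"
  assumes f: "integrable lborel f"
  shows "integrable lborel (\<lambda>y. f (y + x))"
proof -
  have "integrable (distr lborel borel (\<lambda>y. y + x)) f" by (simp add: lborel_translate f)
  then show ?thesis by (subst (asm) integrable_distr_eq) (use f in auto)
qed

lemma integral_translate:
  fixes f :: "'a::euclidean_space \<Rightarrow> 'b::{banach, second_countable_topology}"
  assumes f[measurable]: "f \<in> borel_measurable borel"
  shows "(LINT y|lborel. f (y + x)) = (LINT y|lborel. f y)"
  by (subst (2) lborel_translate[of x, symmetric], subst integral_distr) auto

definition L1_shift :: "('a::euclidean_space \<Rightarrow> 'b::{banach, second_countable_topology}) \<Rightarrow> 'a \<Rightarrow> real" where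
  "L1_shift f s = (LINT x|lborel. norm (f (x + s) - f x))"

lemma L1_shift_nonneg: "L1_shift f s \<ge> 0" by (simp add: L1_shift_def)

lemma integrable_shift_diff:
  fixes f :: "'a::euclidean_space \<Rightarrow> 'b::{banach, second_countable_topology}"
  shows "integrable lborel f \<Longrightarrow> integrable lborel (\<lambda>x. norm (f (x + s) - f x))"
  by (rule integrable_norm, rule Bochner_Integration.integrable_diff, rule integrable_translate)

lemma L1_shift_triangle:
  fixes f g :: "'a::euclidean_space \<Rightarrow> 'b::{banach, second_countable_topology}"
  assumes f: "integrable lborel f" and g: "integrable lborel g"
  shows "L1_shift f s \<le> L1_shift g s + 2 * (LINT x|lborel. norm (f x - g x))"
proof -
  have d: "integrable lborel (\<lambda>x. norm (f x - g x))"
    by (intro integrable_norm Bochner_Integration.integrable_diff f g)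
  have [measurable]: "f \<in> borel_measurable borel" "g \<in> borel_measurable borel" using f g by auto
  have "L1_shift f s \<le> (LINT x|lborel. norm (g (x + s) - g x) + norm (f (x + s) - g (x + s)) + norm (f x - g x))"
    unfolding L1_shift_def
  proof (rule integral_mono)
    show "integrable lborel (\<lambda>x. norm (g (x + s) - g x) + norm (f (x + s) - g (x + s)) + norm (f x - g x))"
      by (intro Bochner_Integration.integrable_add integrable_shift_diff g d
          integrable_translate[of "\<lambda>x. norm (f x - g x)"])
    show "norm (f (x + s) - f x) \<le> norm (g (x + s) - g x) + norm (f (x + s) - g (x + s)) + norm (f x - g x)" for x
      using norm_triangle_ineq[of "f (x + s) - g (x + s)" "g (x + s) - g x"]
        norm_triangle_ineq[of "f (x + s) - g x" "g x - f x"] by (simp add: norm_minus_commute)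
  qed (rule integrable_shift_diff[OF f])
  also have "\<dots> = L1_shift g s + (LINT x|lborel. norm (f (x + s) - g (x + s))) + (LINT x|lborel. norm (f x - g x))"
    unfolding L1_shift_def
    using integrable_shift_diff[OF g] d integrable_translate[OF d] by simp
  also have "(LINT x|lborel. norm (f (x + s) - g (x + s))) = (LINT x|lborel. norm (f x - g x))"
    using integral_translate[of "\<lambda>x. norm (f x - g x)" s] by simp
  finally show ?thesis by simp
qed

lemma L1_shift_limit_closed:
  fixes f :: "'a::euclidean_space \<Rightarrow> 'b::{banach, second_countable_topology}"
  assumes f: "integrable lborel f"
    and approx: "\<And>e. e > 0 \<Longrightarrow> \<exists>g. integrable lborel g \<and> (LINT x|lborel. norm (f x - g x)) < e \<and> (\<lambda>n. L1_shift g (s n)) \<longlonglongrightarrow> 0"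
  shows "(\<lambda>n. L1_shift f (s n)) \<longlonglongrightarrow> 0"
proof (rule LIMSEQ_I)
  fix e :: real assume "e > 0"
  then obtain g where g: "integrable lborel g" "(LINT x|lborel. norm (f x - g x)) < e / 4"
    "(\<lambda>n. L1_shift g (s n)) \<longlonglongrightarrow> 0" using approx[of "e/4"] by auto
  then obtain N where N: "\<forall>n\<ge>N. norm (L1_shift g (s n) - 0) < e / 2"
    using LIMSEQ_D[OF g(3), of "e/2"] \<open>e > 0\<close> by auto
  show "\<exists>N. \<forall>n\<ge>N. norm (L1_shift f (s n) - 0) < e"
  proof (intro exI allI impI)
    fix n assume "N \<le> n"
    with N have "L1_shift g (s n) < e / 2" by auto
    then show "norm (L1_shift f (s n) - 0) < e"
      using L1_shift_triangle[OF f g(1), of "s n"] g(2) L1_shift_nonneg[of f "s n"] by simp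
  qed
qed

text \<open>
  For an open set the indicator is lower semicontinuous, hence the part of U that a small
  translation moves out of U shrinks to zero by dominated convergence; the part moved in has the same
  measure because translations preserve the measure of U.
\<close>

lemma L1_shift_open:
  fixes U :: "'a::euclidean_space set"
  assumes U: "open U" "emeasure lborel U < \<infinity>" and s: "s \<longlonglongrightarrow> 0"
  shows "(\<lambda>n. L1_shift (indicator U :: 'a \<Rightarrow> real) (s n)) \<longlonglongrightarrow> 0"
proof -
  let ?u = "indicator U :: 'a \<Rightarrow> real"
  have [measurable]: "U \<in> sets borel" using U by auto
  have iu: "integrable lborel ?u" using U by (simp add: less_top)
  have im: "integrable lborel (\<lambda>x. ?u x * ?u (x + t))" for t
    by (rule Bochner_Integration.integrable_bound[OF iu]) (auto simp: indicator_def)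
  have eq: "L1_shift ?u t = 2 * (LINT x|lborel. ?u x - ?u x * ?u (x + t))" for t
  proof -
    have "L1_shift ?u t = (LINT x|lborel. ?u (x + t) + ?u x - 2 * (?u x * ?u (x + t)))"
      unfolding L1_shift_def by (rule Bochner_Integration.integral_cong) (auto simp: indicator_def)
    also have "\<dots> = 2 * (LINT x|lborel. ?u x - ?u x * ?u (x + t))"
      using iu im integrable_translate[OF iu] integral_translate[of ?u t] by simp
    finally show ?thesis .
  qed
  have "(\<lambda>n. LINT x|lborel. ?u x - ?u x * ?u (x + s n)) \<longlonglongrightarrow> (LINT x|(lborel :: 'a measure). 0)"
  proof (rule integral_dominated_convergence[where w="?u"])
    show "AE x in lborel. (\<lambda>n. ?u x - ?u x * ?u (x + s n)) \<longlonglongrightarrow> 0"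
    proof (rule AE_I2)
      fix x :: 'a
      show "(\<lambda>n. ?u x - ?u x * ?u (x + s n)) \<longlonglongrightarrow> 0"
      proof (cases "x \<in> U")
        case True
        have "(\<lambda>n. x + s n) \<longlonglongrightarrow> x + 0" by (intro tendsto_intros s)
        then have "eventually (\<lambda>n. x + s n \<in> U) sequentially"
          using topological_tendstoD[OF _ U(1)] True by simp
        then have "eventually (\<lambda>n. 0 = ?u x - ?u x * ?u (x + s n)) sequentially"
          by eventually_elim (use True in auto)
        then show ?thesis by (rule Lim_transform_eventually[rotated]) simp
      qed simp
    qed
  qed (use iu in \<open>auto simp: indicator_def\<close>)
  then show ?thesis unfolding eq using tendsto_mult_right_zero by simp
qed

text \<open>
  Integrable functions are reached from indicators by linearity and limits in the mean, and
  indicators of measurable sets from those of open sets by outer regularity.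
\<close>

lemma L1_shift_sequence:
  fixes f :: "'a::euclidean_space \<Rightarrow> 'b::{banach, second_countable_topology}"
  assumes "integrable lborel f" and s: "s \<longlonglongrightarrow> 0"
  shows "(\<lambda>n. L1_shift f (s n)) \<longlonglongrightarrow> 0"
  using assms(1)
proof (induction rule: integrable_induct)
  case (base A c)
  have A[measurable]: "A \<in> sets borel" using base by simp
  have iA: "integrable lborel (indicator A :: 'a \<Rightarrow> real)" using base by (simp add: less_top)
  have "(\<lambda>n. L1_shift (indicator A :: 'a \<Rightarrow> real) (s n)) \<longlonglongrightarrow> 0"
  proof (rule L1_shift_limit_closed[OF iA])
    fix e :: real assume "e > 0"
    from outer_regular_lborel[OF A this] obtain U where U: "open U" "A \<subseteq> U" "emeasure lborel (U - A) < e" .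
    have [measurable]: "U \<in> sets borel" using U by auto
    have fin: "emeasure lborel U < \<infinity>"
    proof -
      have "emeasure lborel U \<le> emeasure lborel A + emeasure lborel (U - A)"
        using emeasure_subadditive[of A lborel "U - A"] U(2) by (simp add: Un_absorb1)
      also have "\<dots> < \<infinity>" using base(2) U(3) by (simp add: ennreal_add_less_top order.strict_trans[OF U(3)])
      finally show ?thesis .
    qed
    have "(LINT x|lborel. norm (indicator A x - indicator U x :: real)) = (LINT x|lborel. indicator (U - A) x)"
      by (rule Bochner_Integration.integral_cong) (use U(2) in \<open>auto simp: indicator_def\<close>)
    also have "\<dots> = measure lborel (U - A)" by simp
    also have "\<dots> < e" using U(3) \<open>e > 0\<close> by (simp add: measure_def enn2real_less_iff order.strict_trans[OF U(3)])
    finally show "\<exists>g. integrable lborel g \<and> (LINT x|lborel. norm ((indicator A x :: real) - g x)) < e \<and>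
        (\<lambda>n. L1_shift g (s n)) \<longlonglongrightarrow> 0"
      using L1_shift_open[OF U(1) fin s] fin by (intro exI[of _ "indicator U"]) (auto simp: less_top)
  qed
  then have "(\<lambda>n. norm c * L1_shift (indicator A :: 'a \<Rightarrow> real) (s n)) \<longlonglongrightarrow> 0"
    by (rule tendsto_mult_right_zero)
  moreover have "norm c * L1_shift (indicator A :: 'a \<Rightarrow> real) t = L1_shift (\<lambda>x. indicator A x *\<^sub>R c) t" for t
    unfolding L1_shift_def
    by (subst integral_mult_right_zero[symmetric], rule Bochner_Integration.integral_cong)
       (auto simp: indicator_def)
  ultimately show ?case by simp
next
  case (add f g)
  have "L1_shift (\<lambda>x. f x + g x) t \<le> L1_shift f t + L1_shift g t" for t
  proof -
    have "L1_shift (\<lambda>x. f x + g x) t \<le> (LINT x|lborel. norm (f (x + t) - f x) + norm (g (x + t) - g x))"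
      unfolding L1_shift_def
      by (intro integral_mono integrable_shift_diff[of "\<lambda>x. f x + g x"] Bochner_Integration.integrable_add
          integrable_shift_diff add) (metis add_diff_add norm_triangle_ineq)
    then show ?thesis unfolding L1_shift_def
      by (simp only: Bochner_Integration.integral_add integrable_shift_diff add.hyps)
  qed
  moreover have "(\<lambda>n. L1_shift f (s n) + L1_shift g (s n)) \<longlonglongrightarrow> 0"
    using tendsto_add[OF add.IH] by simp
  ultimately show ?case
    by (intro tendsto_sandwich[of "\<lambda>_. 0" "\<lambda>n. L1_shift (\<lambda>x. f x + g x) (s n)" _
        "\<lambda>n. L1_shift f (s n) + L1_shift g (s n)"] tendsto_const always_eventually allI L1_shift_nonneg)
next
  case (lim f u)
  show ?case
  proof (rule L1_shift_limit_closed[OF lim.hyps(4)])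
    fix e :: real assume "e > 0"
    have [measurable]: "f \<in> borel_measurable borel" "\<And>i. u i \<in> borel_measurable borel"
      using lim.hyps(1,4) by auto
    have "(\<lambda>i. LINT x|lborel. norm (f x - u i x)) \<longlonglongrightarrow> (LINT x|(lborel :: 'a measure). 0)"
    proof (rule integral_dominated_convergence[where w="\<lambda>x. 3 * norm (f x)"])
      show "AE x in lborel. (\<lambda>i. norm (f x - u i x)) \<longlonglongrightarrow> 0"
      proof (rule AE_I2)
        fix x :: 'a
        have "(\<lambda>i. norm (f x - u i x)) \<longlonglongrightarrow> norm (f x - f x)"
          by (intro tendsto_intros lim.hyps(2)) auto
        then show "(\<lambda>i. norm (f x - u i x)) \<longlonglongrightarrow> 0" by simp
      qed
      show "AE x in lborel. norm (norm (f x - u i x)) \<le> 3 * norm (f x)" for i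
      proof (rule AE_I2)
        fix x :: 'a
        show "norm (norm (f x - u i x)) \<le> 3 * norm (f x)"
          using norm_triangle_ineq4[of "f x" "u i x"] lim.hyps(3)[of x i] by simp
      qed
    qed (use lim.hyps(4) in auto)
    then have "eventually (\<lambda>i. (LINT x|lborel. norm (f x - u i x)) < e) sequentially"
      using order_tendstoD(2) \<open>e > 0\<close> by fastforce
    then obtain i where "(LINT x|lborel. norm (f x - u i x)) < e"
      using eventually_happens' trivial_limit_sequentially by blast
    then show "\<exists>g. integrable lborel g \<and> (LINT x|lborel. norm (f x - g x)) < e \<and> (\<lambda>n. L1_shift g (s n)) \<longlonglongrightarrow> 0"
      using lim.hyps(1) lim.IH by blast
  qed
qed

lemma L1_shift_small:
  fixes f :: "'a::euclidean_space \<Rightarrow> 'b::{banach, second_countable_topology}"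
  assumes f: "integrable lborel f" and e: "e > 0"
  obtains d where "d > 0" "\<And>s. norm s < d \<Longrightarrow> L1_shift f s < e"
proof -
  have "continuous (at 0) (L1_shift f)"
    unfolding continuous_at_sequentially
    using L1_shift_sequence[OF f] by (auto simp: o_def L1_shift_def[of f 0])
  then have "(L1_shift f \<longlongrightarrow> 0) (at 0)" by (simp add: continuous_at L1_shift_def[of f 0])
  from tendstoD[OF this e] obtain d where d: "d > 0" "\<And>s. s \<noteq> 0 \<Longrightarrow> dist s 0 < d \<Longrightarrow> dist (L1_shift f s) 0 < e"
    unfolding eventually_at by auto
  show ?thesis
  proof (rule that[OF d(1)])
    fix s :: 'a assume "norm s < d"
    with d(2)[of s] e show "L1_shift f s < e"
      by (cases "s = 0") (auto simp: L1_shift_def[of f 0] L1_shift_nonneg)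
  qed
qed

section \<open>Mollification\<close>

text \<open>
  A radial kernel that is C^1 with Lipschitz gradient.  Test functions are only required to be C^1,
  so this polynomial profile can replace a smooth one, and its Taylor remainder is elementary.
\<close>

definition bump :: "real^3 \<Rightarrow> real" where
  "bump x = (max 0 (1 - (norm x)\<^sup>2))\<^sup>2"

definition bump_grad :: "real^3 \<Rightarrow> real^3" where
  "bump_grad x = (- 4 * max 0 (1 - (norm x)\<^sup>2)) *\<^sub>R x"

lemma continuous_on_bump [continuous_intros]:
  "continuous_on S f \<Longrightarrow> continuous_on S (\<lambda>x. bump (f x))"
  unfolding bump_def by (intro continuous_intros)

lemma continuous_on_bump_grad [continuous_intros]:
  "continuous_on S f \<Longrightarrow> continuous_on S (\<lambda>x. bump_grad (f x))"
  unfolding bump_grad_def by (intro continuous_intros)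

lemma bump_bounds: "0 \<le> bump x" "bump x \<le> 1"
proof -
  show "0 \<le> bump x" by (simp add: bump_def)
  show "bump x \<le> 1" unfolding bump_def by (intro power_le_one) auto
qed

lemma bump_eq_0: "norm x \<ge> 1 \<Longrightarrow> bump x = 0"
  unfolding bump_def using power_mono[of 1 "norm x" 2] by simp

lemma bump_grad_eq_0: "norm x \<ge> 1 \<Longrightarrow> bump_grad x = 0"
  unfolding bump_grad_def using power_mono[of 1 "norm x" 2] by simp

lemma bump_pos: "norm x < 1 \<Longrightarrow> bump x > 0"
  unfolding bump_def using power_strict_mono[of "norm x" 1 2] by simp

lemma bump_quadratic_remainder:
  assumes d: "norm d \<le> 1"
  shows "\<bar>bump (x + d) - bump x - d \<bullet> bump_grad x\<bar> \<le> 27 * (norm d)\<^sup>2"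
proof (cases "norm x \<le> 2")
  case True
  define s where "s = 1 - (norm x)\<^sup>2"
  define a where "a = - 2 * (x \<bullet> d) - (norm d)\<^sup>2"
  have sa: "1 - (norm (x + d))\<^sup>2 = s + a"
    unfolding s_def a_def power2_norm_eq_inner by (simp add: inner_simps inner_commute)
  have "\<bar>x \<bullet> d\<bar> \<le> 2 * norm d"
    using Cauchy_Schwarz_ineq2[of x d] mult_right_mono[OF True, of "norm d"] by simp
  moreover have "(norm d)\<^sup>2 \<le> norm d" using d by (simp add: power2_eq_square mult_left_le)
  moreover have "0 \<le> (norm d)\<^sup>2" by simp
  ultimately have "\<bar>a\<bar> \<le> 5 * norm d" unfolding a_def by linarith
  then have a2: "a\<^sup>2 \<le> 25 * (norm d)\<^sup>2"
    using power_mono[of "\<bar>a\<bar>" "5 * norm d" 2] by (simp add: power_mult_distrib)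
  have 1: "\<bar>(max 0 (s + a))\<^sup>2 - (max 0 s)\<^sup>2 - 2 * max 0 s * a\<bar> \<le> a\<^sup>2"
  proof -
    have "s\<^sup>2 \<le> a\<^sup>2" if "s \<ge> 0" "s + a \<le> 0" using that power_mono[of s "-a" 2] by simp
    moreover have "(s+a)\<^sup>2 \<le> a\<^sup>2" if "s \<le> 0" "s + a \<ge> 0" using that power_mono[of "s+a" a 2] by simp
    moreover have "(s + a)\<^sup>2 = s\<^sup>2 + 2 * s * a + a\<^sup>2" by (simp add: power2_sum)
    moreover have "- (s\<^sup>2) - 2 * s * a \<le> a\<^sup>2" using zero_le_power2[of "s + a"] by (simp add: power2_sum)
    moreover have "s\<^sup>2 + 2 * s * a \<le> 0" if "s \<ge> 0" "s + a \<le> 0"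
    proof -
      have "s * (s + 2 * a) \<le> 0" using that by (intro mult_nonneg_nonpos) auto
      then show ?thesis by (simp add: power2_eq_square algebra_simps)
    qed
    ultimately show ?thesis by (cases "s \<ge> 0"; cases "s + a \<ge> 0") (auto simp: max_def abs_le_iff)
  qed
  have s1: "max 0 s \<le> 1" by (simp add: s_def)
  have "bump (x + d) - bump x - d \<bullet> bump_grad x =
      ((max 0 (s + a))\<^sup>2 - (max 0 s)\<^sup>2 - 2 * max 0 s * a) - 2 * max 0 s * (norm d)\<^sup>2"
    unfolding bump_def bump_grad_def sa s_def[symmetric] by (simp add: a_def inner_commute algebra_simps)
  moreover have "0 \<le> 2 * max 0 s * (norm d)\<^sup>2" "2 * max 0 s * (norm d)\<^sup>2 \<le> 2 * (norm d)\<^sup>2"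
    using mult_right_mono[OF s1, of "(norm d)\<^sup>2"] by auto
  ultimately show ?thesis using 1 a2 by linarith
next
  case False
  then have "norm (x + d) \<ge> 1" using d norm_diff_ineq[of x d] by linarith
  with False show ?thesis by (simp add: bump_eq_0 bump_grad_eq_0)
qed

lemma GDERIV_quadratic_remainder:
  fixes f :: "'a::real_inner \<Rightarrow> real"
  assumes r: "r > 0" and rem: "\<And>d. norm d \<le> r \<Longrightarrow> \<bar>f (x + d) - f x - d \<bullet> D\<bar> \<le> L * (norm d)\<^sup>2"
  shows "GDERIV f x :> D"
  unfolding gderiv_def has_derivative_at
proof
  show "bounded_linear (\<lambda>h. h \<bullet> D)" by (rule bounded_linear_inner_left)
  have "\<forall>\<^sub>F d in at 0. norm (norm (f (x + d) - f x - d \<bullet> D) / norm d) \<le> \<bar>L\<bar> * norm d"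
    unfolding eventually_at
  proof (intro exI[of _ r] conjI ballI impI r)
    fix d :: 'a assume d: "d \<noteq> 0 \<and> dist d 0 < r"
    then have "\<bar>f (x + d) - f x - d \<bullet> D\<bar> \<le> L * (norm d)\<^sup>2" by (intro rem) auto
    also have "\<dots> \<le> \<bar>L\<bar> * norm d * norm d" by (simp add: power2_eq_square mult_right_mono mult.assoc[symmetric])
    finally show "norm (norm (f (x + d) - f x - d \<bullet> D) / norm d) \<le> \<bar>L\<bar> * norm d"
      using d by (simp add: divide_le_eq)
  qed
  moreover have "((\<lambda>d::'a. \<bar>L\<bar> * norm d) \<longlongrightarrow> 0) (at 0)"
    by (rule tendsto_eq_intros | simp)+
  ultimately show "((\<lambda>d. norm (f (x + d) - f x - d \<bullet> D) / norm d) \<longlongrightarrow> 0) (at 0)"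
    by (rule Lim_null_comparison)
qed

lemma GDERIV_bump_scaled: "GDERIV (\<lambda>x. bump (s *\<^sub>R (x - y))) x :> s *\<^sub>R bump_grad (s *\<^sub>R (x - y))"
proof -
  have "GDERIV bump z :> bump_grad z" for z
    by (rule GDERIV_quadratic_remainder[OF zero_less_one]) (rule bump_quadratic_remainder)
  then have "(bump has_derivative (\<lambda>h. h \<bullet> bump_grad (s *\<^sub>R (x - y)))) (at (s *\<^sub>R (x - y)))"
    by (simp add: gderiv_def)
  moreover have "((\<lambda>x. s *\<^sub>R (x - y)) has_derivative (\<lambda>h. s *\<^sub>R h)) (at x)"
    by (auto intro!: derivative_eq_intros)
  ultimately have "((\<lambda>x. bump (s *\<^sub>R (x - y))) has_derivative (\<lambda>h. (s *\<^sub>R h) \<bullet> bump_grad (s *\<^sub>R (x - y)))) (at x)"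
    by (rule has_derivative_compose[rotated])
  then show ?thesis by (simp add: gderiv_def)
qed

definition locally_integrable :: "(real^3 \<Rightarrow> 'b::{banach, second_countable_topology}) \<Rightarrow> bool" where
  "locally_integrable h \<longleftrightarrow> (\<forall>K. compact K \<longrightarrow> set_integrable lborel K h)"

lemma locally_integrable_measurable:
  fixes h :: "real^3 \<Rightarrow> 'b::{banach, second_countable_topology}"
  assumes h: "locally_integrable h" shows "h \<in> borel_measurable borel"
proof (rule borel_measurable_LIMSEQ_metric)
  show "(\<lambda>y. indicator (cball 0 (real n)) y *\<^sub>R h y) \<in> borel_measurable borel" for n :: nat
  proof -
    have "integrable lborel (\<lambda>y. indicator (cball 0 (real n)) y *\<^sub>R h y)"
      using h compact_cball unfolding locally_integrable_def set_integrable_def by blast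
    then show ?thesis by (auto dest: borel_measurable_integrable)
  qed
  fix y :: "real^3"
  obtain N :: nat where N: "norm y \<le> real N" using real_arch_simple by blast
  have "eventually (\<lambda>n. h y = indicator (cball 0 (real n)) y *\<^sub>R h y) sequentially"
    using eventually_ge_at_top[of N] by eventually_elim (use N in auto)
  then show "(\<lambda>n. indicator (cball 0 (real n)) y *\<^sub>R h y) \<longlonglongrightarrow> h y"
    by (rule Lim_transform_eventually[rotated]) simp
qed

lemma locally_integrable_scaleR:
  fixes h :: "real^3 \<Rightarrow> 'b::{banach, second_countable_topology}" and \<phi> :: "real^3 \<Rightarrow> real"
  assumes \<phi>: "continuous_on UNIV \<phi>" and h: "locally_integrable h"
  shows "locally_integrable (\<lambda>x. \<phi> x *\<^sub>R h x)"
  unfolding locally_integrable_def set_integrable_def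
proof (intro allI impI)
  fix K :: "(real^3) set" assume K: "compact K"
  have [measurable]: "\<phi> \<in> borel_measurable borel" using \<phi> by (rule borel_measurable_continuous_onI)
  have iK: "integrable lborel (\<lambda>y. indicator K y *\<^sub>R h y)"
    using h K by (simp add: locally_integrable_def set_integrable_def)
  have "bounded (\<phi> ` K)"
    by (intro compact_imp_bounded compact_continuous_image K continuous_on_subset[OF \<phi>]) auto
  then obtain B where B: "\<And>x. x \<in> K \<Longrightarrow> norm (\<phi> x) \<le> B" by (auto simp: bounded_iff)
  have "integrable lborel (\<lambda>y. \<phi> y *\<^sub>R (indicator K y *\<^sub>R h y))"
  proof (rule Bochner_Integration.integrable_bound[OF integrable_scaleR_right[OF iK, of B]])
    show "(\<lambda>y. \<phi> y *\<^sub>R (indicator K y *\<^sub>R h y)) \<in> borel_measurable lborel"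
      by (intro borel_measurable_scaleR borel_measurable_integrable[OF iK]) simp
    show "AE x in lborel. norm (\<phi> x *\<^sub>R indicator K x *\<^sub>R h x) \<le> norm (B *\<^sub>R indicator K x *\<^sub>R h x)"
      by (rule AE_I2) (use B in \<open>force simp: indicator_def intro!: mult_right_mono\<close>)
  qed
  then show "integrable lborel (\<lambda>x. indicator K x *\<^sub>R \<phi> x *\<^sub>R h x)"
    by (simp add: mult.commute)
qed

lemma locally_integrable_scaleR_vector:
  fixes \<phi> :: "real^3 \<Rightarrow> real^3" and h :: "real^3 \<Rightarrow> real"
  assumes \<phi>: "continuous_on UNIV \<phi>" and h: "locally_integrable h"
  shows "locally_integrable (\<lambda>x. h x *\<^sub>R \<phi> x)"
  unfolding locally_integrable_def set_integrable_def
proof (intro allI impI)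
  fix K :: "(real^3) set" assume K: "compact K"
  have [measurable]: "\<phi> \<in> borel_measurable borel" "h \<in> borel_measurable borel" "K \<in> sets borel"
    using \<phi> locally_integrable_measurable[OF h] K
    by (auto intro: borel_measurable_continuous_onI simp: borel_compact)
  have "integrable lborel (\<lambda>x. indicator K x *\<^sub>R (norm (\<phi> x) *\<^sub>R h x))"
    using locally_integrable_scaleR[OF continuous_on_norm[OF \<phi>] h] K
    by (auto simp: locally_integrable_def set_integrable_def)
  then show "integrable lborel (\<lambda>x. indicator K x *\<^sub>R h x *\<^sub>R \<phi> x)"
    by (rule Bochner_Integration.integrable_bound) (auto simp: indicator_def abs_mult)
qed

lemma integrable_compact_support:
  fixes h :: "real^3 \<Rightarrow> 'b::{banach, second_countable_topology}"
  assumes h: "locally_integrable h" and K: "compact K" "\<And>x. x \<notin> K \<Longrightarrow> h x = 0"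
  shows "integrable lborel h"
proof -
  have "(\<lambda>x. indicator K x *\<^sub>R h x) = h" using K(2) by (auto simp: fun_eq_iff indicator_def)
  with h K(1) show ?thesis by (auto simp: locally_integrable_def set_integrable_def)
qed

lemma integrable_scaleR_compact_support:
  fixes \<phi> :: "real^3 \<Rightarrow> real" and h :: "real^3 \<Rightarrow> 'b::{banach, second_countable_topology}"
  assumes "continuous_on UNIV \<phi>" "compact K" "\<And>x. x \<notin> K \<Longrightarrow> \<phi> x = 0" "locally_integrable h"
  shows "integrable lborel (\<lambda>y. \<phi> y *\<^sub>R h y)"
  by (rule integrable_compact_support[OF locally_integrable_scaleR]) (use assms in auto)

lemma integrable_scaleR_vector_compact_support:
  fixes \<phi> :: "real^3 \<Rightarrow> real^3" and h :: "real^3 \<Rightarrow> real"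
  assumes "continuous_on UNIV \<phi>" "compact K" "\<And>x. x \<notin> K \<Longrightarrow> \<phi> x = 0" "locally_integrable h"
  shows "integrable lborel (\<lambda>y. h y *\<^sub>R \<phi> y)"
  by (rule integrable_compact_support[OF locally_integrable_scaleR_vector]) (use assms in auto)

definition bump_mass :: "real \<Rightarrow> real" where
  "bump_mass r = (LINT y|lborel. bump ((1/r) *\<^sub>R y))"

lemma locally_integrable_continuous:
  fixes f :: "real^3 \<Rightarrow> 'b::euclidean_space"
  shows "continuous_on UNIV f \<Longrightarrow> locally_integrable f"
  unfolding locally_integrable_def set_integrable_def
  by (auto intro!: borel_integrable_compact intro: continuous_on_subset)

lemma bump_scaled_eq_0: "r > 0 \<Longrightarrow> norm x \<ge> r \<Longrightarrow> bump ((1/r) *\<^sub>R x) = 0"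
  by (rule bump_eq_0) (simp add: field_simps)

lemma bump_grad_scaled_eq_0: "r > 0 \<Longrightarrow> norm x \<ge> r \<Longrightarrow> bump_grad ((1/r) *\<^sub>R x) = 0"
  by (rule bump_grad_eq_0) (simp add: field_simps)

lemma integrable_bump_scaled:
  assumes "r > 0" shows "integrable lborel (\<lambda>y. bump ((1/r) *\<^sub>R y))"
proof -
  have "integrable lborel (\<lambda>y. bump ((1/r) *\<^sub>R y) *\<^sub>R (1::real))"
    by (rule integrable_scaleR_compact_support[where K="cball 0 r"])
      (use assms in \<open>auto intro!: continuous_intros bump_scaled_eq_0[unfolded scaleR_conv_of_real] locally_integrable_continuous bump_scaled_eq_0\<close>)
  then show ?thesis by simp
qed

lemma bump_mass_pos:
  assumes r: "r > 0" shows "bump_mass r > 0"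
proof -
  have "bump_mass r \<ge> 0" unfolding bump_mass_def by (simp add: bump_bounds)
  moreover have "bump_mass r \<noteq> 0"
  proof
    assume "bump_mass r = 0"
    then have "AE y in lborel. bump ((1/r) *\<^sub>R y) = 0"
      unfolding bump_mass_def
      by (subst (asm) integral_nonneg_eq_0_iff_AE[OF integrable_bump_scaled[OF r]]) (auto simp: bump_bounds)
    then have "AE y in lborel. y \<notin> ball (0::real^3) r"
    proof eventually_elim
      fix y :: "real^3" assume "bump ((1/r) *\<^sub>R y) = 0"
      with bump_pos[of "(1/r) *\<^sub>R y"] r show "y \<notin> ball 0 r" by (auto simp: field_simps)
    qed
    then have "ball (0::real^3) r \<in> null_sets lborel" by (subst AE_iff_null_sets) auto
    then have "emeasure lborel (ball (0::real^3) r) = 0" by (rule null_setsD1)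
    moreover have "ball (0::real^3) r \<noteq> {}" using r by auto
    ultimately show False
      using emeasure_lborel_ball_finite open_not_negligible[OF open_ball, of 0 r]
      by (auto simp: negligible_iff_null_sets null_sets_completionI null_setsI)
  qed
  ultimately show ?thesis by simp
qed

definition mollifier :: "real \<Rightarrow> real^3 \<Rightarrow> real" where
  "mollifier r y = bump ((1/r) *\<^sub>R y) / bump_mass r"

definition mollify :: "real \<Rightarrow> (real^3 \<Rightarrow> 'b) \<Rightarrow> real^3 \<Rightarrow> 'b::{banach, second_countable_topology}" where
  "mollify r h x = (LINT y|lborel. mollifier r (y - x) *\<^sub>R h y)"

lemma mollifier_nonneg: "r > 0 \<Longrightarrow> mollifier r y \<ge> 0"
  unfolding mollifier_def using bump_mass_pos[of r] bump_bounds by simp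

lemma mollifier_eq_0: "r > 0 \<Longrightarrow> norm y \<ge> r \<Longrightarrow> mollifier r y = 0"
  unfolding mollifier_def using bump_scaled_eq_0 by simp

lemma continuous_on_mollifier: "continuous_on S f \<Longrightarrow> continuous_on S (\<lambda>y. mollifier r (f y))"
  unfolding mollifier_def divide_inverse
  by (intro continuous_on_mult continuous_on_const continuous_on_bump continuous_on_scaleR)

lemma mollifier_measurable [measurable]: "mollifier r \<in> borel_measurable borel"
  by (intro borel_measurable_continuous_onI continuous_on_mollifier[OF continuous_on_id])

lemma integrable_mollifier: "r > 0 \<Longrightarrow> integrable lborel (mollifier r)"
  unfolding mollifier_def[abs_def] using integrable_bump_scaled by simp

lemma integral_mollifier: "r > 0 \<Longrightarrow> (LINT y|lborel. mollifier r y) = 1"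
  unfolding mollifier_def using bump_mass_pos[of r] by (simp add: bump_mass_def)

lemma nn_integral_mollifier: "r > 0 \<Longrightarrow> (\<integral>\<^sup>+y. ennreal (mollifier r y) \<partial>lborel) = 1"
  using nn_integral_eq_integral[OF integrable_mollifier] mollifier_nonneg integral_mollifier by simp

lemma integrable_mollify:
  assumes r: "r > 0" and h: "locally_integrable h"
  shows "integrable lborel (\<lambda>y. mollifier r (y - x) *\<^sub>R h y)"
proof (rule integrable_scaleR_compact_support[OF _ _ _ h])
  show "compact (cball x r)" by simp
  show "continuous_on UNIV (\<lambda>y. mollifier r (y - x))" by (intro continuous_on_mollifier continuous_intros)
  show "mollifier r (y - x) = 0" if "y \<notin> cball x r" for y
    using that by (intro mollifier_eq_0 r) (auto simp: dist_norm norm_minus_commute)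
qed

lemma test_function_mollifier:
  assumes r: "r > 0"
  shows "test_function (\<lambda>y. mollifier r (y - x)) (\<lambda>y. (1 / (r * bump_mass r)) *\<^sub>R bump_grad ((1/r) *\<^sub>R (y - x)))"
  unfolding test_function_def
proof (intro conjI allI)
  fix y
  have "GDERIV (\<lambda>y. inverse (bump_mass r) * bump ((1/r) *\<^sub>R (y - x))) y :>
     inverse (bump_mass r) *\<^sub>R (1/r) *\<^sub>R bump_grad ((1/r) *\<^sub>R (y - x)) + bump ((1/r) *\<^sub>R (y - x)) *\<^sub>R 0"
    by (intro GDERIV_mult GDERIV_const GDERIV_bump_scaled)
  then show "GDERIV (\<lambda>y. mollifier r (y - x)) y :> (1 / (r * bump_mass r)) *\<^sub>R bump_grad ((1/r) *\<^sub>R (y - x))"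
    by (simp add: mollifier_def divide_inverse mult.commute)
  show "continuous_on UNIV (\<lambda>y. (1 / (r * bump_mass r)) *\<^sub>R bump_grad ((1/r) *\<^sub>R (y - x)))"
    by (intro continuous_intros)
  have "{y. mollifier r (y - x) \<noteq> 0} \<subseteq> cball x r"
  proof
    fix y assume "y \<in> {y. mollifier r (y - x) \<noteq> 0}"
    then have "norm (y - x) < r" using mollifier_eq_0[OF r, of "y - x"] by force
    then show "y \<in> cball x r" by (simp add: dist_norm norm_minus_commute)
  qed
  then have "bounded {y. mollifier r (y - x) \<noteq> 0}" by (rule bounded_subset[OF bounded_cball])
  then show "compact (closure {y. mollifier r (y - x) \<noteq> 0})" by simp
qed

text \<open>
  The kernel has a quadratic Taylor remainder, uniformly in the base point, so the convolution can be
  differentiated under the integral with a remainder of the same kind.  The derivative falls on the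
  kernel, which is a test function in the integration variable, and the weak gradient of h moves it to k.
\<close>

lemma GDERIV_mollify:
  fixes h :: "real^3 \<Rightarrow> real"
  assumes r: "r > 0" and w: "has_weak_gradient h k"
  shows "GDERIV (mollify r h) x :> mollify r k x"
proof -
  have h: "locally_integrable h" and k: "locally_integrable k"
    using w by (auto simp: has_weak_gradient_def locally_integrable_def)
  define M where "M = bump_mass r"
  have M: "M > 0" using bump_mass_pos[OF r] by (simp add: M_def)
  let ?\<psi> = "\<lambda>y. (1 / (r * M)) *\<^sub>R bump_grad ((1/r) *\<^sub>R (y - x))"
  have i\<psi>: "integrable lborel (\<lambda>y. h y *\<^sub>R ?\<psi> y)"
  proof (rule integrable_scaleR_vector_compact_support[OF _ _ _ h])
    show "compact (cball x r)" by simp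
    show "continuous_on UNIV ?\<psi>" by (intro continuous_intros)
    show "?\<psi> y = 0" if "y \<notin> cball x r" for y
      using that by (subst bump_grad_scaled_eq_0) (use r in \<open>auto simp: dist_norm norm_minus_commute\<close>)
  qed
  have weak: "(LINT y|lborel. h y *\<^sub>R ?\<psi> y) = - mollify r k x"
    using w test_function_mollifier[OF r, of x] unfolding has_weak_gradient_def mollify_def M_def by blast
  define L where "L = 27 / (r\<^sup>2 * M) * (LINT y:cball x (2*r)|lborel. \<bar>h y\<bar>)"
  have iabs: "integrable lborel (\<lambda>y. indicator (cball x (2*r)) y *\<^sub>R \<bar>h y\<bar>)"
  proof -
    have "integrable lborel (\<lambda>y. indicator (cball x (2*r)) y *\<^sub>R h y)"
      using h compact_cball unfolding locally_integrable_def set_integrable_def by blast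
    from integrable_norm[OF this] show ?thesis by (simp add: abs_mult)
  qed
  show ?thesis
  proof (rule GDERIV_quadratic_remainder[OF r, where L=L])
    fix d :: "real^3" assume d: "norm d \<le> r"
    define q where "q y = mollifier r (y - (x + d)) - mollifier r (y - x) + d \<bullet> ?\<psi> y" for y
    have i1: "integrable lborel (\<lambda>y. mollifier r (y - (x + d)) *\<^sub>R h y)"
      and i2: "integrable lborel (\<lambda>y. mollifier r (y - x) *\<^sub>R h y)"
      by (intro integrable_mollify[OF r h])+
    have i3: "integrable lborel (\<lambda>y. d \<bullet> (h y *\<^sub>R ?\<psi> y))"
      by (intro integrable_inner_right i\<psi>)
    have e: "mollify r h (x + d) - mollify r h x - d \<bullet> mollify r k x = (LINT y|lborel. q y * h y)"
    proof -
      have "d \<bullet> mollify r k x = - (LINT y|lborel. d \<bullet> (h y *\<^sub>R ?\<psi> y))"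
        unfolding integral_inner_right[of d lborel "\<lambda>y. h y *\<^sub>R ?\<psi> y", OF i\<psi>] weak by simp
      moreover have "(LINT y|lborel. q y * h y) = (LINT y|lborel. mollifier r (y - (x + d)) *\<^sub>R h y)
        - (LINT y|lborel. mollifier r (y - x) *\<^sub>R h y) + (LINT y|lborel. d \<bullet> (h y *\<^sub>R ?\<psi> y))"
        using i1 i2 i3 unfolding q_def
        by (subst Bochner_Integration.integral_diff[symmetric] Bochner_Integration.integral_add[symmetric];
            (simp add: algebra_simps)?)+
      ultimately show ?thesis by (simp add: mollify_def)
    qed
    have qb: "\<bar>q y * h y\<bar> \<le> 27 / (r\<^sup>2 * M) * (norm d)\<^sup>2 * (indicator (cball x (2*r)) y *\<^sub>R \<bar>h y\<bar>)" for y
    proof (cases "y \<in> cball x (2*r)")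
      case True
      have "q y = (bump ((1/r) *\<^sub>R (y - x) + (-1/r) *\<^sub>R d) - bump ((1/r) *\<^sub>R (y - x))
          - ((-1/r) *\<^sub>R d) \<bullet> bump_grad ((1/r) *\<^sub>R (y - x))) / M"
        using M r by (simp add: q_def mollifier_def M_def[symmetric] algebra_simps diff_divide_distrib add_divide_distrib)
      moreover have "\<bar>bump ((1/r) *\<^sub>R (y - x) + (-1/r) *\<^sub>R d) - bump ((1/r) *\<^sub>R (y - x))
          - ((-1/r) *\<^sub>R d) \<bullet> bump_grad ((1/r) *\<^sub>R (y - x))\<bar> \<le> 27 * (norm ((-1/r) *\<^sub>R d))\<^sup>2"
        by (rule bump_quadratic_remainder) (use d r in \<open>simp add: field_simps\<close>)
      ultimately have "\<bar>q y\<bar> \<le> 27 * (norm ((-1/r) *\<^sub>R d))\<^sup>2 / M"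
        using M by (simp add: divide_right_mono)
      also have "\<dots> = 27 / (r\<^sup>2 * M) * (norm d)\<^sup>2" using r by (simp add: power_divide)
      finally show ?thesis using True mult_right_mono[of "\<bar>q y\<bar>" "27 / (r\<^sup>2 * M) * (norm d)\<^sup>2" "\<bar>h y\<bar>"]
        by (simp add: abs_mult)
    next
      case False
      then have "norm (y - x) \<ge> 2*r" by (simp add: dist_norm norm_minus_commute)
      moreover have "norm (y - (x + d)) \<ge> norm (y - x) - norm d"
        using norm_triangle_ineq2[of "y - x" d] by (simp add: algebra_simps)
      ultimately have "q y = 0" using d r
        by (simp add: q_def mollifier_eq_0 bump_grad_scaled_eq_0)
      then show ?thesis using False by simp
    qed
    have "\<bar>LINT y|lborel. q y * h y\<bar> \<le> (LINT y|lborel. \<bar>q y * h y\<bar>)"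
      using integral_norm_bound[of lborel "\<lambda>y. q y * h y"] by simp
    also have "\<dots> \<le> (LINT y|lborel. 27 / (r\<^sup>2 * M) * (norm d)\<^sup>2 * (indicator (cball x (2*r)) y *\<^sub>R \<bar>h y\<bar>))"
      using qb M by (intro integral_mono_AE' AE_I2 integrable_mult_right iabs)
        (auto intro!: divide_nonneg_nonneg mult_nonneg_nonneg)
    also have "\<dots> = L * (norm d)\<^sup>2"
      unfolding integral_mult_right_zero L_def set_lebesgue_integral_def by (simp add: mult.commute)
    finally show "\<bar>mollify r h (x + d) - mollify r h x - d \<bullet> mollify r k x\<bar> \<le> L * (norm d)\<^sup>2"
      by (simp add: e)
  qed
qed

lemma continuous_on_mollify:
  fixes k :: "real^3 \<Rightarrow> 'b::{banach, second_countable_topology}"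
  assumes r: "r > 0" and k: "locally_integrable k"
  shows "continuous_on UNIV (mollify r k)"
proof -
  have "continuous (at x) (mollify r k)" for x
    unfolding continuous_at_sequentially
  proof (intro allI impI)
    fix u assume u: "u \<longlonglongrightarrow> x"
    have [measurable]: "k \<in> borel_measurable borel" using locally_integrable_measurable[OF k] .
    have iK: "integrable lborel (\<lambda>y. indicator (cball x (r + 1)) y *\<^sub>R k y)"
      using k by (simp add: locally_integrable_def set_integrable_def)
    have ev: "eventually (\<lambda>n. dist (u n) x < 1) sequentially" using tendstoD[OF u] by simp
    then obtain N where N: "\<And>n. n \<ge> N \<Longrightarrow> dist (u n) x < 1" unfolding eventually_sequentially by auto
    have "(\<lambda>n. LINT y|lborel. mollifier r (y - u (n + N)) *\<^sub>R k y) \<longlonglongrightarrow> (LINT y|lborel. mollifier r (y - x) *\<^sub>R k y)"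
    proof (rule integral_dominated_convergence[where w="\<lambda>y. (1 / bump_mass r) * norm (indicator (cball x (r + 1)) y *\<^sub>R k y)"])
      show "integrable lborel (\<lambda>y. (1 / bump_mass r) * norm (indicator (cball x (r + 1)) y *\<^sub>R k y))"
        using iK by (intro integrable_mult_right integrable_norm)
      show "AE y in lborel. (\<lambda>n. mollifier r (y - u (n + N)) *\<^sub>R k y) \<longlonglongrightarrow> mollifier r (y - x) *\<^sub>R k y"
      proof (rule AE_I2)
        fix y
        have "isCont (mollifier r) (y - x)"
          using continuous_on_mollifier[OF continuous_on_id, of UNIV r] by (simp add: continuous_on_eq_continuous_at)
        moreover have "(\<lambda>n. y - u (n + N)) \<longlonglongrightarrow> y - x"
          by (intro tendsto_intros LIMSEQ_ignore_initial_segment u)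
        ultimately have "(\<lambda>n. mollifier r (y - u (n + N))) \<longlonglongrightarrow> mollifier r (y - x)"
          by (rule isCont_tendsto_compose)
        then show "(\<lambda>n. mollifier r (y - u (n + N)) *\<^sub>R k y) \<longlonglongrightarrow> mollifier r (y - x) *\<^sub>R k y"
          by (intro tendsto_intros)
      qed
      show "AE y in lborel. norm (mollifier r (y - u (n + N)) *\<^sub>R k y) \<le> (1 / bump_mass r) * norm (indicator (cball x (r + 1)) y *\<^sub>R k y)" for n
      proof (rule AE_I2)
        fix y
        show "norm (mollifier r (y - u (n + N)) *\<^sub>R k y) \<le> (1 / bump_mass r) * norm (indicator (cball x (r + 1)) y *\<^sub>R k y)"
        proof (cases "y \<in> cball x (r + 1)")
          case True
          have "mollifier r (y - u (n + N)) \<le> 1 / bump_mass r"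
            unfolding mollifier_def using bump_mass_pos[OF r] bump_bounds by (intro divide_right_mono) auto
          then show ?thesis using True mollifier_nonneg[OF r, of "y - u (n + N)"] 
            using mult_right_mono[of "mollifier r (y - u (n + N))" "1 / bump_mass r" "norm (k y)"] by simp
        next
          case False
          have "dist y x \<le> dist y (u (n + N)) + dist (u (n + N)) x" by (rule dist_triangle)
          then have "norm (y - u (n + N)) \<ge> r" using False N[of "n + N"]
            by (simp add: dist_norm norm_minus_commute)
          then show ?thesis using False by (simp add: mollifier_eq_0[OF r])
        qed
      qed
    qed measurable
    then have "(\<lambda>n. mollify r k (u (n + N))) \<longlonglongrightarrow> mollify r k x" by (simp add: mollify_def)
    then show "(mollify r k \<circ> u) \<longlonglongrightarrow> mollify r k x"
      unfolding o_def by (rule LIMSEQ_offset)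
  qed
  then show ?thesis by (simp add: continuous_at_imp_continuous_on)
qed

text \<open>
  The mollification is an average of translates of h, hence its distance to h in the mean is at most the
  largest distance of h to a translate by a vector shorter than r.
\<close>

lemma mollify_L1_le:
  fixes h :: "real^3 \<Rightarrow> 'b::{banach, second_countable_topology}"
  assumes r: "r > 0" and h: "integrable lborel h"
    and e: "\<And>s. norm s < r \<Longrightarrow> L1_shift h s \<le> e" "e \<ge> 0"
  shows "(\<integral>\<^sup>+x. ennreal (norm (mollify r h x - h x)) \<partial>lborel) \<le> ennreal e"
proof -
  have [measurable]: "h \<in> borel_measurable borel" using h by auto
  have lh: "locally_integrable h"
    unfolding locally_integrable_def set_integrable_def
    using h by (auto intro!: integrable_mult_indicator simp: borel_compact)
  have pt: "ennreal (norm (mollify r h x - h x)) \<le> (\<integral>\<^sup>+s. ennreal (mollifier r s) * ennreal (norm (h (x + s) - h x)) \<partial>lborel)" for x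
  proof -
    have i1: "integrable lborel (\<lambda>s. mollifier r s *\<^sub>R h (x + s))"
      using integrable_translate[OF integrable_mollify[OF r lh, of x], of x] by (simp add: add.commute)
    have "mollify r h x = (LINT s|lborel. mollifier r s *\<^sub>R h (x + s))"
      unfolding mollify_def by (subst integral_translate[symmetric, where x=x]) (auto simp: add.commute)
    moreover have "h x = (LINT s|lborel. mollifier r s *\<^sub>R h x)"
      using integrable_mollifier[OF r] integral_mollifier[OF r] by simp
    ultimately have "mollify r h x - h x = (LINT s|lborel. mollifier r s *\<^sub>R (h (x + s) - h x))"
      using i1 integrable_mollifier[OF r] by (simp add: scaleR_diff_right)
    moreover have "integrable lborel (\<lambda>s. mollifier r s *\<^sub>R (h (x + s) - h x))"
      unfolding scaleR_diff_right
      by (rule Bochner_Integration.integrable_diff[OF i1]) (use integrable_mollifier[OF r] in simp)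
    ultimately have "ennreal (norm (mollify r h x - h x)) \<le> (\<integral>\<^sup>+s. ennreal (norm (mollifier r s *\<^sub>R (h (x + s) - h x))) \<partial>lborel)"
      using integral_norm_bound_ennreal[of lborel "\<lambda>s. mollifier r s *\<^sub>R (h (x + s) - h x)"] by simp
    then show ?thesis by (simp add: ennreal_mult mollifier_nonneg[OF r])
  qed
  have "(\<integral>\<^sup>+x. ennreal (norm (mollify r h x - h x)) \<partial>lborel)
     \<le> (\<integral>\<^sup>+x. \<integral>\<^sup>+s. ennreal (mollifier r s) * ennreal (norm (h (x + s) - h x)) \<partial>lborel \<partial>lborel)"
    by (intro nn_integral_mono pt)
  also have "\<dots> = (\<integral>\<^sup>+s. \<integral>\<^sup>+x. ennreal (mollifier r s) * ennreal (norm (h (x + s) - h x)) \<partial>lborel \<partial>lborel)"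
    by (rule lborel_pair.Fubini') measurable
  also have "\<dots> \<le> (\<integral>\<^sup>+s. ennreal (mollifier r s) * ennreal e \<partial>lborel)"
  proof (rule nn_integral_mono)
    fix s :: "real^3"
    have "(\<integral>\<^sup>+x. ennreal (mollifier r s) * ennreal (norm (h (x + s) - h x)) \<partial>lborel)
      = ennreal (mollifier r s) * ennreal (L1_shift h s)"
      using nn_integral_eq_integral[OF integrable_shift_diff[OF h, of s]]
      by (simp add: nn_integral_cmult L1_shift_def)
    also have "\<dots> \<le> ennreal (mollifier r s) * ennreal e"
      using e(1)[of s] mollifier_eq_0[OF r, of s] by (cases "norm s < r") (auto intro!: mult_left_mono ennreal_leI)
    finally show "(\<integral>\<^sup>+x. ennreal (mollifier r s) * ennreal (norm (h (x + s) - h x)) \<partial>lborel) \<le> ennreal (mollifier r s) * ennreal e" .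
  qed
  also have "\<dots> = ennreal e" by (simp add: nn_integral_multc nn_integral_mollifier[OF r])
  finally show ?thesis .
qed

text \<open>
  Near the compact set K, mollification at scales below one does not see the values of h outside a
  ball of radius larger by one, so h may be cut off there and is then globally integrable.
\<close>

lemma mollify_tendsto_L1_compact:
  fixes h :: "real^3 \<Rightarrow> 'b::{banach, second_countable_topology}"
  assumes h: "locally_integrable h" and K: "compact K"
  shows "(\<lambda>n. LINT x|lborel. norm (indicator K x *\<^sub>R (mollify (1 / real (Suc n)) h x - h x))) \<longlonglongrightarrow> 0"
proof (rule LIMSEQ_I)
  fix e :: real assume e: "e > 0"
  obtain B where B: "\<And>x. x \<in> K \<Longrightarrow> norm x \<le> B" using compact_imp_bounded[OF K] by (auto simp: bounded_iff)
  define h' where "h' x = indicator (cball 0 (B + 1)) x *\<^sub>R h x" for x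
  have ih': "integrable lborel h'"
    using h unfolding locally_integrable_def set_integrable_def h'_def[abs_def] by auto
  have [measurable]: "K \<in> sets borel" "h \<in> borel_measurable borel"
    using K locally_integrable_measurable[OF h] by (auto simp: borel_compact)
  obtain d where d: "d > 0" "\<And>s. norm s < d \<Longrightarrow> L1_shift h' s < e / 2"
    using L1_shift_small[OF ih', of "e/2"] e by auto
  obtain N where N: "inverse (real (Suc N)) < d" using reals_Archimedean[OF d(1)] by auto
  show "\<exists>N. \<forall>n\<ge>N. norm ((LINT x|lborel. norm (indicator K x *\<^sub>R (mollify (1 / real (Suc n)) h x - h x))) - 0) < e"
  proof (intro exI allI impI)
    fix n assume n: "n \<ge> N"
    define r where "r = 1 / real (Suc n)"
    have r: "r > 0" "r \<le> 1" "r < d"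
      using N n by (auto simp: r_def inverse_eq_divide elim!: le_less_trans[rotated] intro!: divide_left_mono)
    have [measurable]: "mollify r h \<in> borel_measurable borel"
      by (intro borel_measurable_continuous_onI continuous_on_mollify r h)
    have eq: "norm (indicator K x *\<^sub>R (mollify r h x - h x)) \<le> norm (mollify r h' x - h' x)" for x
    proof (cases "x \<in> K")
      case True
      have "mollify r h x = mollify r h' x"
        unfolding mollify_def
      proof (rule Bochner_Integration.integral_cong)
        fix y
        show "mollifier r (y - x) *\<^sub>R h y = mollifier r (y - x) *\<^sub>R h' y"
        proof (cases "norm (y - x) \<ge> r")
          case False
          have "norm y \<le> norm x + norm (y - x)" using norm_triangle_ineq[of x "y - x"] by simp
          then have "norm y \<le> B + 1" using False B[OF True] r by linarith
          then show ?thesis by (simp add: h'_def)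
        qed (simp add: mollifier_eq_0[OF r(1)])
      qed simp
      moreover have "h x = h' x" using B[OF True] by (simp add: h'_def)
      ultimately show ?thesis using True by simp
    qed simp
    have "(\<integral>\<^sup>+x. ennreal (norm (indicator K x *\<^sub>R (mollify r h x - h x))) \<partial>lborel) \<le> (\<integral>\<^sup>+x. ennreal (norm (mollify r h' x - h' x)) \<partial>lborel)"
      by (intro nn_integral_mono ennreal_leI eq)
    also have "\<dots> \<le> ennreal (e / 2)"
      using d(2) r e by (intro mollify_L1_le ih') (auto intro: less_imp_le)
    finally have le: "(\<integral>\<^sup>+x. ennreal (norm (indicator K x *\<^sub>R (mollify r h x - h x))) \<partial>lborel) \<le> ennreal (e / 2)" .
    have "(LINT x|lborel. norm (indicator K x *\<^sub>R (mollify r h x - h x))) =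
        enn2real (\<integral>\<^sup>+x. ennreal (norm (indicator K x *\<^sub>R (mollify r h x - h x))) \<partial>lborel)"
      by (rule integral_eq_nn_integral) auto
    also have "\<dots> \<le> enn2real (ennreal (e / 2))" by (rule enn2real_mono[OF le]) simp
    finally have "(LINT x|lborel. norm (indicator K x *\<^sub>R (mollify r h x - h x))) \<le> e / 2" using e by simp
    then show "norm ((LINT x|lborel. norm (indicator K x *\<^sub>R (mollify (1 / real (Suc n)) h x - h x))) - 0) < e"
      using e by (simp add: r_def)
  qed
qed

section \<open>Weak gradients vanish on the zero set\<close>

lemma has_weak_gradient_locally_integrable:
  assumes "has_weak_gradient f g"
  shows "locally_integrable f" "locally_integrable g"
  using assms by (auto simp: has_weak_gradient_def locally_integrable_def)

lemma mollify_nonneg: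
  fixes h :: "real^3 \<Rightarrow> real"
  assumes "r > 0" "\<And>x. 0 \<le> h x" shows "0 \<le> mollify r h x"
  unfolding mollify_def using mollifier_nonneg[OF assms(1)] assms(2) by simp

lemma difference_quotient_bound:
  fixes F :: "real^3 \<Rightarrow> real" and F' :: "real^3 \<Rightarrow> real^3"
  assumes F: "\<And>x. GDERIV F x :> F' x" "continuous_on UNIV F'" and t: "t > 0" and e: "norm e \<le> 1"
  shows "ennreal \<bar>F (x + t *\<^sub>R e) - F x - t * (a \<bullet> e)\<bar>
    \<le> (\<integral>\<^sup>+s. indicator {0..t} s * ennreal (norm (F' (x + s *\<^sub>R e) - a)) \<partial>lborel)"
proof -
  let ?g = "\<lambda>s. (F' (x + s *\<^sub>R e) - a) \<bullet> e"
  have cg: "continuous_on {0..t} ?g"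
    by (intro continuous_intros continuous_on_compose2[OF F(2)]) auto
  have "(LINT s|lborel. indicator {0..t} s *\<^sub>R ?g s) = (F (x + t *\<^sub>R e) - t * (a \<bullet> e)) - (F (x + 0 *\<^sub>R e) - 0 * (a \<bullet> e))"
  proof (rule integral_FTC_Icc)
    show "((\<lambda>s. F (x + s *\<^sub>R e) - s * (a \<bullet> e)) has_vector_derivative ?g s) (at s within {0..t})" for s
      unfolding has_real_derivative_iff_has_vector_derivative[symmetric] inner_diff_left
      by (auto intro!: derivative_eq_intros GDERIV_has_derivative_line F)
  qed (use t cg in auto)
  then have eq: "F (x + t *\<^sub>R e) - F x - t * (a \<bullet> e) = (LINT s|lborel. indicator {0..t} s *\<^sub>R ?g s)" by simp
  have "ennreal (norm (LINT s|lborel. indicator {0..t} s *\<^sub>R ?g s)) \<le>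
      (\<integral>\<^sup>+s. ennreal (norm (indicator {0..t} s *\<^sub>R ?g s)) \<partial>lborel)"
    by (rule integral_norm_bound_ennreal) (rule borel_integrable_compact[OF _ cg], simp)
  also have "\<dots> \<le> (\<integral>\<^sup>+s. indicator {0..t} s * ennreal (norm (F' (x + s *\<^sub>R e) - a)) \<partial>lborel)"
  proof (rule nn_integral_mono)
    fix s
    have "\<bar>?g s\<bar> \<le> norm (F' (x + s *\<^sub>R e) - a)"
      using Cauchy_Schwarz_ineq2[of "F' (x + s *\<^sub>R e) - a" e] mult_left_le[OF e, of "norm (F' (x + s *\<^sub>R e) - a)"]
      by simp
    then show "ennreal (norm (indicator {0..t} s *\<^sub>R ?g s)) \<le> indicator {0..t} s * ennreal (norm (F' (x + s *\<^sub>R e) - a))"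
      by (auto simp: indicator_def intro!: ennreal_leI)
  qed
  finally show ?thesis by (simp add: eq)
qed

lemma nn_integral_mollify_compact_small:
  fixes h :: "real^3 \<Rightarrow> 'b::{banach, second_countable_topology}"
  assumes h: "locally_integrable h" and K: "compact K" and e: "e > 0"
  shows "eventually (\<lambda>n. (\<integral>\<^sup>+x. indicator K x * ennreal (norm (mollify (1 / real (Suc n)) h x - h x)) \<partial>lborel) \<le> ennreal e) sequentially"
  using order_tendstoD(2)[OF mollify_tendsto_L1_compact[OF h K] e]
proof eventually_elim
  case (elim n)
  have [measurable]: "mollify (1 / real (Suc n)) h \<in> borel_measurable borel"
    by (intro borel_measurable_continuous_onI continuous_on_mollify h) simp
  have Ks[measurable]: "K \<in> sets borel" using K by (simp add: borel_compact)
  have "integrable lborel (\<lambda>x. indicator K x *\<^sub>R (mollify (1 / real (Suc n)) h x - h x))"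
    unfolding scaleR_diff_right
  proof (rule Bochner_Integration.integrable_diff)
    show "integrable lborel (\<lambda>x. indicator K x *\<^sub>R mollify (1 / real (Suc n)) h x)"
      by (intro borel_integrable_compact K continuous_on_subset[OF continuous_on_mollify] h) auto
    show "integrable lborel (\<lambda>x. indicator K x *\<^sub>R h x)"
      using h K by (simp add: locally_integrable_def set_integrable_def)
  qed
  from nn_integral_eq_integral[OF integrable_norm[OF this]]
  have "(\<integral>\<^sup>+x. ennreal (norm (indicator K x *\<^sub>R (mollify (1 / real (Suc n)) h x - h x))) \<partial>lborel) \<le> ennreal e"
    using elim by (simp add: ennreal_leI)
  moreover have "ennreal (norm (indicator K x *\<^sub>R (mollify (1 / real (Suc n)) h x - h x))) =
    indicator K x * ennreal (norm (mollify (1 / real (Suc n)) h x - h x))" for x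
    by (auto simp: indicator_def)
  ultimately show ?case by simp
qed

text \<open>
  At a zero of the nonnegative function f every difference quotient (f(x + t e) - f(x)) / t with t > 0 is
  nonnegative, and difference quotients converge in the mean to g.e.  To make this precise, let Z be
  the set of zeros with g.e < 0.  For the mollifications F, G of f, g the difference
  F(x + t e) - F(x) - t (g(x).e) is an integral of G - g along a segment; over Z its integral
  is small compared with t, because translations and mollification are continuous in the mean.  As
  F >= 0, and F is close to f = 0 on Z, the integral of -(g.e) over Z is arbitrarily small.
\<close>

lemma weak_gradient_direction_nonneg:
  assumes w: "has_weak_gradient f g" and f: "\<And>x. 0 \<le> f x" and e: "norm e \<le> 1"
  shows "AE x in lborel. f x = 0 \<longrightarrow> norm x \<le> real N \<longrightarrow> 0 \<le> g x \<bullet> e"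
proof -
  note li = has_weak_gradient_locally_integrable[OF w]
  have [measurable]: "f \<in> borel_measurable borel" "g \<in> borel_measurable borel"
    using li by (auto intro: locally_integrable_measurable)
  define Z where "Z = {x \<in> cball 0 (real N). f x = 0 \<and> g x \<bullet> e < 0}"
  have [measurable]: "Z \<in> sets borel"
  proof -
    have "Z = cball 0 (real N) \<inter> {x \<in> space borel. f x = 0 \<and> g x \<bullet> e < 0}" by (auto simp: Z_def)
    moreover have "{x \<in> space borel. f x = 0 \<and> g x \<bullet> e < 0} \<in> sets borel" by measurable
    ultimately show ?thesis by (simp add: sets.Int)
  qed
  let ?N = "(\<integral>\<^sup>+x. indicator Z x * ennreal (- (g x \<bullet> e)) \<partial>lborel)"
  define K where "K = cball (0::real^3) (real N + 1)"
  have [measurable]: "K \<in> sets borel" unfolding K_def by simp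
  define gK where "gK x = indicator K x *\<^sub>R g x" for x
  have igK: "integrable lborel gK"
    using li(2)[unfolded locally_integrable_def, rule_format, of K]
    by (simp add: gK_def[abs_def] K_def set_integrable_def)
  have [measurable]: "gK \<in> borel_measurable borel" using igK by auto
  have small: "?N \<le> ennreal (4 * \<eta>)" if \<eta>: "\<eta> > 0" for \<eta>
  proof -
    obtain d where d: "d > 0" "\<And>s. norm s < d \<Longrightarrow> L1_shift gK s < \<eta>"
      using L1_shift_small[OF igK \<eta>] by auto
    \<comment> \<open>The step t is fixed first and the mollification parameter afterwards, with an error below
      t \<eta> for f, since the error in f is divided by t in the end.\<close>
    define t where "t = min 1 (d / 2)"
    have t: "0 < t" "t \<le> 1" "t < d" using d(1) by (auto simp: t_def)
    have "eventually (\<lambda>n. (\<integral>\<^sup>+x. indicator K x * ennreal (norm (mollify (1 / real (Suc n)) g x - g x)) \<partial>lborel) \<le> ennreal \<eta>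
       \<and> (\<integral>\<^sup>+x. indicator K x * ennreal (norm (mollify (1 / real (Suc n)) f x - f x)) \<partial>lborel) \<le> ennreal (t * \<eta>)) sequentially"
      using t \<eta> by (intro eventually_conj nn_integral_mollify_compact_small li) (auto simp: K_def)
    then obtain n where n: "(\<integral>\<^sup>+x. indicator K x * ennreal (norm (mollify (1 / real (Suc n)) g x - g x)) \<partial>lborel) \<le> ennreal \<eta>"
       "(\<integral>\<^sup>+x. indicator K x * ennreal (norm (mollify (1 / real (Suc n)) f x - f x)) \<partial>lborel) \<le> ennreal (t * \<eta>)"
      unfolding eventually_sequentially by blast
    define r where "r = 1 / real (Suc n)"
    have r: "r > 0" by (simp add: r_def)
    define F where "F = mollify r f"
    define G where "G = mollify r g"
    have FG: "GDERIV F x :> G x" for x unfolding F_def G_def by (rule GDERIV_mollify[OF r w])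
    have cG: "continuous_on UNIV G" unfolding G_def by (rule continuous_on_mollify[OF r li(2)])
    have [measurable]: "F \<in> borel_measurable borel" "G \<in> borel_measurable borel"
      using GDERIV_continuous[OF FG, of UNIV] cG by (auto intro: borel_measurable_continuous_onI)
    have F0: "0 \<le> F x" for x unfolding F_def using f r by (intro mollify_nonneg)
    have ZK: "x + s *\<^sub>R e \<in> K" if "x \<in> Z" "s \<in> {0..t}" for x s
    proof -
      have "norm (s *\<^sub>R e) \<le> 1" using that(2) t e by (auto intro!: mult_le_one)
      then show ?thesis using that(1) norm_triangle_ineq[of x "s *\<^sub>R e"] by (simp add: Z_def K_def)
    qed
    have pt: "indicator Z x * ennreal (t * (- (g x \<bullet> e))) \<le> indicator Z x * ennreal (norm (F x - f x))
        + indicator Z x * (\<integral>\<^sup>+s. indicator {0..t} s * ennreal (norm (G (x + s *\<^sub>R e) - g x)) \<partial>lborel)" for x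
    proof (cases "x \<in> Z")
      case True
      have "t * (- (g x \<bullet> e)) \<le> norm (F x - f x) + \<bar>F (x + t *\<^sub>R e) - F x - t * (g x \<bullet> e)\<bar>"
        using F0[of "x + t *\<^sub>R e"] True by (simp add: Z_def)
      then have "ennreal (t * (- (g x \<bullet> e))) \<le> ennreal (norm (F x - f x)) + ennreal \<bar>F (x + t *\<^sub>R e) - F x - t * (g x \<bullet> e)\<bar>"
        by (simp add: ennreal_plus[symmetric] ennreal_leI del: ennreal_plus)
      also have "\<dots> \<le> ennreal (norm (F x - f x)) + (\<integral>\<^sup>+s. indicator {0..t} s * ennreal (norm (G (x + s *\<^sub>R e) - g x)) \<partial>lborel)"
        by (intro add_left_mono difference_quotient_bound FG cG t e)
      finally show ?thesis using True by simp
    qed simp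
    have slice: "(\<integral>\<^sup>+x. indicator Z x * ennreal (norm (G (x + s *\<^sub>R e) - g x)) \<partial>lborel) \<le> ennreal (2 * \<eta>)"
      if s: "s \<in> {0..t}" for s
    proof -
      have "indicator Z x * ennreal (norm (G (x + s *\<^sub>R e) - g x)) \<le>
        indicator K (x + s *\<^sub>R e) * ennreal (norm (G (x + s *\<^sub>R e) - g (x + s *\<^sub>R e))) + ennreal (norm (gK (x + s *\<^sub>R e) - gK x))" for x
      proof (cases "x \<in> Z")
        case True
        have "x \<in> K" "x + s *\<^sub>R e \<in> K" using ZK[OF True s] ZK[OF True, of 0] t by auto
        then have "norm (G (x + s *\<^sub>R e) - g x) \<le> norm (G (x + s *\<^sub>R e) - g (x + s *\<^sub>R e)) + norm (gK (x + s *\<^sub>R e) - gK x)"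
          using norm_triangle_ineq[of "G (x + s *\<^sub>R e) - g (x + s *\<^sub>R e)" "g (x + s *\<^sub>R e) - g x"] by (simp add: gK_def)
        with True \<open>x + s *\<^sub>R e \<in> K\<close> show ?thesis
          by (simp add: ennreal_plus[symmetric] ennreal_leI del: ennreal_plus)
      qed simp
      then have "(\<integral>\<^sup>+x. indicator Z x * ennreal (norm (G (x + s *\<^sub>R e) - g x)) \<partial>lborel) \<le>
        (\<integral>\<^sup>+x. indicator K (x + s *\<^sub>R e) * ennreal (norm (G (x + s *\<^sub>R e) - g (x + s *\<^sub>R e))) + ennreal (norm (gK (x + s *\<^sub>R e) - gK x)) \<partial>lborel)"
        by (intro nn_integral_mono)
      also have "\<dots> = (\<integral>\<^sup>+x. indicator K (x + s *\<^sub>R e) * ennreal (norm (G (x + s *\<^sub>R e) - g (x + s *\<^sub>R e))) \<partial>lborel)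
         + (\<integral>\<^sup>+x. ennreal (norm (gK (x + s *\<^sub>R e) - gK x)) \<partial>lborel)"
        by (rule nn_integral_add) measurable
      also have "(\<integral>\<^sup>+x. indicator K (x + s *\<^sub>R e) * ennreal (norm (G (x + s *\<^sub>R e) - g (x + s *\<^sub>R e))) \<partial>lborel)
         = (\<integral>\<^sup>+x. indicator K x * ennreal (norm (G x - g x)) \<partial>lborel)"
        by (subst (2) lborel_translate[of "s *\<^sub>R e", symmetric], subst nn_integral_distr) auto
      also have "(\<integral>\<^sup>+x. ennreal (norm (gK (x + s *\<^sub>R e) - gK x)) \<partial>lborel) = ennreal (L1_shift gK (s *\<^sub>R e))"
        unfolding L1_shift_def by (rule nn_integral_eq_integral[OF integrable_shift_diff[OF igK]]) simp
      also have "(\<integral>\<^sup>+x. indicator K x * ennreal (norm (G x - g x)) \<partial>lborel) + ennreal (L1_shift gK (s *\<^sub>R e)) \<le> ennreal \<eta> + ennreal \<eta>"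
      proof (intro add_mono ennreal_leI)
        show "(\<integral>\<^sup>+x. indicator K x * ennreal (norm (G x - g x)) \<partial>lborel) \<le> ennreal \<eta>"
          using n(1) by (simp add: G_def r_def)
        have "norm (s *\<^sub>R e) \<le> s" using s e by (auto intro: mult_left_le)
        then show "L1_shift gK (s *\<^sub>R e) \<le> \<eta>" using d(2)[of "s *\<^sub>R e"] s t by auto
      qed
      also have "\<dots> = ennreal (2 * \<eta>)" using \<eta> by (simp add: ennreal_plus[symmetric] del: ennreal_plus)
      finally show ?thesis .
    qed
    have "(\<integral>\<^sup>+x. indicator Z x * ennreal (t * (- (g x \<bullet> e))) \<partial>lborel) \<le>
      (\<integral>\<^sup>+x. indicator Z x * ennreal (norm (F x - f x))
        + indicator Z x * (\<integral>\<^sup>+s. indicator {0..t} s * ennreal (norm (G (x + s *\<^sub>R e) - g x)) \<partial>lborel) \<partial>lborel)"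
      by (intro nn_integral_mono pt)
    also have "\<dots> = (\<integral>\<^sup>+x. indicator Z x * ennreal (norm (F x - f x)) \<partial>lborel)
        + (\<integral>\<^sup>+x. \<integral>\<^sup>+s. indicator {0..t} s * (indicator Z x * ennreal (norm (G (x + s *\<^sub>R e) - g x))) \<partial>lborel \<partial>lborel)"
      by (subst nn_integral_add, measurable) (simp add: nn_integral_cmult[symmetric] mult.left_commute)
    also have "(\<integral>\<^sup>+x. \<integral>\<^sup>+s. indicator {0..t} s * (indicator Z x * ennreal (norm (G (x + s *\<^sub>R e) - g x))) \<partial>lborel \<partial>lborel)
      = (\<integral>\<^sup>+s. \<integral>\<^sup>+x. indicator {0..t} s * (indicator Z x * ennreal (norm (G (x + s *\<^sub>R e) - g x))) \<partial>lborel \<partial>lborel)"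
      by (rule lborel_pair.Fubini') measurable
    also have "\<dots> \<le> (\<integral>\<^sup>+s. ennreal (2 * \<eta>) * indicator {0..t} s \<partial>lborel)"
    proof (rule nn_integral_mono)
      fix s
      show "(\<integral>\<^sup>+x. indicator {0..t} s * (indicator Z x * ennreal (norm (G (x + s *\<^sub>R e) - g x))) \<partial>lborel) \<le> ennreal (2 * \<eta>) * indicator {0..t} s"
        using slice[of s] by (cases "s \<in> {0..t}") auto
    qed
    also have "\<dots> = ennreal (2 * \<eta> * t)"
      using t \<eta> by (subst nn_integral_cmult_indicator) (auto simp: ennreal_mult[symmetric])
    also have "(\<integral>\<^sup>+x. indicator Z x * ennreal (norm (F x - f x)) \<partial>lborel) \<le> ennreal (t * \<eta>)"
    proof (rule order.trans[OF nn_integral_mono n(2)])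
      fix x show "indicator Z x * ennreal (norm (F x - f x)) \<le> indicator K x * ennreal (norm (mollify (1 / real (Suc n)) f x - f x))"
        using ZK[of x 0] t by (cases "x \<in> Z") (auto simp: F_def r_def)
    qed
    finally have "(\<integral>\<^sup>+x. indicator Z x * ennreal (t * (- (g x \<bullet> e))) \<partial>lborel) \<le> ennreal (t * \<eta>) + ennreal (2 * \<eta> * t)"
      by (simp add: add_right_mono)
    also have "\<dots> \<le> ennreal t * ennreal (4 * \<eta>)"
      using t \<eta> by (simp add: ennreal_plus[symmetric] ennreal_mult[symmetric] del: ennreal_plus)
    also have "(\<integral>\<^sup>+x. indicator Z x * ennreal (t * (- (g x \<bullet> e))) \<partial>lborel) =
        ennreal t * ?N"
    proof -
      have "indicator Z x * ennreal (t * (- (g x \<bullet> e))) = ennreal t * (indicator Z x * ennreal (- (g x \<bullet> e)))" for x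
        using t by (auto simp: indicator_def ennreal_mult'[symmetric])
      then show ?thesis by (simp add: nn_integral_cmult)
    qed
    finally show ?thesis using t by (simp add: ennreal_mult_le_mult_iff)
  qed
  have "?N = 0"
  proof -
    have "?N \<le> 0"
    proof (rule ennreal_le_epsilon)
      fix \<eta> :: real assume "\<eta> > 0"
      then show "?N \<le> 0 + ennreal \<eta>"
        using small[of "\<eta> / 4"] by simp
    qed
    then show ?thesis by simp
  qed
  then have "AE x in lborel. indicator Z x * ennreal (- (g x \<bullet> e)) = 0"
    by (subst (asm) nn_integral_0_iff_AE) auto
  then show ?thesis
  proof eventually_elim
    case (elim x)
    show ?case
    proof (intro impI, rule ccontr)
      assume "f x = 0" "norm x \<le> real N" "\<not> 0 \<le> g x \<bullet> e"
      then have "x \<in> Z" by (simp add: Z_def)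
      with elim \<open>\<not> 0 \<le> g x \<bullet> e\<close> show False by (simp add: ennreal_eq_0_iff)
    qed
  qed
qed

text \<open>
  Both e and -e are admitted as directions, so every component of g vanishes.
\<close>

lemma weak_gradient_eq_0_on_zero_set:
  assumes w: "has_weak_gradient f g" and f: "\<And>x. 0 \<le> f x"
  shows "AE x in lborel. f x = 0 \<longrightarrow> g x = 0"
proof -
  have "AE x in lborel. \<forall>N. \<forall>i. (f x = 0 \<longrightarrow> norm x \<le> real N \<longrightarrow> 0 \<le> g x \<bullet> axis i 1) \<and>
      (f x = 0 \<longrightarrow> norm x \<le> real N \<longrightarrow> 0 \<le> g x \<bullet> (- axis i 1))"
    unfolding AE_all_countable
  proof (intro allI)
    fix N :: nat and i :: 3
    show "AE x in lborel. (f x = 0 \<longrightarrow> norm x \<le> real N \<longrightarrow> 0 \<le> g x \<bullet> axis i 1) \<and>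
      (f x = 0 \<longrightarrow> norm x \<le> real N \<longrightarrow> 0 \<le> g x \<bullet> (- axis i 1))"
      by (intro AE_conjI weak_gradient_direction_nonneg[OF w f]) simp_all
  qed
  then show ?thesis
  proof eventually_elim
    case (elim x)
    obtain N :: nat where "norm x \<le> real N" using real_arch_simple by blast
    with elim have "f x = 0 \<Longrightarrow> g x $ i = 0" for i
      by (metis (no_types) cart_eq_inner_axis inner_minus_right neg_0_le_iff_le order_antisym)
    then show ?case by (simp add: vec_eq_iff)
  qed
qed

section \<open>Logarithmic Sobolev inequality for weakly differentiable densities\<close>

text \<open>
  The function |k|^2 / h is jointly convex in (h, k), so mollification can only decrease it; here this is
  Cauchy-Schwarz with the splitting |k| = sqrt h * sqrt(|k|^2 / h), which is valid because k
  vanishes where h does.  Division by zero makes |k|^2 / h vanish there, in accordance with this.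
\<close>

lemma mollify_Fisher_le:
  fixes h :: "real^3 \<Rightarrow> real" and k :: "real^3 \<Rightarrow> real^3"
  assumes h: "locally_integrable h" "\<And>x. 0 \<le> h x" and k: "locally_integrable k"
    and zero: "AE x in lborel. h x = 0 \<longrightarrow> k x = 0" and r: "r > 0" and \<epsilon>: "\<epsilon> > 0"
  shows "ennreal ((norm (mollify r k x))\<^sup>2 / (mollify r h x + \<epsilon>))
     \<le> (\<integral>\<^sup>+y. ennreal (mollifier r (y - x)) * ennreal ((norm (k y))\<^sup>2 / h y) \<partial>lborel)"
proof -
  let ?S = "\<lambda>y. sqrt (mollifier r (y - x) * h y)"
  let ?J = "\<lambda>y. sqrt (mollifier r (y - x) * ((norm (k y))\<^sup>2 / h y))"
  have [measurable]: "h \<in> borel_measurable borel" "k \<in> borel_measurable borel"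
    using h k by (auto intro: locally_integrable_measurable)
  define B where "B = (\<integral>\<^sup>+y. ennreal (mollifier r (y - x)) * ennreal ((norm (k y))\<^sup>2 / h y) \<partial>lborel)"
  define a where "a = mollify r h x"
  have a0: "a \<ge> 0" unfolding a_def by (intro mollify_nonneg r h)
  have A: "(\<integral>\<^sup>+y. ennreal (mollifier r (y - x) * h y) \<partial>lborel) = ennreal a"
    unfolding a_def mollify_def using integrable_mollify[OF r h(1), of x] mollifier_nonneg[OF r] h(2)
    by (subst nn_integral_eq_integral) auto
  have "ennreal (norm (mollify r k x)) \<le> (\<integral>\<^sup>+y. ennreal (norm (mollifier r (y - x) *\<^sub>R k y)) \<partial>lborel)"
    unfolding mollify_def by (rule integral_norm_bound_ennreal[OF integrable_mollify[OF r k]])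
  also have "\<dots> = (\<integral>\<^sup>+y. ennreal (?S y) * ennreal (?J y) \<partial>lborel)"
  proof (rule nn_integral_cong_AE)
    show "AE y in lborel. ennreal (norm (mollifier r (y - x) *\<^sub>R k y)) = ennreal (?S y) * ennreal (?J y)"
      using zero
    proof eventually_elim
      case (elim y)
      show ?case
      proof (cases "h y = 0")
        case False
        have "sqrt (mollifier r (y - x) * h y) * sqrt (mollifier r (y - x) * ((norm (k y))\<^sup>2 / h y))
          = sqrt ((mollifier r (y - x) * norm (k y))\<^sup>2)"
          unfolding real_sqrt_mult[symmetric] using False by (simp add: power_mult_distrib power2_eq_square mult_ac)
        also have "\<dots> = norm (mollifier r (y - x) *\<^sub>R k y)"
          using mollifier_nonneg[OF r, of "y - x"] by (simp add: abs_mult)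
        finally show ?thesis using h(2)[of y] mollifier_nonneg[OF r, of "y - x"] by (simp add: ennreal_mult'[symmetric])
      qed (use elim in simp)
    qed
  qed
  finally have le1: "ennreal (norm (mollify r k x)) \<le> (\<integral>\<^sup>+y. ennreal (?S y) * ennreal (?J y) \<partial>lborel)" .
  have "ennreal ((norm (mollify r k x))\<^sup>2) = (ennreal (norm (mollify r k x)))\<^sup>2" by (simp add: ennreal_power)
  also have "\<dots> \<le> (\<integral>\<^sup>+y. ennreal (?S y) * ennreal (?J y) \<partial>lborel)\<^sup>2"
    by (intro power_mono le1) auto
  also have "\<dots> \<le> (\<integral>\<^sup>+y. (ennreal (?S y))\<^sup>2 \<partial>lborel) *
      (\<integral>\<^sup>+y. (ennreal (?J y))\<^sup>2 \<partial>lborel)"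
    by (rule Cauchy_Schwarz_nn_integral) measurable
  also have "\<dots> = ennreal a * B"
    unfolding A[symmetric] B_def using h(2) mollifier_nonneg[OF r]
    by (simp add: ennreal_power ennreal_mult[symmetric])
  finally have le2: "ennreal ((norm (mollify r k x))\<^sup>2) \<le> ennreal a * B" .
  show ?thesis unfolding B_def[symmetric] a_def[symmetric]
  proof (cases B)
    case (real b)
    have "(norm (mollify r k x))\<^sup>2 \<le> a * b"
      using le2 real a0 by (simp add: ennreal_mult[symmetric])
    also have "\<dots> \<le> (a + \<epsilon>) * b" using real \<epsilon> by (simp add: mult_right_mono)
    finally have "(norm (mollify r k x))\<^sup>2 / (a + \<epsilon>) \<le> b"
      using a0 \<epsilon> by (simp add: divide_le_eq mult.commute)
    then show "ennreal ((norm (mollify r k x))\<^sup>2 / (a + \<epsilon>)) \<le> B" using real by (simp add: ennreal_leI)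
  qed simp
qed

text \<open>
  Continuity of s ln s on the closed half line, with the value 0 at s = 0; near zero
  |s ln s| <= 2 sqrt s.
\<close>

lemma tendsto_mult_ln:
  fixes s :: "nat \<Rightarrow> real"
  assumes s: "s \<longlonglongrightarrow> x" and nonneg: "\<And>n. s n \<ge> 0" and x: "x \<ge> 0"
  shows "(\<lambda>n. s n * ln (s n)) \<longlonglongrightarrow> x * ln x"
proof (cases "x = 0")
  case False
  then show ?thesis using x by (intro tendsto_intros s) auto
next
  case True
  have "\<bar>s n * ln (s n)\<bar> \<le> 2 * sqrt (s n) + (s n)\<^sup>2" if pos: "s n > 0" for n
  proof (cases "s n \<le> 1")
    case t: True
    have "ln (1 / sqrt (s n)) \<le> 1 / sqrt (s n) - 1" using pos by (intro ln_le_minus_one) simp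
    then have "- ln (s n) \<le> 2 / sqrt (s n)" using pos by (simp add: ln_div ln_sqrt)
    then have "s n * (- ln (s n)) \<le> s n * (2 / sqrt (s n))" using pos by (intro mult_left_mono) auto
    also have "\<dots> = 2 * (s n / sqrt (s n))" by simp
    also have "s n / sqrt (s n) = sqrt (s n)" using pos by (simp add: real_div_sqrt)
    finally have "s n * (- ln (s n)) \<le> 2 * sqrt (s n)" .
    moreover have "s n * ln (s n) \<le> 0" using t pos by (intro mult_nonneg_nonpos) auto
    ultimately show ?thesis by (simp add: abs_of_nonpos add_increasing2)
  next
    case f: False
    have "ln (s n) \<le> s n" using pos ln_le_minus_one[of "s n"] by linarith
    then have "s n * ln (s n) \<le> (s n)\<^sup>2" using pos by (simp add: power2_eq_square)
    moreover have "s n * ln (s n) \<ge> 0" using f by (intro mult_nonneg_nonneg) auto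
    ultimately show ?thesis using pos by (simp add: add_increasing)
  qed
  then have "norm (s n * ln (s n)) \<le> 2 * sqrt (s n) + (s n)\<^sup>2" for n
    using nonneg[of n] by (cases "s n = 0") auto
  then have "\<forall>\<^sub>F n in sequentially. norm (s n * ln (s n)) \<le> 2 * sqrt (s n) + (s n)\<^sup>2" by simp
  moreover have "(\<lambda>n. 2 * sqrt (s n) + (s n)\<^sup>2) \<longlonglongrightarrow> 2 * sqrt x + x\<^sup>2"
    by (intro tendsto_intros s)
  then have "(\<lambda>n. 2 * sqrt (s n) + (s n)\<^sup>2) \<longlonglongrightarrow> 0" using True by simp
  ultimately have "(\<lambda>n. s n * ln (s n)) \<longlonglongrightarrow> 0" by (rule Lim_null_comparison)
  then show ?thesis using True by simp
qed

lemma mult_ln_ge: "(s::real) \<ge> 0 \<Longrightarrow> s * ln s + 1 \<ge> 0"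
proof (cases "s = 0")
  case False
  assume "s \<ge> 0"
  then have "ln (1 / s) \<le> 1 / s - 1" using False by (intro ln_le_minus_one) simp
  then have "s * (- ln s) \<le> s * (1 / s - 1)" using False \<open>s \<ge> 0\<close> by (intro mult_left_mono) (auto simp: ln_div)
  then show ?thesis using False \<open>s \<ge> 0\<close> by (simp add: algebra_simps)
qed simp

text \<open>
  After an exchange of integrals the kernel averages exp(-V) over a small ball around y, and the
  uniform continuity of V near Q bounds this average by exp(omega) exp(-V(y)).
\<close>

lemma eventually_mollified_Fisher_le:
  fixes h V :: "real^3 \<Rightarrow> real" and k :: "real^3 \<Rightarrow> real^3"
  assumes V: "continuous_on UNIV V" and Q: "compact Q"
    and h: "locally_integrable h" "\<And>x. 0 \<le> h x" and k: "locally_integrable k"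
    and zero: "AE x in lborel. h x = 0 \<longrightarrow> k x = 0" and \<omega>: "\<omega> > 0"
  shows "eventually (\<lambda>n. (\<integral>\<^sup>+x. indicator Q x * ennreal ((norm (mollify (1 / real (Suc n)) k x))\<^sup>2
        / (mollify (1 / real (Suc n)) h x + 1 / real (Suc n)) * exp (- V x)) \<partial>lborel)
     \<le> ennreal (exp \<omega>) * (\<integral>\<^sup>+x. ennreal ((norm (k x))\<^sup>2 / h x * exp (- V x)) \<partial>lborel)) sequentially"
proof -
  have [measurable]: "h \<in> borel_measurable borel" "k \<in> borel_measurable borel" "V \<in> borel_measurable borel"
    using h k V by (auto intro: locally_integrable_measurable borel_measurable_continuous_onI)
  have [measurable]: "Q \<in> sets borel" using Q by (simp add: borel_compact)
  obtain B where B: "\<And>x. x \<in> Q \<Longrightarrow> norm x \<le> B" using compact_imp_bounded[OF Q] by (auto simp: bounded_iff)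
  have "uniformly_continuous_on (cball 0 (B + 1)) V"
    by (intro compact_uniformly_continuous continuous_on_subset[OF V]) auto
  then obtain d where d: "d > 0" "\<And>x y. x \<in> cball 0 (B + 1) \<Longrightarrow> y \<in> cball 0 (B + 1) \<Longrightarrow> dist x y < d \<Longrightarrow> dist (V x) (V y) < \<omega>"
    unfolding uniformly_continuous_on_def using \<omega> by metis
  obtain N where N: "inverse (real (Suc N)) < d" using reals_Archimedean[OF d(1)] by auto
  show ?thesis unfolding eventually_sequentially
  proof (intro exI allI impI)
    fix n assume n: "n \<ge> N"
    define r where "r = 1 / real (Suc n)"
    have r: "r > 0" "r \<le> 1" "r < d"
      using N n by (auto simp: r_def inverse_eq_divide elim!: le_less_trans[rotated] intro!: divide_left_mono)
    let ?J = "\<lambda>y. (norm (k y))\<^sup>2 / h y"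
    have "(\<integral>\<^sup>+x. indicator Q x * ennreal ((norm (mollify r k x))\<^sup>2 / (mollify r h x + r) * exp (- V x)) \<partial>lborel)
      \<le> (\<integral>\<^sup>+x. \<integral>\<^sup>+y. indicator Q x * ennreal (exp (- V x)) * (ennreal (mollifier r (y - x)) * ennreal (?J y)) \<partial>lborel \<partial>lborel)"
    proof (rule nn_integral_mono)
      fix x
      have "ennreal ((norm (mollify r k x))\<^sup>2 / (mollify r h x + r) * exp (- V x)) =
        ennreal (exp (- V x)) * ennreal ((norm (mollify r k x))\<^sup>2 / (mollify r h x + r))"
        by (subst mult.commute, rule ennreal_mult') simp
      also have "\<dots> \<le> ennreal (exp (- V x)) * (\<integral>\<^sup>+y. ennreal (mollifier r (y - x)) * ennreal (?J y) \<partial>lborel)"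
        by (intro mult_left_mono mollify_Fisher_le h k zero r) simp
      finally have "indicator Q x * ennreal ((norm (mollify r k x))\<^sup>2 / (mollify r h x + r) * exp (- V x))
        \<le> indicator Q x * (ennreal (exp (- V x)) * (\<integral>\<^sup>+y. ennreal (mollifier r (y - x)) * ennreal (?J y) \<partial>lborel))"
        by (rule mult_left_mono) simp
      also have "\<dots> = (\<integral>\<^sup>+y. indicator Q x * ennreal (exp (- V x)) * (ennreal (mollifier r (y - x)) * ennreal (?J y)) \<partial>lborel)"
        by (subst nn_integral_cmult) (auto simp: mult.assoc)
      finally show "indicator Q x * ennreal ((norm (mollify r k x))\<^sup>2 / (mollify r h x + r) * exp (- V x))
        \<le> (\<integral>\<^sup>+y. indicator Q x * ennreal (exp (- V x)) * (ennreal (mollifier r (y - x)) * ennreal (?J y)) \<partial>lborel)" .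
    qed
    also have "\<dots> = (\<integral>\<^sup>+y. \<integral>\<^sup>+x. indicator Q x * ennreal (exp (- V x)) * (ennreal (mollifier r (y - x)) * ennreal (?J y)) \<partial>lborel \<partial>lborel)"
      by (rule lborel_pair.Fubini') measurable
    also have "\<dots> \<le> (\<integral>\<^sup>+y. ennreal (exp \<omega>) * ennreal (?J y * exp (- V y)) \<partial>lborel)"
    proof (rule nn_integral_mono)
      fix y
      have "(\<integral>\<^sup>+x. indicator Q x * ennreal (exp (- V x)) * (ennreal (mollifier r (y - x)) * ennreal (?J y)) \<partial>lborel)
        \<le> (\<integral>\<^sup>+x. ennreal (exp \<omega> * exp (- V y)) * ennreal (?J y) * ennreal (mollifier r (y - x)) \<partial>lborel)"
      proof (rule nn_integral_mono)
        fix x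
        show "indicator Q x * ennreal (exp (- V x)) * (ennreal (mollifier r (y - x)) * ennreal (?J y)) \<le>
          ennreal (exp \<omega> * exp (- V y)) * ennreal (?J y) * ennreal (mollifier r (y - x))"
        proof (cases "x \<in> Q \<and> norm (y - x) < r")
          case True
          have "norm y \<le> norm x + norm (y - x)" using norm_triangle_ineq[of x "y - x"] by simp
          then have "norm y \<le> B + 1" "norm x \<le> B + 1" using True B[of x] r by auto
          then have "dist (V x) (V y) < \<omega>" using True r by (intro d(2)) (auto simp: dist_norm norm_minus_commute)
          then have "exp (- V x) \<le> exp \<omega> * exp (- V y)" unfolding exp_add[symmetric] by (simp add: dist_real_def)
          then have "ennreal (exp (- V x)) \<le> ennreal (exp \<omega> * exp (- V y))" by (rule ennreal_leI)
          from mult_right_mono[OF this, of "ennreal (mollifier r (y - x)) * ennreal (?J y)"] True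
          show ?thesis by (simp add: mult_ac)
        next
          case False
          then have "x \<notin> Q \<or> mollifier r (y - x) = 0" using mollifier_eq_0[OF r(1), of "y - x"] by force
          then show ?thesis by auto
        qed
      qed
      also have "\<dots> = ennreal (exp \<omega> * exp (- V y)) * ennreal (?J y) * (\<integral>\<^sup>+x. ennreal (mollifier r (y - x)) \<partial>lborel)"
        by (rule nn_integral_cmult) measurable
      also have "(\<integral>\<^sup>+x. ennreal (mollifier r (y - x)) \<partial>lborel) = 1"
        using nn_integral_reflect[of "\<lambda>x. ennreal (mollifier r x)" y] nn_integral_mollifier[OF r(1)] by simp
      also have "ennreal (exp \<omega> * exp (- V y)) * ennreal (?J y) * 1 = ennreal (exp \<omega>) * ennreal (?J y * exp (- V y))"
        using h(2)[of y] by (simp add: ennreal_mult[symmetric] mult_ac)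
      finally show "(\<integral>\<^sup>+x. indicator Q x * ennreal (exp (- V x)) * (ennreal (mollifier r (y - x)) * ennreal (?J y)) \<partial>lborel)
        \<le> ennreal (exp \<omega>) * ennreal (?J y * exp (- V y))" .
    qed
    also have "\<dots> = ennreal (exp \<omega>) * (\<integral>\<^sup>+x. ennreal (?J x * exp (- V x)) \<partial>lborel)"
      by (rule nn_integral_cmult) measurable
    finally show "(\<integral>\<^sup>+x. indicator Q x * ennreal ((norm (mollify (1 / real (Suc n)) k x))\<^sup>2
        / (mollify (1 / real (Suc n)) h x + 1 / real (Suc n)) * exp (- V x)) \<partial>lborel)
     \<le> ennreal (exp \<omega>) * (\<integral>\<^sup>+x. ennreal ((norm (k x))\<^sup>2 / h x * exp (- V x)) \<partial>lborel)"
      by (simp only: r_def)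
  qed
qed

text \<open>
  The inequality for positive C^1 functions is applied to H_n, the mollification of h at scale
  1/(n+1) plus the constant 1/(n+1), which makes it positive.  Masses converge because
  H_n tends to h in the mean on Q, the Fisher information is under control by convexity, and the
  entropy passes to the limit along a subsequence converging almost everywhere by Fatou's lemma, as
  s ln s + 1 >= 0.
\<close>

lemma log_Sobolev_cube_weak:
  fixes V h :: "real^3 \<Rightarrow> real" and V' k :: "real^3 \<Rightarrow> real^3"
  assumes R: "R > 0" and c: "c > 0"
    and V: "\<And>v. GDERIV V v :> V' v" "continuous_on UNIV V'"
    and convex: "\<And>v w. V v + V' v \<bullet> (w - v) + c / 2 * (norm (w - v))\<^sup>2 \<le> V w"
    and w: "has_weak_gradient h k" and h: "\<And>v. 0 \<le> h v"
  defines "Q \<equiv> cbox (vec3 (-R) (-R) (-R)) (vec3 R R R)"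
  assumes E: "set_integrable lborel Q (\<lambda>v. h v * ln (h v) * exp (- V v))"
    and I: "(\<integral>\<^sup>+v. ennreal ((norm (k v))\<^sup>2 / h v * exp (- V v)) \<partial>lborel) \<le> ennreal I" "I \<ge> 0"
  shows "(LINT v:Q|lborel. h v * ln (h v) * exp (- V v))
    \<le> (LINT v:Q|lborel. h v * exp (- V v)) * ln (LINT v:Q|lborel. h v * exp (- V v))
      - (LINT v:Q|lborel. h v * exp (- V v)) * ln (LINT v:Q|lborel. exp (- V v)) + I / (2 * c)"
proof -
  note li = has_weak_gradient_locally_integrable[OF w]
  have cQ: "compact Q" by (simp add: Q_def)
  have Qs[measurable]: "Q \<in> sets borel" by (simp add: Q_def)
  have cV: "continuous_on S V" for S using GDERIV_continuous V(1) by blast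
  have [measurable]: "h \<in> borel_measurable borel" "V \<in> borel_measurable borel"
    using li cV by (auto intro: locally_integrable_measurable borel_measurable_continuous_onI)
  define r where "r n = 1 / real (Suc n)" for n
  have r: "r n > 0" for n by (simp add: r_def)
  have r0: "r \<longlonglongrightarrow> 0" unfolding r_def using LIMSEQ_inverse_real_of_nat by (simp add: inverse_eq_divide)
  define H where "H n v = mollify (r n) h v + r n" for n v
  define K where "K n = mollify (r n) k" for n
  have Hder: "GDERIV (H n) v :> K n v" for n v
    using GDERIV_add[OF GDERIV_mollify[OF r w] GDERIV_const] by (simp add: H_def[abs_def] K_def)
  have cK: "continuous_on UNIV (K n)" for n unfolding K_def by (rule continuous_on_mollify[OF r li(2)])
  have Hpos: "H n v > 0" for n v using mollify_nonneg[OF r h] r[of n] by (simp add: H_def add_nonneg_pos)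
  have cH: "continuous_on S (H n)" for n S using GDERIV_continuous[OF Hder] .
  have [measurable]: "H n \<in> borel_measurable borel" for n using cH by (rule borel_measurable_continuous_onI)
  have si: "set_integrable lborel Q f" if "continuous_on UNIV f" for f :: "real^3 \<Rightarrow> real"
    using locally_integrable_continuous[OF that] cQ by (simp add: locally_integrable_def)
  have ihQ: "set_integrable lborel Q h" using li(1) cQ by (simp add: locally_integrable_def)
  have iZ: "set_integrable lborel Q (\<lambda>v. h v * exp (- V v))"
  proof -
    have "continuous_on UNIV (\<lambda>v. exp (- V v))" by (intro continuous_intros cV)
    from locally_integrable_scaleR[OF this li(1)] cQ show ?thesis
      by (simp add: locally_integrable_def mult.commute)
  qed
  define Z where "Z = (LINT v:Q|lborel. h v * exp (- V v))"
  define G where "G = (LINT v:Q|lborel. exp (- V v))"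
  define Zn where "Zn n = (LINT v:Q|lborel. H n v * exp (- V v))" for n
  define D where "D n v = indicator Q v *\<^sub>R (H n v - h v)" for n v
  have iD: "integrable lborel (D n)" for n
    using set_integral_diff(1)[OF si[OF cH] ihQ, of n] by (simp add: set_integrable_def D_def[abs_def])
  have D0: "(\<lambda>n. LINT v|lborel. norm (D n v)) \<longlonglongrightarrow> 0"
  proof (rule tendsto_sandwich[OF _ _ tendsto_const])
    have iQ: "integrable lborel (\<lambda>v. indicator Q v * a :: real)" for a
      using emeasure_compact_finite[OF cQ] by (intro integrable_mult_left) (simp add: less_top)
    let ?M = "\<lambda>n. LINT v|lborel. norm (indicator Q v *\<^sub>R (mollify (1 / real (Suc n)) h v - h v))"
    have "(LINT v|lborel. norm (D n v)) \<le> ?M n + measure lborel Q * r n" for n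
    proof -
      have iM: "integrable lborel (\<lambda>v. indicator Q v *\<^sub>R (mollify (r n) h v - h v))"
        using set_integral_diff(1)[OF si[OF continuous_on_mollify[OF r li(1)]] ihQ, of n]
        by (simp add: set_integrable_def)
      have "(LINT v|lborel. norm (D n v)) \<le> (LINT v|lborel. norm (indicator Q v *\<^sub>R (mollify (r n) h v - h v)) + indicator Q v * r n)"
        using r[of n] by (intro integral_mono integrable_norm iD iQ iM Bochner_Integration.integrable_add)
          (auto simp: D_def H_def indicator_def)
      also have "\<dots> = (LINT v|lborel. norm (indicator Q v *\<^sub>R (mollify (r n) h v - h v))) + measure lborel Q * r n"
        by (subst Bochner_Integration.integral_add[OF integrable_norm[OF iM] iQ]) simp
      finally show ?thesis by (simp only: r_def)
    qed
    then show "eventually (\<lambda>n. (LINT v|lborel. norm (D n v)) \<le> ?M n + measure lborel Q * r n) sequentially" by simp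
    have "(\<lambda>n. ?M n + measure lborel Q * r n) \<longlonglongrightarrow> 0 + measure lborel Q * 0"
      by (intro tendsto_intros mollify_tendsto_L1_compact[OF li(1) cQ] r0)
    then show "(\<lambda>n. ?M n + measure lborel Q * r n) \<longlonglongrightarrow> 0" by simp
  qed simp
  have Zlim: "Zn \<longlonglongrightarrow> Z"
  proof -
    have "bounded ((\<lambda>v. exp (- V v)) ` Q)"
      by (intro compact_imp_bounded compact_continuous_image cQ continuous_intros cV)
    then obtain B where B: "\<And>v. v \<in> Q \<Longrightarrow> exp (- V v) \<le> B" by (auto simp: bounded_iff)
    have "norm (Zn n - Z) \<le> B * (LINT v|lborel. norm (D n v))" for n
    proof -
      have i1: "set_integrable lborel Q (\<lambda>v. H n v * exp (- V v))" by (intro si continuous_intros cH cV)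
      have e: "Zn n - Z = (LINT v|lborel. D n v * exp (- V v))"
        unfolding Zn_def Z_def set_integral_diff(2)[OF i1 iZ, symmetric]
        unfolding set_lebesgue_integral_def D_def by (simp add: algebra_simps)
      have "integrable lborel (\<lambda>v. D n v * exp (- V v))"
        using set_integral_diff(1)[OF i1 iZ] by (simp add: set_integrable_def D_def algebra_simps)
      then have "norm (Zn n - Z) \<le> (LINT v|lborel. B * norm (D n v))"
        unfolding e
        by (intro order.trans[OF integral_norm_bound] integral_mono integrable_norm integrable_mult_right iD)
          (auto simp: D_def abs_mult indicator_def mult.commute[of B] intro!: mult_left_mono B)
      then show ?thesis by simp
    qed
    moreover have "(\<lambda>n. B * (LINT v|lborel. norm (D n v))) \<longlonglongrightarrow> 0" by (rule tendsto_mult_right_zero[OF D0])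
    ultimately have "(\<lambda>n. Zn n - Z) \<longlonglongrightarrow> 0"
      by (intro Lim_null_comparison[of "\<lambda>n. Zn n - Z" "\<lambda>n. B * (LINT v|lborel. norm (D n v))"]) auto
    then show ?thesis by (simp add: LIM_zero_iff)
  qed
  have Zn0: "Zn n \<ge> 0" for n unfolding Zn_def set_lebesgue_integral_def using Hpos by (simp add: less_imp_le)
  have Z0: "Z \<ge> 0" unfolding Z_def set_lebesgue_integral_def using h by simp
  obtain \<rho> :: "nat \<Rightarrow> nat" where \<rho>: "strict_mono \<rho>" "AE v in lborel. (\<lambda>n. D (\<rho> n) v) \<longlonglongrightarrow> 0"
    using tendsto_L1_AE_subseq[OF iD D0] by auto
  have Hlim: "AE v in lborel. v \<in> Q \<longrightarrow> (\<lambda>n. H (\<rho> n) v) \<longlonglongrightarrow> h v"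
    using \<rho>(2) by eventually_elim (auto simp: D_def LIM_zero_iff)
  define \<phi> where "\<phi> s = s * ln s + 1" for s :: real
  have main: "(LINT v:Q|lborel. h v * ln (h v) * exp (- V v)) \<le> Z * ln Z - Z * ln G + exp \<omega> * I / (2 * c)"
    if \<omega>: "\<omega> > 0" for \<omega>
  proof -
    define U where "U n = Zn n * ln (Zn n) - Zn n * ln G + exp \<omega> * I / (2 * c) + G" for n
    have Ulim: "(\<lambda>n. U (\<rho> n)) \<longlonglongrightarrow> Z * ln Z - Z * ln G + exp \<omega> * I / (2 * c) + G"
    proof -
      have "U \<longlonglongrightarrow> Z * ln Z - Z * ln G + exp \<omega> * I / (2 * c) + G"
        unfolding U_def by (intro tendsto_intros tendsto_mult_ln Zlim Zn0 Z0)
      from LIMSEQ_subseq_LIMSEQ[OF this \<rho>(1)] show ?thesis by (simp add: o_def)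
    qed
    have ev: "eventually (\<lambda>n. (LINT v:Q|lborel. \<phi> (H n v) * exp (- V v)) \<le> U n) sequentially"
      using eventually_mollified_Fisher_le[OF cV cQ li(1) h li(2) weak_gradient_eq_0_on_zero_set[OF w h] \<omega>]
    proof eventually_elim
      case (elim n)
      have cJ: "continuous_on UNIV (\<lambda>v. (norm (K n v))\<^sup>2 / H n v * exp (- V v))"
        using less_imp_neq[OF Hpos] by (intro continuous_intros cK cH cV) (metis)
      have J: "(LINT v:Q|lborel. (norm (K n v))\<^sup>2 / H n v * exp (- V v)) \<le> exp \<omega> * I"
      proof -
        have "(\<integral>\<^sup>+x. ennreal (indicator Q x *\<^sub>R ((norm (K n x))\<^sup>2 / H n x * exp (- V x))) \<partial>lborel) \<le> ennreal (exp \<omega>) * ennreal I"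
        proof (rule order.trans[OF _ mult_left_mono[OF I(1)]])
          have "ennreal (indicator Q x *\<^sub>R ((norm (K n x))\<^sup>2 / H n x * exp (- V x))) =
            indicator Q x * ennreal ((norm (mollify (1 / real (Suc n)) k x))\<^sup>2
              / (mollify (1 / real (Suc n)) h x + 1 / real (Suc n)) * exp (- V x))" for x
            by (auto simp: indicator_def K_def H_def r_def)
          then show "(\<integral>\<^sup>+x. ennreal (indicator Q x *\<^sub>R ((norm (K n x))\<^sup>2 / H n x * exp (- V x))) \<partial>lborel) \<le>
            ennreal (exp \<omega>) * (\<integral>\<^sup>+v. ennreal ((norm (k v))\<^sup>2 / h v * exp (- V v)) \<partial>lborel)"
            using elim by simp
        qed simp
        also have "\<dots> = ennreal (exp \<omega> * I)" using I(2) by (simp add: ennreal_mult)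
        finally have le: "(\<integral>\<^sup>+x. ennreal (indicator Q x *\<^sub>R ((norm (K n x))\<^sup>2 / H n x * exp (- V x))) \<partial>lborel) \<le> ennreal (exp \<omega> * I)" .
        have "(\<integral>\<^sup>+x. ennreal (indicator Q x *\<^sub>R ((norm (K n x))\<^sup>2 / H n x * exp (- V x))) \<partial>lborel) =
          ennreal (LINT v:Q|lborel. (norm (K n v))\<^sup>2 / H n v * exp (- V v))"
          unfolding set_lebesgue_integral_def using si[OF cJ] Hpos
          by (intro nn_integral_eq_integral) (auto simp: set_integrable_def less_imp_le)
        then show ?thesis using le I(2) by simp
      qed
      have cE: "continuous_on UNIV (\<lambda>v. H n v * ln (H n v) * exp (- V v))"
        using less_imp_neq[OF Hpos] by (intro continuous_intros cH cV) (metis)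
      have "(LINT v:Q|lborel. \<phi> (H n v) * exp (- V v)) =
         (LINT v:Q|lborel. H n v * ln (H n v) * exp (- V v)) + G"
        unfolding G_def \<phi>_def distrib_right mult_1_left
        by (intro set_integral_add si cE continuous_intros cV)
      also have "(LINT v:Q|lborel. H n v * ln (H n v) * exp (- V v)) \<le> Zn n * ln (Zn n) - Zn n * ln G
          + 1 / (2 * c) * (LINT v:Q|lborel. (norm (K n v))\<^sup>2 / H n v * exp (- V v))"
        unfolding Zn_def G_def Q_def by (rule log_Sobolev_cube[OF R c V convex Hder cK Hpos])
      also have "1 / (2 * c) * (LINT v:Q|lborel. (norm (K n v))\<^sup>2 / H n v * exp (- V v)) \<le> 1 / (2 * c) * (exp \<omega> * I)"
        using c by (intro mult_left_mono J) auto
      finally show ?case by (simp add: U_def)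
    qed
    have ev\<rho>: "eventually (\<lambda>n. (LINT v:Q|lborel. \<phi> (H (\<rho> n) v) * exp (- V v)) \<le> U (\<rho> n)) sequentially"
      using ev filterlim_subseq[OF \<rho>(1)] by (auto simp: filterlim_iff)
    have \<phi>0: "\<phi> s \<ge> 0" if "s \<ge> 0" for s unfolding \<phi>_def using mult_ln_ge[OF that] .
    have [measurable]: "\<phi> \<in> borel_measurable borel" unfolding \<phi>_def[abs_def] by measurable
    have nnH: "(\<integral>\<^sup>+v. ennreal (indicator Q v * (\<phi> (H n v) * exp (- V v))) \<partial>lborel) =
        ennreal (LINT v:Q|lborel. \<phi> (H n v) * exp (- V v))" for n
    proof -
      have "continuous_on UNIV (\<lambda>v. \<phi> (H n v) * exp (- V v))"
        unfolding \<phi>_def using less_imp_neq[OF Hpos] by (intro continuous_intros cH cV) (metis)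
      from si[OF this] show ?thesis
        unfolding set_lebesgue_integral_def using \<phi>0 Hpos
        by (subst nn_integral_eq_integral) (auto simp: set_integrable_def less_imp_le)
    qed
    have "(\<integral>\<^sup>+v. ennreal (indicator Q v * (\<phi> (h v) * exp (- V v))) \<partial>lborel)
      = (\<integral>\<^sup>+v. liminf (\<lambda>n. ennreal (indicator Q v * (\<phi> (H (\<rho> n) v) * exp (- V v)))) \<partial>lborel)"
    proof (rule nn_integral_cong_AE)
      show "AE v in lborel. ennreal (indicator Q v * (\<phi> (h v) * exp (- V v))) =
        liminf (\<lambda>n. ennreal (indicator Q v * (\<phi> (H (\<rho> n) v) * exp (- V v))))"
        using Hlim
      proof eventually_elim
        case (elim v)
        show ?case
        proof (cases "v \<in> Q")
          case True
          have "(\<lambda>n. \<phi> (H (\<rho> n) v)) \<longlonglongrightarrow> \<phi> (h v)"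
            unfolding \<phi>_def using elim True Hpos h by (intro tendsto_intros tendsto_mult_ln) (auto simp: less_imp_le)
          then have "(\<lambda>n. ennreal (indicator Q v * (\<phi> (H (\<rho> n) v) * exp (- V v)))) \<longlonglongrightarrow>
            ennreal (indicator Q v * (\<phi> (h v) * exp (- V v)))"
            by (intro tendsto_ennrealI tendsto_intros)
          from lim_imp_Liminf[OF _ this] show ?thesis by simp
        qed (simp add: Liminf_const)
      qed
    qed
    also have "\<dots> \<le> liminf (\<lambda>n. \<integral>\<^sup>+v. ennreal (indicator Q v * (\<phi> (H (\<rho> n) v) * exp (- V v))) \<partial>lborel)"
      by (rule nn_integral_liminf) measurable
    also have "\<dots> \<le> liminf (\<lambda>n. ennreal (U (\<rho> n)))"
      unfolding nnH by (rule Liminf_mono) (use ev\<rho> in eventually_elim, auto intro: ennreal_leI)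
    also have "\<dots> = ennreal (Z * ln Z - Z * ln G + exp \<omega> * I / (2 * c) + G)"
      by (rule lim_imp_Liminf[OF _ tendsto_ennrealI[OF Ulim]]) simp
    finally have le: "(\<integral>\<^sup>+v. ennreal (indicator Q v * (\<phi> (h v) * exp (- V v))) \<partial>lborel)
      \<le> ennreal (Z * ln Z - Z * ln G + exp \<omega> * I / (2 * c) + G)" .
    have i\<phi>: "set_integrable lborel Q (\<lambda>v. \<phi> (h v) * exp (- V v))"
      and e\<phi>: "(LINT v:Q|lborel. \<phi> (h v) * exp (- V v)) = (LINT v:Q|lborel. h v * ln (h v) * exp (- V v)) + G"
      unfolding G_def \<phi>_def distrib_right mult_1_left
      by (intro set_integral_add E si continuous_intros cV)+
    have "(\<integral>\<^sup>+v. ennreal (indicator Q v * (\<phi> (h v) * exp (- V v))) \<partial>lborel)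
       = ennreal (LINT v:Q|lborel. \<phi> (h v) * exp (- V v))"
      unfolding set_lebesgue_integral_def using i\<phi> \<phi>0 h
      by (subst nn_integral_eq_integral) (auto simp: set_integrable_def)
    with le have "ennreal (LINT v:Q|lborel. \<phi> (h v) * exp (- V v)) \<le> ennreal (Z * ln Z - Z * ln G + exp \<omega> * I / (2 * c) + G)"
      by simp
    moreover have "0 \<le> Z * ln Z - Z * ln G + exp \<omega> * I / (2 * c) + G"
    proof (rule tendsto_lowerbound[OF Ulim])
      show "eventually (\<lambda>n. 0 \<le> U (\<rho> n)) sequentially"
        using ev\<rho>
      proof eventually_elim
        case (elim n)
        have "0 \<le> (LINT v:Q|lborel. \<phi> (H (\<rho> n) v) * exp (- V v))"
          unfolding set_lebesgue_integral_def using \<phi>0 Hpos by (simp add: less_imp_le)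
        with elim show ?case by simp
      qed
    qed simp
    ultimately have "(LINT v:Q|lborel. \<phi> (h v) * exp (- V v)) \<le> Z * ln Z - Z * ln G + exp \<omega> * I / (2 * c) + G"
      by (simp add: ennreal_le_iff)
    then show ?thesis unfolding e\<phi> by simp
  qed
  have lim: "(\<lambda>n. Z * ln Z - Z * ln G + exp (r n) * I / (2 * c)) \<longlonglongrightarrow> Z * ln Z - Z * ln G + exp 0 * I / (2 * c)"
    using c by (intro tendsto_intros r0) simp
  have "(LINT v:Q|lborel. h v * ln (h v) * exp (- V v)) \<le> Z * ln Z - Z * ln G + exp 0 * I / (2 * c)"
    by (rule LIMSEQ_le_const[OF lim]) (use main[OF r] in auto)
  then show ?thesis by (simp add: Z_def G_def)
qed

lemma set_integral_cubes_tendsto: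
  fixes f :: "real^3 \<Rightarrow> real"
  assumes f: "integrable lborel f"
  defines "Q \<equiv> \<lambda>n. cbox (vec3 (- real (Suc n)) (- real (Suc n)) (- real (Suc n))) (vec3 (real (Suc n)) (real (Suc n)) (real (Suc n)))"
  shows "(\<lambda>n. LINT v:Q n|lborel. f v) \<longlonglongrightarrow> (LINT v|lborel. f v)"
  unfolding set_lebesgue_integral_def
proof (rule integral_dominated_convergence[where w="\<lambda>v. norm (f v)"])
  show "AE v in lborel. (\<lambda>n. indicator (Q n) v *\<^sub>R f v) \<longlonglongrightarrow> f v"
  proof (rule AE_I2)
    fix v :: "real^3"
    obtain N :: nat where N: "norm v \<le> real N" using real_arch_simple by blast
    have "eventually (\<lambda>n. f v = indicator (Q n) v *\<^sub>R f v) sequentially"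
      using eventually_ge_at_top[of N]
    proof eventually_elim
      case (elim n)
      have "- real (Suc n) \<le> v $ i \<and> v $ i \<le> real (Suc n)" for i
        using component_le_norm_cart[of v i] N elim by (simp add: abs_le_iff)
      then have "v \<in> Q n" unfolding Q_def mem_box_cart forall_3 vec3_nth by blast
      then show ?case by simp
    qed
    then show "(\<lambda>n. indicator (Q n) v *\<^sub>R f v) \<longlonglongrightarrow> f v"
      by (rule Lim_transform_eventually[rotated]) simp
  qed
qed (use f in \<open>auto simp: Q_def indicator_def\<close>)

text \<open>
  Exhaustion of the space by cubes: the constant 1 / (2 c) does not depend on the cube.
\<close>

theorem log_Sobolev_weak:
  fixes V h :: "real^3 \<Rightarrow> real" and V' k :: "real^3 \<Rightarrow> real^3"
  assumes c: "c > 0"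
    and V: "\<And>v. GDERIV V v :> V' v" "continuous_on UNIV V'"
    and convex: "\<And>v w. V v + V' v \<bullet> (w - v) + c / 2 * (norm (w - v))\<^sup>2 \<le> V w"
    and w: "has_weak_gradient h k" and h: "\<And>v. 0 \<le> h v"
    and G: "integrable lborel (\<lambda>v. exp (- V v))" and Z: "integrable lborel (\<lambda>v. h v * exp (- V v))"
    and E: "integrable lborel (\<lambda>v. h v * ln (h v) * exp (- V v))"
    and I: "(\<integral>\<^sup>+v. ennreal ((norm (k v))\<^sup>2 / h v * exp (- V v)) \<partial>lborel) \<le> ennreal I" "I \<ge> 0"
    and Gpos: "(LINT v|lborel. exp (- V v)) > 0"
  shows "(LINT v|lborel. h v * ln (h v) * exp (- V v))
    \<le> (LINT v|lborel. h v * exp (- V v)) * ln (LINT v|lborel. h v * exp (- V v))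
      - (LINT v|lborel. h v * exp (- V v)) * ln (LINT v|lborel. exp (- V v)) + I / (2 * c)"
proof -
  define Q where "Q n = cbox (vec3 (- real (Suc n)) (- real (Suc n)) (- real (Suc n))) (vec3 (real (Suc n)) (real (Suc n)) (real (Suc n)))" for n
  have le: "(LINT v:Q n|lborel. h v * ln (h v) * exp (- V v))
    \<le> (LINT v:Q n|lborel. h v * exp (- V v)) * ln (LINT v:Q n|lborel. h v * exp (- V v))
      - (LINT v:Q n|lborel. h v * exp (- V v)) * ln (LINT v:Q n|lborel. exp (- V v)) + I / (2 * c)" for n
    unfolding Q_def
  proof (rule log_Sobolev_cube_weak[OF _ c V convex w h _ I])
    show "set_integrable lborel (cbox (vec3 (- real (Suc n)) (- real (Suc n)) (- real (Suc n))) (vec3 (real (Suc n)) (real (Suc n)) (real (Suc n))))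
      (\<lambda>v. h v * ln (h v) * exp (- V v))"
      unfolding set_integrable_def by (rule integrable_mult_indicator[OF _ E]) simp
  qed simp
  note lims = set_integral_cubes_tendsto[folded Q_def]
  have Z0: "(LINT v:Q n|lborel. h v * exp (- V v)) \<ge> 0" for n
    unfolding set_lebesgue_integral_def using h by simp
  have "(\<lambda>n. (LINT v:Q n|lborel. h v * exp (- V v)) * ln (LINT v:Q n|lborel. h v * exp (- V v))
      - (LINT v:Q n|lborel. h v * exp (- V v)) * ln (LINT v:Q n|lborel. exp (- V v)) + I / (2 * c)) \<longlonglongrightarrow>
      (LINT v|lborel. h v * exp (- V v)) * ln (LINT v|lborel. h v * exp (- V v))
      - (LINT v|lborel. h v * exp (- V v)) * ln (LINT v|lborel. exp (- V v)) + I / (2 * c)"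
    using Gpos h by (intro tendsto_intros tendsto_mult_ln lims G Z Z0) auto
  from LIMSEQ_le[OF lims[OF E] this] le show ?thesis by blast
qed

section \<open>Integration by parts against polynomials\<close>

lemma test_function_facts:
  assumes "test_function \<phi> \<psi>"
  shows "\<And>v. GDERIV \<phi> v :> \<psi> v" "continuous_on UNIV \<psi>" "continuous_on UNIV \<phi>"
    "compact (closure {v. \<phi> v \<noteq> 0})" "\<And>v. v \<notin> closure {v. \<phi> v \<noteq> 0} \<Longrightarrow> \<phi> v = 0"
    "\<And>v. v \<notin> closure {v. \<phi> v \<noteq> 0} \<Longrightarrow> \<psi> v = 0"
proof -
  show d: "\<And>v. GDERIV \<phi> v :> \<psi> v" and "continuous_on UNIV \<psi>" "compact (closure {v. \<phi> v \<noteq> 0})"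
    using assms by (auto simp: test_function_def)
  show "continuous_on UNIV \<phi>" using GDERIV_continuous[OF d] .
  show z: "\<phi> v = 0" if "v \<notin> closure {v. \<phi> v \<noteq> 0}" for v
    using that closure_subset[of "{v. \<phi> v \<noteq> 0}"] by auto
  show "\<psi> v = 0" if v: "v \<notin> closure {v. \<phi> v \<noteq> 0}" for v
  proof -
    have "(\<phi> has_derivative (\<lambda>h. h \<bullet> \<psi> v)) (at v)" using d by (simp add: gderiv_def)
    moreover have "(\<phi> has_derivative (\<lambda>h. 0)) (at v)"
    proof (rule has_derivative_transform_within_open[of "\<lambda>_. 0" _ v UNIV "- closure {v. \<phi> v \<noteq> 0}"])
      show "((\<lambda>_. 0) has_derivative (\<lambda>h. 0)) (at v)" by (rule has_derivative_const)
      show "open (- closure {v. \<phi> v \<noteq> 0})" by (rule open_Compl[OF closed_closure])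
      show "v \<in> - closure {v. \<phi> v \<noteq> 0}" using v by blast
      fix x assume "x \<in> - closure {v. \<phi> v \<noteq> 0}"
      then show "0 = \<phi> x" using z[of x] by simp
    qed
    ultimately have "(\<lambda>h. h \<bullet> \<psi> v) = (\<lambda>h. 0)" by (rule has_derivative_unique)
    from fun_cong[OF this, of "\<psi> v"] show ?thesis by simp
  qed
qed

lemma locally_integrable_add:
  "locally_integrable f \<Longrightarrow> locally_integrable g \<Longrightarrow> locally_integrable (\<lambda>x. f x + g x)"
  by (auto simp: locally_integrable_def intro: set_integral_add)

lemma compact_subset_closure: "S \<subseteq> K \<Longrightarrow> compact K \<Longrightarrow> compact (closure S)"
  for S K :: "'a::euclidean_space set"
  by (meson bounded_subset compact_closure compact_imp_bounded)

text \<open>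
  If phi is a test function and a is C^1, then a phi is again a test function.
\<close>

lemma has_weak_gradient_mult:
  assumes w: "has_weak_gradient f g" and a: "\<And>v. GDERIV a v :> a' v" "continuous_on UNIV a'"
  shows "has_weak_gradient (\<lambda>v. a v * f v) (\<lambda>v. a v *\<^sub>R g v + f v *\<^sub>R a' v)"
proof -
  note li = has_weak_gradient_locally_integrable[OF w]
  have ca: "continuous_on UNIV a" using GDERIV_continuous[OF a(1)] .
  have l1: "locally_integrable (\<lambda>v. a v * f v)" using locally_integrable_scaleR[OF ca li(1)] by simp
  have l2: "locally_integrable (\<lambda>v. a v *\<^sub>R g v)" by (rule locally_integrable_scaleR[OF ca li(2)])
  have l3: "locally_integrable (\<lambda>v. f v *\<^sub>R a' v)" by (rule locally_integrable_scaleR_vector[OF a(2) li(1)])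
  have "(LINT v|lborel. (a v * f v) *\<^sub>R \<psi> v) = - (LINT v|lborel. \<phi> v *\<^sub>R (a v *\<^sub>R g v + f v *\<^sub>R a' v))"
    if t: "test_function \<phi> \<psi>" for \<phi> \<psi>
  proof -
    note tf = test_function_facts[OF t]
    let ?K = "closure {v. \<phi> v \<noteq> 0}"
    have t': "test_function (\<lambda>v. a v * \<phi> v) (\<lambda>v. a v *\<^sub>R \<psi> v + \<phi> v *\<^sub>R a' v)"
      unfolding test_function_def
    proof (intro conjI allI)
      show "GDERIV (\<lambda>v. a v * \<phi> v) v :> a v *\<^sub>R \<psi> v + \<phi> v *\<^sub>R a' v" for v
        by (rule GDERIV_mult[OF a(1) tf(1)])
      show "continuous_on UNIV (\<lambda>v. a v *\<^sub>R \<psi> v + \<phi> v *\<^sub>R a' v)"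
        by (intro continuous_intros ca tf a(2))
      show "compact (closure {v. a v * \<phi> v \<noteq> 0})"
        by (rule compact_subset_closure[OF _ tf(4)]) (use closure_subset[of "{v. \<phi> v \<noteq> 0}"] in auto)
    qed
    have i1: "integrable lborel (\<lambda>v. (a v * f v) *\<^sub>R \<psi> v)"
      by (rule integrable_scaleR_vector_compact_support[OF tf(2) tf(4) tf(6) l1])
    have i2: "integrable lborel (\<lambda>v. \<phi> v *\<^sub>R (f v *\<^sub>R a' v))"
      by (rule integrable_scaleR_compact_support[OF tf(3) tf(4) tf(5) l3])
    have i3: "integrable lborel (\<lambda>v. \<phi> v *\<^sub>R (a v *\<^sub>R g v))"
      by (rule integrable_scaleR_compact_support[OF tf(3) tf(4) tf(5) l2])
    have "(LINT v|lborel. (a v * f v) *\<^sub>R \<psi> v) + (LINT v|lborel. \<phi> v *\<^sub>R (f v *\<^sub>R a' v))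
      = (LINT v|lborel. (a v * f v) *\<^sub>R \<psi> v + \<phi> v *\<^sub>R (f v *\<^sub>R a' v))"
      by (rule Bochner_Integration.integral_add[OF i1 i2, symmetric])
    also have "\<dots> = (LINT v|lborel. f v *\<^sub>R (a v *\<^sub>R \<psi> v + \<phi> v *\<^sub>R a' v))"
      by (rule Bochner_Integration.integral_cong) (auto simp: algebra_simps)
    also have "\<dots> = - (LINT v|lborel. (a v * \<phi> v) *\<^sub>R g v)"
      using w t' by (auto simp: has_weak_gradient_def)
    also have "(LINT v|lborel. (a v * \<phi> v) *\<^sub>R g v) = (LINT v|lborel. \<phi> v *\<^sub>R (a v *\<^sub>R g v))"
      by (rule Bochner_Integration.integral_cong) (auto simp: algebra_simps)
    finally have "(LINT v|lborel. (a v * f v) *\<^sub>R \<psi> v) =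
        - (LINT v|lborel. \<phi> v *\<^sub>R (a v *\<^sub>R g v)) - (LINT v|lborel. \<phi> v *\<^sub>R (f v *\<^sub>R a' v))"
      by (simp only: eq_diff_eq)
    also have "\<dots> = - ((LINT v|lborel. \<phi> v *\<^sub>R (a v *\<^sub>R g v)) + (LINT v|lborel. \<phi> v *\<^sub>R (f v *\<^sub>R a' v)))"
      by simp
    also have "(LINT v|lborel. \<phi> v *\<^sub>R (a v *\<^sub>R g v)) + (LINT v|lborel. \<phi> v *\<^sub>R (f v *\<^sub>R a' v)) =
       (LINT v|lborel. \<phi> v *\<^sub>R (a v *\<^sub>R g v + f v *\<^sub>R a' v))"
      unfolding scaleR_add_right by (rule Bochner_Integration.integral_add[OF i3 i2, symmetric])
    finally show ?thesis .
  qed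
  then show ?thesis
    using l1 locally_integrable_add[OF l2 l3] by (auto simp: has_weak_gradient_def locally_integrable_def)
qed

text \<open>
  Used to test weak gradients against polynomials.  No integrability of the weak gradient at
  infinity is available, only of f (1 + |v|^2), so the limits below are taken after integration by parts.
\<close>

definition cutoff :: "nat \<Rightarrow> real^3 \<Rightarrow> real" where
  "cutoff n v = bump ((1 / real (Suc n)) *\<^sub>R v)"

definition cutoff_grad :: "nat \<Rightarrow> real^3 \<Rightarrow> real^3" where
  "cutoff_grad n v = (1 / real (Suc n)) *\<^sub>R bump_grad ((1 / real (Suc n)) *\<^sub>R v)"

lemma cutoff_facts:
  shows "GDERIV (cutoff n) v :> cutoff_grad n v" "continuous_on UNIV (cutoff n)" "continuous_on UNIV (cutoff_grad n)"
    "0 \<le> cutoff n v" "cutoff n v \<le> 1" "v \<notin> cball 0 (real (Suc n)) \<Longrightarrow> cutoff n v = 0"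
    "v \<notin> cball 0 (real (Suc n)) \<Longrightarrow> cutoff_grad n v = 0"
    "norm (cutoff_grad n v) \<le> 4 / real (Suc n)"
proof -
  show "GDERIV (cutoff n) v :> cutoff_grad n v"
    using GDERIV_bump_scaled[of "1 / real (Suc n)" 0 v] by (simp add: cutoff_def[abs_def] cutoff_grad_def)
  show "continuous_on UNIV (cutoff n)" "continuous_on UNIV (cutoff_grad n)"
    unfolding cutoff_def[abs_def] cutoff_grad_def[abs_def] by (intro continuous_intros)+
  show "0 \<le> cutoff n v" "cutoff n v \<le> 1" by (simp_all add: cutoff_def bump_bounds)
  show "v \<notin> cball 0 (real (Suc n)) \<Longrightarrow> cutoff n v = 0" "v \<notin> cball 0 (real (Suc n)) \<Longrightarrow> cutoff_grad n v = 0"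
    unfolding cutoff_def cutoff_grad_def
    by (simp_all only: bump_scaled_eq_0 bump_grad_scaled_eq_0 of_nat_0_less_iff zero_less_Suc
        mem_cball dist_0_norm not_le less_imp_le scaleR_zero_right)
  have "norm (bump_grad x) \<le> 4" for x
  proof (cases "norm x \<le> 1")
    case True
    then have "max 0 (1 - (norm x)\<^sup>2) * norm x \<le> 1 * 1" by (intro mult_mono) auto
    then show ?thesis by (simp add: bump_grad_def abs_mult)
  qed (simp add: bump_grad_eq_0)
  then show "norm (cutoff_grad n v) \<le> 4 / real (Suc n)"
    by (simp add: cutoff_grad_def divide_right_mono del: of_nat_Suc)
qed

lemma cutoff_tendsto: "(\<lambda>n. cutoff n v) \<longlonglongrightarrow> 1"
proof -
  have "(\<lambda>n. (1 / real (Suc n)) *\<^sub>R v) \<longlonglongrightarrow> 0 *\<^sub>R v"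
    using LIMSEQ_inverse_real_of_nat by (intro tendsto_intros) (simp add: inverse_eq_divide)
  moreover have "isCont bump (0 *\<^sub>R v)"
    using continuous_on_bump[OF continuous_on_id, of UNIV] by (simp add: continuous_on_eq_continuous_at)
  ultimately have "(\<lambda>n. bump ((1 / real (Suc n)) *\<^sub>R v)) \<longlonglongrightarrow> bump (0 *\<^sub>R v)"
    by (rule isCont_tendsto_compose[rotated])
  then show ?thesis unfolding cutoff_def by (simp add: bump_def)
qed

lemma cutoff_moment_tendsto:
  fixes \<zeta> :: "real^3 \<Rightarrow> real"
  assumes f: "integrable lborel (\<lambda>v. f v * (1 + (norm v)\<^sup>2))" "\<And>v. 0 \<le> f v" "f \<in> borel_measurable borel"
    and \<zeta>: "continuous_on UNIV \<zeta>" "\<And>v. \<bar>\<zeta> v\<bar> \<le> C * (1 + (norm v)\<^sup>2)"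
  shows "(\<lambda>n. LINT v|lborel. (cutoff n v * \<zeta> v) * f v) \<longlonglongrightarrow> (LINT v|lborel. \<zeta> v * f v)"
proof (rule integral_dominated_convergence[where w="\<lambda>v. C * (f v * (1 + (norm v)\<^sup>2))"])
  have [measurable]: "\<zeta> \<in> borel_measurable borel" "\<And>n. cutoff n \<in> borel_measurable borel"
    using \<zeta>(1) cutoff_facts(2) by (auto intro: borel_measurable_continuous_onI)
  note [measurable] = f(3)
  show "(\<lambda>v. \<zeta> v * f v) \<in> borel_measurable lborel" "\<And>n. (\<lambda>v. (cutoff n v * \<zeta> v) * f v) \<in> borel_measurable lborel"
    by measurable
  show "AE v in lborel. (\<lambda>n. cutoff n v * \<zeta> v * f v) \<longlonglongrightarrow> \<zeta> v * f v"
  proof (rule AE_I2)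
    fix v
    have "(\<lambda>n. cutoff n v * \<zeta> v * f v) \<longlonglongrightarrow> 1 * \<zeta> v * f v" by (intro tendsto_intros cutoff_tendsto)
    then show "(\<lambda>n. cutoff n v * \<zeta> v * f v) \<longlonglongrightarrow> \<zeta> v * f v" by simp
  qed
  show "AE v in lborel. norm (cutoff n v * \<zeta> v * f v) \<le> C * (f v * (1 + (norm v)\<^sup>2))" for n
  proof (rule AE_I2)
    fix v
    have "cutoff n v * \<bar>\<zeta> v\<bar> \<le> 1 * (C * (1 + (norm v)\<^sup>2))"
      using cutoff_facts(4,5)[of n v] \<zeta>(2)[of v] by (intro mult_mono) auto
    from mult_right_mono[OF this f(2)[of v]] show "norm (cutoff n v * \<zeta> v * f v) \<le> C * (f v * (1 + (norm v)\<^sup>2))"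
      using cutoff_facts(4)[of n v] f(2)[of v] by (simp add: abs_mult mult_ac)
  qed
qed (use f in auto)

text \<open>
  Integration by parts moves the derivative to the product of cutoff and polynomial.  The gradient of the cutoff
  is at most 4 / (n + 1), so the term containing it tends to zero while f (1 + |v|^2) dominates everything.
\<close>

lemma cutoff_gradient_moment_tendsto:
  fixes \<zeta> :: "real^3 \<Rightarrow> real"
  assumes w: "has_weak_gradient f g"
    and f: "integrable lborel (\<lambda>v. f v * (1 + (norm v)\<^sup>2))" "\<And>v. 0 \<le> f v"
    and \<zeta>: "\<And>v. GDERIV \<zeta> v :> \<zeta>' v" "continuous_on UNIV \<zeta>'"
      "\<And>v. \<bar>\<zeta> v\<bar> \<le> C * (1 + (norm v)\<^sup>2)" "\<And>v. norm (\<zeta>' v) \<le> C * (1 + (norm v)\<^sup>2)"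
  shows "(\<lambda>n. LINT v|lborel. (cutoff n v * \<zeta> v) *\<^sub>R g v) \<longlonglongrightarrow> - (LINT v|lborel. f v *\<^sub>R \<zeta>' v)"
proof -
  have C0: "C \<ge> 0" using \<zeta>(3)[of 0] by simp
  have c\<zeta>: "continuous_on UNIV \<zeta>" using GDERIV_continuous[OF \<zeta>(1)] .
  have [measurable]: "\<zeta> \<in> borel_measurable borel" "\<zeta>' \<in> borel_measurable borel"
    "\<And>n. cutoff n \<in> borel_measurable borel" "\<And>n. cutoff_grad n \<in> borel_measurable borel"
    using c\<zeta> \<zeta>(2) cutoff_facts(2,3) by (auto intro: borel_measurable_continuous_onI)
  have [measurable]: "f \<in> borel_measurable borel"
    using has_weak_gradient_locally_integrable[OF w] locally_integrable_measurable by blast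
  define \<psi> where "\<psi> n v = cutoff n v *\<^sub>R \<zeta>' v + \<zeta> v *\<^sub>R cutoff_grad n v" for n v
  have [measurable]: "\<And>n. \<psi> n \<in> borel_measurable borel" unfolding \<psi>_def[abs_def] by measurable
  have t: "test_function (\<lambda>v. cutoff n v * \<zeta> v) (\<psi> n)" for n
    unfolding test_function_def \<psi>_def
  proof (intro conjI allI GDERIV_mult cutoff_facts \<zeta>)
    show "continuous_on UNIV (\<lambda>v. cutoff n v *\<^sub>R \<zeta>' v + \<zeta> v *\<^sub>R cutoff_grad n v)"
      by (intro continuous_intros cutoff_facts \<zeta> c\<zeta>)
    show "compact (closure {v. cutoff n v * \<zeta> v \<noteq> 0})"
      by (rule compact_subset_closure[OF _ compact_cball[of 0 "real (Suc n)"]]) (use cutoff_facts(6)[of _ n] in force)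
  qed
  have eq: "(LINT v|lborel. (cutoff n v * \<zeta> v) *\<^sub>R g v) = - (LINT v|lborel. f v *\<^sub>R \<psi> n v)" for n
    using w[unfolded has_weak_gradient_def, THEN conjunct2, rule_format, OF t[of n]] by simp
  have "(\<lambda>n. LINT v|lborel. f v *\<^sub>R \<psi> n v) \<longlonglongrightarrow> (LINT v|lborel. f v *\<^sub>R \<zeta>' v)"
  proof (rule integral_dominated_convergence[where w="\<lambda>v. 5 * C * (f v * (1 + (norm v)\<^sup>2))"])
    show "AE v in lborel. (\<lambda>n. f v *\<^sub>R \<psi> n v) \<longlonglongrightarrow> f v *\<^sub>R \<zeta>' v"
    proof (rule AE_I2)
      fix v
      have "(\<lambda>n. cutoff_grad n v) \<longlonglongrightarrow> 0"
      proof (rule Lim_null_comparison[OF _ tendsto_mult_right_zero[OF LIMSEQ_inverse_real_of_nat, of 4]])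
        show "\<forall>\<^sub>F n in sequentially. norm (cutoff_grad n v) \<le> 4 * inverse (real (Suc n))"
          using cutoff_facts(8)[of _ v] by (simp add: divide_inverse)
      qed
      then have "(\<lambda>n. f v *\<^sub>R \<psi> n v) \<longlonglongrightarrow> f v *\<^sub>R (1 *\<^sub>R \<zeta>' v + \<zeta> v *\<^sub>R 0)"
        unfolding \<psi>_def by (intro tendsto_intros cutoff_tendsto)
      then show "(\<lambda>n. f v *\<^sub>R \<psi> n v) \<longlonglongrightarrow> f v *\<^sub>R \<zeta>' v" by simp
    qed
    show "AE v in lborel. norm (f v *\<^sub>R \<psi> n v) \<le> 5 * C * (f v * (1 + (norm v)\<^sup>2))" for n
    proof (rule AE_I2)
      fix v
      have "norm (\<psi> n v) \<le> norm (cutoff n v *\<^sub>R \<zeta>' v) + norm (\<zeta> v *\<^sub>R cutoff_grad n v)"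
        unfolding \<psi>_def by (rule norm_triangle_ineq)
      also have "\<dots> \<le> 1 * (C * (1 + (norm v)\<^sup>2)) + (C * (1 + (norm v)\<^sup>2)) * 4"
      proof (rule add_mono)
        show "norm (cutoff n v *\<^sub>R \<zeta>' v) \<le> 1 * (C * (1 + (norm v)\<^sup>2))"
          unfolding norm_scaleR using cutoff_facts(4,5)[of n v] \<zeta>(4) by (intro mult_mono) auto
        have "4 / real (Suc n) \<le> 4" by (simp add: divide_le_eq)
        then have "norm (cutoff_grad n v) \<le> 4" using cutoff_facts(8)[of n v] by linarith
        then show "norm (\<zeta> v *\<^sub>R cutoff_grad n v) \<le> (C * (1 + (norm v)\<^sup>2)) * 4"
          unfolding norm_scaleR using \<zeta>(3)[of v] C0 by (intro mult_mono) auto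
      qed
      finally have "norm (\<psi> n v) \<le> 5 * C * (1 + (norm v)\<^sup>2)" by simp
      from mult_left_mono[OF this f(2)[of v]] show "norm (f v *\<^sub>R \<psi> n v) \<le> 5 * C * (f v * (1 + (norm v)\<^sup>2))"
        using f(2)[of v] by (simp add: mult_ac)
    qed
  qed (use f in auto)
  then show ?thesis unfolding eq by (rule tendsto_minus)
qed

section \<open>The pointwise Landau estimate\<close>

definition landau_form :: "real^3 \<Rightarrow> real^3 \<Rightarrow> real" where
  "landau_form z x = (\<Sum>i\<in>UNIV. \<Sum>j\<in>UNIV. landau_kernel z i j * x $ i * x $ j)"

lemma landau_form_eq:
  "landau_form z x = inverse (norm z) * (x \<bullet> x - (z \<bullet> x)\<^sup>2 / (norm z)\<^sup>2)"
  by (cases "z = 0") (simp_all add: landau_form_def landau_kernel_def landau_proj_def inner_vec_def sum_3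
      divide_inverse algebra_simps power2_eq_square)

lemma landau_form_nonneg: "0 \<le> landau_form z x"
  unfolding landau_form_def by (rule landau_kernel_nonneg)

text \<open>
  The left side is (z.y)^2 with y = (x.c) a - (x.a) c, which is orthogonal to x and, by Bessel's inequality,
  not longer than x.  Replacing z by its component orthogonal to x and applying Cauchy-Schwarz gives the
  squared area on the right.
\<close>

lemma orthonormal_pair_bound:
  fixes a c x z :: "'a::real_inner"
  assumes ac: "norm a = 1" "norm c = 1" "a \<bullet> c = 0"
  shows "((z \<bullet> a) * (x \<bullet> c) - (z \<bullet> c) * (x \<bullet> a))\<^sup>2 \<le> (z \<bullet> z) * (x \<bullet> x) - (z \<bullet> x)\<^sup>2"
proof (cases "x = 0")
  case False
  have aa: "a \<bullet> a = 1" "c \<bullet> c = 1" "c \<bullet> a = 0" using ac by (simp_all add: norm_eq_1 inner_commute)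
  define y where "y = (x \<bullet> c) *\<^sub>R a - (x \<bullet> a) *\<^sub>R c"
  define z' where "z' = (x \<bullet> x) *\<^sub>R z - (z \<bullet> x) *\<^sub>R x"
  have yx: "x \<bullet> y = 0" by (simp add: y_def inner_simps)
  have yy: "y \<bullet> y = (x \<bullet> a)\<^sup>2 + (x \<bullet> c)\<^sup>2"
    by (simp add: y_def inner_simps aa ac power2_eq_square)
  have "0 \<le> (x - (x \<bullet> a) *\<^sub>R a - (x \<bullet> c) *\<^sub>R c) \<bullet> (x - (x \<bullet> a) *\<^sub>R a - (x \<bullet> c) *\<^sub>R c)" by simp
  also have "\<dots> = x \<bullet> x - (x \<bullet> a)\<^sup>2 - (x \<bullet> c)\<^sup>2"
    by (simp add: inner_simps aa ac power2_eq_square inner_commute algebra_simps)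
  finally have yle: "y \<bullet> y \<le> x \<bullet> x" using yy by simp
  have zz: "z' \<bullet> z' = (x \<bullet> x) * ((z \<bullet> z) * (x \<bullet> x) - (z \<bullet> x)\<^sup>2)"
    by (simp add: z'_def inner_simps power2_eq_square inner_commute algebra_simps)
  have "z' \<bullet> y = (x \<bullet> x) * (z \<bullet> y)" by (simp add: z'_def inner_simps yx)
  moreover have "(z' \<bullet> y)\<^sup>2 \<le> (z' \<bullet> z') * (y \<bullet> y)" by (rule Cauchy_Schwarz_ineq)
  moreover have "(z' \<bullet> z') * (y \<bullet> y) \<le> (z' \<bullet> z') * (x \<bullet> x)" by (intro mult_left_mono yle) simp
  ultimately have "(x \<bullet> x)\<^sup>2 * (z \<bullet> y)\<^sup>2 \<le> (x \<bullet> x)\<^sup>2 * ((z \<bullet> z) * (x \<bullet> x) - (z \<bullet> x)\<^sup>2)"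
    unfolding zz by (simp add: power_mult_distrib power2_eq_square mult_ac)
  then have "(z \<bullet> y)\<^sup>2 \<le> (z \<bullet> z) * (x \<bullet> x) - (z \<bullet> x)\<^sup>2"
    using False by (simp add: mult_le_cancel_left_pos)
  moreover have "z \<bullet> y = (z \<bullet> a) * (x \<bullet> c) - (z \<bullet> c) * (x \<bullet> a)" by (simp add: y_def inner_simps mult.commute)
  ultimately show ?thesis by simp
qed simp

lemma orthonormal_pair_landau_form:
  fixes a c x z :: "real^3"
  assumes ac: "norm a = 1" "norm c = 1" "a \<bullet> c = 0"
  shows "((z \<bullet> a) * (x \<bullet> c) - (z \<bullet> c) * (x \<bullet> a))\<^sup>2 \<le> (norm z)^3 * landau_form z x"
proof (cases "z = 0")
  case False
  have "(norm z)^3 * landau_form z x = (norm z)\<^sup>2 * (x \<bullet> x) - (z \<bullet> x)\<^sup>2"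
    using False by (simp add: landau_form_eq field_simps power2_eq_square power3_eq_cube)
  then show ?thesis using orthonormal_pair_bound[OF ac, of z x] by (simp add: power2_norm_eq_inner)
qed simp

lemma jbracket_facts:
  "jbracket v \<ge> 1" "(jbracket v)\<^sup>2 = 1 + (norm v)\<^sup>2" "norm v \<le> jbracket v"
  "continuous_on S jbracket" "jbracket \<in> borel_measurable borel"
proof -
  show "jbracket v \<ge> 1" by (simp add: jbracket_def)
  show "(jbracket v)\<^sup>2 = 1 + (norm v)\<^sup>2" by (simp add: jbracket_def)
  show "norm v \<le> jbracket v" unfolding jbracket_def by (rule real_le_rsqrt) simp
  show c: "continuous_on S jbracket" for S unfolding jbracket_def[abs_def] by (intro continuous_intros)
  show "jbracket \<in> borel_measurable borel" using c[of UNIV] by (rule borel_measurable_continuous_onI)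
qed

lemma moment_kernel_bound:
  assumes a: "norm a = 1"
  shows "(w \<bullet> a)\<^sup>2 * (norm (v - w))^3 \<le> 8 * (jbracket v)^3 * (jbracket w)^5"
proof -
  have "norm (v - w) \<le> jbracket v + jbracket w"
    using norm_triangle_ineq4[of v w] jbracket_facts(3)[of v] jbracket_facts(3)[of w] by linarith
  also have "\<dots> \<le> 2 * (jbracket v * jbracket w)"
  proof -
    have "jbracket v * 1 \<le> jbracket v * jbracket w" "1 * jbracket w \<le> jbracket v * jbracket w"
      using jbracket_facts(1)[of v] jbracket_facts(1)[of w] by (auto intro!: mult_mono)
    then show ?thesis by simp
  qed
  finally have "(norm (v - w))^3 \<le> (2 * (jbracket v * jbracket w))^3" by (intro power_mono) auto
  moreover have "(w \<bullet> a)\<^sup>2 \<le> (jbracket w)\<^sup>2"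
  proof -
    have "\<bar>w \<bullet> a\<bar> \<le> norm w" using Cauchy_Schwarz_ineq2[of w a] a by simp
    also have "\<dots> \<le> jbracket w" by (rule jbracket_facts)
    finally show ?thesis using power_mono[of "\<bar>w \<bullet> a\<bar>" "jbracket w" 2] by simp
  qed
  ultimately have "(w \<bullet> a)\<^sup>2 * (norm (v - w))^3 \<le> (jbracket w)\<^sup>2 * (2 * (jbracket v * jbracket w))^3"
    by (intro mult_mono) auto
  also have "\<dots> = 8 * (jbracket v)^3 * (jbracket w)^5"
    by (simp add: power_mult_distrib power_add[symmetric] numeral_eq_Suc)
  finally show ?thesis .
qed

text \<open>
  The quantity q is one component of the exterior product of v - w with b(v) - b(w).  Integrated
  against (w.a) f(w), with a cutoff, it becomes a combination F_n of moments of f and of the weak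
  gradient with coefficients depending on v.  In the limit mass, momentum and the vanishing of the
  off-diagonal second moment leave -(T (b.c) + v.c), and every F_n satisfies the same
  Cauchy-Schwarz bound.
\<close>

lemma pointwise_Landau_bound:
  fixes f :: "real^3 \<Rightarrow> real" and g :: "real^3 \<Rightarrow> real^3"
  assumes w: "has_weak_gradient f g" and f: "\<And>v. 0 \<le> f v"
    and mass: "has_bochner_integral lborel f 1"
    and momentum: "has_bochner_integral lborel (\<lambda>v. f v *\<^sub>R v) 0"
    and energy: "integrable lborel (\<lambda>v. f v * (norm v)\<^sup>2)"
    and ac: "norm a = 1" "norm c = 1" "a \<bullet> c = 0"
    and offdiag: "(LINT w|lborel. f w * ((w \<bullet> a) * (w \<bullet> c))) = 0"
  defines "b \<equiv> \<lambda>v. (1 / f v) *\<^sub>R g v"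
  shows "ennreal (((LINT w|lborel. f w * (w \<bullet> a)\<^sup>2) * (b v \<bullet> c) + v \<bullet> c)\<^sup>2)
    \<le> ennreal (8 * (jbracket v)^3) * moment 5 f * (\<integral>\<^sup>+w. ennreal (f w * landau_form (v - w) (b v - b w)) \<partial>lborel)"
proof -
  let ?k = "\<lambda>w. f w * ((w \<bullet> a)\<^sup>2 * (norm (v - w))^3)"
  let ?l = "\<lambda>w. f w * landau_form (v - w) (b v - b w)"
  note li = has_weak_gradient_locally_integrable[OF w]
  have [measurable]: "f \<in> borel_measurable borel" "g \<in> borel_measurable borel"
    using li by (auto intro: locally_integrable_measurable)
  have [measurable]: "b \<in> borel_measurable borel" unfolding b_def by measurable
  have [measurable]: "\<And>n. cutoff n \<in> borel_measurable borel"
    using cutoff_facts(2) by (rule borel_measurable_continuous_onI)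
  note [measurable] = jbracket_facts(5)
  have aa: "a \<bullet> a = 1" "c \<bullet> c = 1" "c \<bullet> a = 0" using ac by (simp_all add: norm_eq_1 inner_commute)
  have if1: "integrable lborel f" "(LINT v|lborel. f v) = 1"
    using mass by (auto simp: has_bochner_integral_iff)
  have if2: "integrable lborel (\<lambda>v. f v *\<^sub>R v)" "(LINT v|lborel. f v *\<^sub>R v) = 0"
    using momentum by (auto simp: has_bochner_integral_iff)
  have fE: "integrable lborel (\<lambda>v. f v * (1 + (norm v)\<^sup>2))"
    using Bochner_Integration.integrable_add[OF if1(1) energy] by (simp add: distrib_left)
  have zeroset: "AE w in lborel. f w = 0 \<longrightarrow> g w = 0" by (rule weak_gradient_eq_0_on_zero_set[OF w f])
  define T where "T = (LINT w|lborel. f w * (w \<bullet> a)\<^sup>2)"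
  define q where "q w = ((v - w) \<bullet> a) * ((b v - b w) \<bullet> c) - ((v - w) \<bullet> c) * ((b v - b w) \<bullet> a)" for w
  have lin_le: "\<bar>w \<bullet> e\<bar> \<le> 1 * (1 + (norm w)\<^sup>2)" "norm e \<le> 1 * (1 + (norm w)\<^sup>2)" if "norm e = 1" for w e :: "real^3"
  proof -
    have "\<bar>w \<bullet> e\<bar> \<le> norm w" using Cauchy_Schwarz_ineq2[of w e] that by simp
    also have "\<dots> \<le> 1 + (norm w)\<^sup>2" using sum_squares_ge_zero[of "norm w - 1" 0] zero_le_power2[of "norm w - 1"]
      by (simp add: power2_diff) (smt (verit) zero_le_power2)
    finally show "\<bar>w \<bullet> e\<bar> \<le> 1 * (1 + (norm w)\<^sup>2)" by simp
    show "norm e \<le> 1 * (1 + (norm w)\<^sup>2)" using that by simp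
  qed
  have quad_le: "\<bar>(w \<bullet> a) * (w \<bullet> e)\<bar> \<le> 1 * (1 + (norm w)\<^sup>2)"
      "norm ((w \<bullet> a) *\<^sub>R e + (w \<bullet> e) *\<^sub>R a) \<le> 2 * (1 + (norm w)\<^sup>2)" if e: "norm e = 1" for w e :: "real^3"
  proof -
    have "\<bar>w \<bullet> a\<bar> \<le> norm w" "\<bar>w \<bullet> e\<bar> \<le> norm w"
      using Cauchy_Schwarz_ineq2[of w e] Cauchy_Schwarz_ineq2[of w a] e ac by simp_all
    then have "\<bar>w \<bullet> a\<bar> * \<bar>w \<bullet> e\<bar> \<le> norm w * norm w" by (intro mult_mono) auto
    then show "\<bar>(w \<bullet> a) * (w \<bullet> e)\<bar> \<le> 1 * (1 + (norm w)\<^sup>2)" by (simp add: abs_mult power2_eq_square)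
    have "norm ((w \<bullet> a) *\<^sub>R e + (w \<bullet> e) *\<^sub>R a) \<le> \<bar>w \<bullet> a\<bar> + \<bar>w \<bullet> e\<bar>"
      using norm_triangle_ineq[of "(w \<bullet> a) *\<^sub>R e" "(w \<bullet> e) *\<^sub>R a"] e ac by simp
    then show "norm ((w \<bullet> a) *\<^sub>R e + (w \<bullet> e) *\<^sub>R a) \<le> 2 * (1 + (norm w)\<^sup>2)"
      using lin_le(1)[OF e, of w] lin_le(1)[OF ac(1), of w] by simp
  qed
  have quad_le': "\<bar>(w \<bullet> a) * (w \<bullet> e)\<bar> \<le> 2 * (1 + (norm w)\<^sup>2)" if e: "norm e = 1" for w e :: "real^3"
    using quad_le(1)[OF e, of w] by (smt (verit) zero_le_power2)
  have dlin: "GDERIV (\<lambda>w. w \<bullet> e) w :> e" for w e :: "real^3"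
    unfolding gderiv_def by (auto intro!: derivative_eq_intros)
  have dquad: "GDERIV (\<lambda>w. (w \<bullet> a) * (w \<bullet> e)) w :> (w \<bullet> a) *\<^sub>R e + (w \<bullet> e) *\<^sub>R a" for w e :: "real^3"
    by (rule GDERIV_mult[OF dlin dlin])
  \<comment> \<open>Moments of f and of its weak gradient, truncated by the cutoff.\<close>
  define M where "M n \<zeta> = (LINT w|lborel. (cutoff n w * \<zeta> w) * f w)" for n \<zeta>
  define G where "G n \<zeta> = (LINT w|lborel. (cutoff n w * \<zeta> w) *\<^sub>R g w)" for n \<zeta>
  let ?a = "\<lambda>w. w \<bullet> a" and ?aa = "\<lambda>w. (w \<bullet> a) * (w \<bullet> a)" and ?ac = "\<lambda>w. (w \<bullet> a) * (w \<bullet> c)"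
  have M_a: "(\<lambda>n. M n ?a) \<longlonglongrightarrow> 0"
  proof -
    have "(\<lambda>n. M n ?a) \<longlonglongrightarrow> (LINT w|lborel. (w \<bullet> a) * f w)" unfolding M_def
      by (rule cutoff_moment_tendsto[OF fE f _ _ lin_le(1)[OF ac(1)]]) (auto intro!: continuous_intros)
    also have "(LINT w|lborel. (w \<bullet> a) * f w) = (LINT w|lborel. (f w *\<^sub>R w) \<bullet> a)" by (simp add: mult.commute)
    also have "\<dots> = 0" using if2 by (subst integral_inner_left) auto
    finally show ?thesis .
  qed
  have M_aa: "(\<lambda>n. M n ?aa) \<longlonglongrightarrow> T" unfolding M_def
    using cutoff_moment_tendsto[OF fE f _ _ quad_le(1)[OF ac(1)]]
    by (simp add: T_def power2_eq_square mult.commute[of "f _"] continuous_intros)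
  have M_ac: "(\<lambda>n. M n ?ac) \<longlonglongrightarrow> 0" unfolding M_def
    using cutoff_moment_tendsto[OF fE f _ _ quad_le(1)[OF ac(2)]] offdiag
    by (simp add: mult.commute[of "f _"] continuous_intros)
  have G_a: "(\<lambda>n. G n ?a) \<longlonglongrightarrow> - a"
  proof -
    have "(\<lambda>n. G n ?a) \<longlonglongrightarrow> - (LINT w|lborel. f w *\<^sub>R a)" unfolding G_def
      by (rule cutoff_gradient_moment_tendsto[OF w fE f dlin _ lin_le[OF ac(1)]]) auto
    then show ?thesis using if1 by simp
  qed
  have G_quad: "(\<lambda>n. G n (\<lambda>w. (w \<bullet> a) * (w \<bullet> e))) \<longlonglongrightarrow> 0" if e: "norm e = 1" for e :: "real^3"
  proof -
    have "(\<lambda>n. G n (\<lambda>w. (w \<bullet> a) * (w \<bullet> e))) \<longlonglongrightarrow>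
       - (LINT w|lborel. f w *\<^sub>R ((w \<bullet> a) *\<^sub>R e + (w \<bullet> e) *\<^sub>R a))" unfolding G_def
      by (rule cutoff_gradient_moment_tendsto[OF w fE f dquad _ quad_le'[OF e] quad_le(2)[OF e]])
        (auto intro!: continuous_intros)
    also have "(LINT w|lborel. f w *\<^sub>R ((w \<bullet> a) *\<^sub>R e + (w \<bullet> e) *\<^sub>R a)) =
       (LINT w|lborel. ((f w *\<^sub>R w) \<bullet> a) *\<^sub>R e + ((f w *\<^sub>R w) \<bullet> e) *\<^sub>R a)"
      by (simp add: scaleR_add_right)
    also have "\<dots> = (LINT w|lborel. ((f w *\<^sub>R w) \<bullet> a)) *\<^sub>R e + (LINT w|lborel. ((f w *\<^sub>R w) \<bullet> e)) *\<^sub>R a"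
      by (intro has_bochner_integral_integral_eq has_bochner_integral_add has_bochner_integral_scaleR_left
          has_bochner_integral_integrable integrable_inner_left if2)
    also have "\<dots> = 0"
      using integral_inner_left[of a lborel "\<lambda>w. f w *\<^sub>R w"] integral_inner_left[of e lborel "\<lambda>w. f w *\<^sub>R w"] if2 by simp
    finally show ?thesis by simp
  qed
  define F where "F n = (LINT w|lborel. (cutoff n w * (w \<bullet> a)) * (f w * q w))" for n
  have MG: "has_bochner_integral lborel (\<lambda>w. (cutoff n w * \<zeta> w) * f w) (M n \<zeta>)"
    "has_bochner_integral lborel (\<lambda>w. (cutoff n w * \<zeta> w) *\<^sub>R g w) (G n \<zeta>)"
    if "continuous_on UNIV \<zeta>" for \<zeta> n
  proof -
    have c: "continuous_on UNIV (\<lambda>w. cutoff n w * \<zeta> w)" by (intro continuous_intros cutoff_facts that)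
    have z: "cutoff n w * \<zeta> w = 0" if "w \<notin> cball 0 (real (Suc n))" for w using cutoff_facts(6)[OF that] by simp
    show "has_bochner_integral lborel (\<lambda>w. (cutoff n w * \<zeta> w) * f w) (M n \<zeta>)" unfolding M_def
      by (intro has_bochner_integral_integrable
          integrable_scaleR_compact_support[OF c compact_cball z li(1), unfolded real_scaleR_def])
    show "has_bochner_integral lborel (\<lambda>w. (cutoff n w * \<zeta> w) *\<^sub>R g w) (G n \<zeta>)" unfolding G_def
      by (intro has_bochner_integral_integrable integrable_scaleR_compact_support[OF c compact_cball z li(2)])
  qed
  have cl: "continuous_on UNIV ?a" "continuous_on UNIV ?aa" "continuous_on UNIV ?ac"
    by (intro continuous_intros)+
  have F_eq: "F n = (v \<bullet> a * (b v \<bullet> c) - v \<bullet> c * (b v \<bullet> a)) * M n ?a - (b v \<bullet> c) * M n ?aa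
      + (b v \<bullet> a) * M n ?ac - (v \<bullet> a) * (G n ?a \<bullet> c) + (v \<bullet> c) * (G n ?a \<bullet> a) + G n ?aa \<bullet> c - G n ?ac \<bullet> a"
    (is "_ = ?rhs") for n
  proof -
    let ?m = "\<lambda>\<zeta> w. (cutoff n w * \<zeta> w) * f w" and ?g = "\<lambda>\<zeta> w. (cutoff n w * \<zeta> w) *\<^sub>R g w"
    let ?h = "\<lambda>w. (v \<bullet> a * (b v \<bullet> c) - v \<bullet> c * (b v \<bullet> a)) * ?m ?a w - (b v \<bullet> c) * ?m ?aa w + (b v \<bullet> a) * ?m ?ac w
      - (v \<bullet> a) * (?g ?a w \<bullet> c) + (v \<bullet> c) * (?g ?a w \<bullet> a) + ?g ?aa w \<bullet> c - ?g ?ac w \<bullet> a"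
    have "F n = (LINT w|lborel. ?h w)"
      unfolding F_def
    proof (rule integral_cong_AE)
      show "AE w in lborel. (cutoff n w * (w \<bullet> a)) * (f w * q w) = ?h w"
        using zeroset
      proof eventually_elim
        case (elim w)
        \<comment> \<open>The quotient b is 0 where f = 0, and there the weak gradient vanishes almost everywhere.\<close>
        then have g: "g w = f w *\<^sub>R b w" unfolding b_def by (cases "f w = 0") auto
        show ?case unfolding q_def g by (simp add: inner_simps algebra_simps)
      qed
      show "(\<lambda>w. (cutoff n w * (w \<bullet> a)) * (f w * q w)) \<in> borel_measurable lborel"
        unfolding q_def by measurable
    qed measurable
    also have "\<dots> = ?rhs"
      by (rule has_bochner_integral_integral_eq)
        (intro has_bochner_integral_add has_bochner_integral_diff has_bochner_integral_mult_right
          has_bochner_integral_inner_left MG cl)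
    finally show ?thesis .
  qed
  have Flim: "F \<longlonglongrightarrow> - (T * (b v \<bullet> c) + v \<bullet> c)"
  proof -
    have "F \<longlonglongrightarrow> (v \<bullet> a * (b v \<bullet> c) - v \<bullet> c * (b v \<bullet> a)) * 0 - (b v \<bullet> c) * T + (b v \<bullet> a) * 0
      - (v \<bullet> a) * (- a \<bullet> c) + (v \<bullet> c) * (- a \<bullet> a) + 0 \<bullet> c - 0 \<bullet> a"
      unfolding F_eq by (intro tendsto_intros M_a M_aa M_ac G_a G_quad ac)
    then show ?thesis using ac aa by (simp add: algebra_simps)
  qed
  define B where "B = (\<integral>\<^sup>+w. ennreal (?l w) \<partial>lborel)"
  have mform[measurable]: "(\<lambda>w. landau_form (v - w) (b v - b w)) \<in> borel_measurable borel"
    unfolding landau_form_eq by measurable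
  have bound: "ennreal ((F n)\<^sup>2) \<le> ennreal (8 * (jbracket v)^3) * moment 5 f * B" for n
  proof -
    have iFn: "integrable lborel (\<lambda>w. (cutoff n w * (w \<bullet> a)) * (f w * q w)) \<or> F n = 0"
      unfolding F_def using not_integrable_integral_eq by blast
    have "ennreal \<bar>F n\<bar> \<le> (\<integral>\<^sup>+w. ennreal \<bar>(cutoff n w * (w \<bullet> a)) * (f w * q w)\<bar> \<partial>lborel)"
      using iFn integral_norm_bound_ennreal[of lborel "\<lambda>w. (cutoff n w * (w \<bullet> a)) * (f w * q w)"]
      by (auto simp: F_def)
    also have "\<dots> \<le> (\<integral>\<^sup>+w. ennreal (sqrt (?k w)) *
        ennreal (sqrt (?l w)) \<partial>lborel)"
    proof (rule nn_integral_mono)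
      fix w
      have "\<bar>q w\<bar> \<le> sqrt ((norm (v - w))^3 * landau_form (v - w) (b v - b w))"
        using orthonormal_pair_landau_form[OF ac, of "v - w" "b v - b w"] by (intro real_le_rsqrt) (simp add: q_def)
      then have "\<bar>w \<bullet> a\<bar> * f w * \<bar>q w\<bar> \<le> \<bar>w \<bullet> a\<bar> * f w * sqrt ((norm (v - w))^3 * landau_form (v - w) (b v - b w))"
        using f[of w] by (intro mult_left_mono) auto
      also have "\<dots> = sqrt ((\<bar>w \<bullet> a\<bar> * f w)\<^sup>2 * ((norm (v - w))^3 * landau_form (v - w) (b v - b w)))"
        using f[of w] by (simp add: real_sqrt_mult)
      also have "(\<bar>w \<bullet> a\<bar> * f w)\<^sup>2 * ((norm (v - w))^3 * landau_form (v - w) (b v - b w)) =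
        (?k w) * (?l w)"
        by (simp add: power_mult_distrib power2_eq_square mult_ac)
      also have "sqrt \<dots> = sqrt (?k w) * sqrt (?l w)"
        by (rule real_sqrt_mult)
      finally have le: "\<bar>w \<bullet> a\<bar> * f w * \<bar>q w\<bar> \<le> sqrt (?k w) * sqrt (?l w)" .
      have "\<bar>(cutoff n w * (w \<bullet> a)) * (f w * q w)\<bar> = cutoff n w * (\<bar>w \<bullet> a\<bar> * f w * \<bar>q w\<bar>)"
        using cutoff_facts(4)[of n w] f[of w] by (simp add: abs_mult)
      also have "\<dots> \<le> 1 * (\<bar>w \<bullet> a\<bar> * f w * \<bar>q w\<bar>)"
        using cutoff_facts(5)[of n w] f[of w] by (intro mult_right_mono) auto
      finally have "\<bar>(cutoff n w * (w \<bullet> a)) * (f w * q w)\<bar> \<le> sqrt (?k w) * sqrt (?l w)"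
        using le by simp
      then show "ennreal \<bar>(cutoff n w * (w \<bullet> a)) * (f w * q w)\<bar> \<le> ennreal (sqrt (?k w)) *
        ennreal (sqrt (?l w))"
        using f[of w] landau_form_nonneg[of "v - w" "b v - b w"] by (simp add: ennreal_mult[symmetric] ennreal_leI)
    qed
    finally have le1: "ennreal \<bar>F n\<bar> \<le> (\<integral>\<^sup>+w. ennreal (sqrt (?k w)) *
        ennreal (sqrt (?l w)) \<partial>lborel)" .
    have "ennreal ((F n)\<^sup>2) = (ennreal \<bar>F n\<bar>)\<^sup>2" by (simp add: ennreal_power)
    also have "\<dots> \<le> (\<integral>\<^sup>+w. ennreal (sqrt (?k w)) *
        ennreal (sqrt (?l w)) \<partial>lborel)\<^sup>2"
      by (intro power_mono le1) simp
    also have "\<dots> \<le> (\<integral>\<^sup>+w. (ennreal (sqrt (?k w)))\<^sup>2 \<partial>lborel) *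
        (\<integral>\<^sup>+w. (ennreal (sqrt (?l w)))\<^sup>2 \<partial>lborel)"
      by (rule Cauchy_Schwarz_nn_integral) measurable
    also have "\<dots> = (\<integral>\<^sup>+w. ennreal (?k w) \<partial>lborel) * B"
      unfolding B_def using f landau_form_nonneg by (simp add: ennreal_power)
    also have "\<dots> \<le> (ennreal (8 * (jbracket v)^3) * moment 5 f) * B"
    proof (rule mult_right_mono)
      have "(\<integral>\<^sup>+w. ennreal (?k w) \<partial>lborel)
         \<le> (\<integral>\<^sup>+w. ennreal (8 * (jbracket v)^3) * ennreal (jbracket w powr 5 * f w) \<partial>lborel)"
      proof (rule nn_integral_mono)
        fix w
        have "f w * ((w \<bullet> a)\<^sup>2 * (norm (v - w))^3) \<le> f w * (8 * (jbracket v)^3 * (jbracket w)^5)"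
          by (intro mult_left_mono moment_kernel_bound ac f)
        also have "(jbracket w)^5 = jbracket w powr 5"
          using jbracket_facts(1)[of w] powr_realpow[of "jbracket w" 5] by simp
        finally show "ennreal (?k w) \<le> ennreal (8 * (jbracket v)^3) * ennreal (jbracket w powr 5 * f w)"
          using f[of w] jbracket_facts(1)[of v] by (simp add: ennreal_mult[symmetric] ennreal_leI mult_ac)
      qed
      also have "\<dots> = ennreal (8 * (jbracket v)^3) * moment 5 f"
        unfolding moment_def by (rule nn_integral_cmult) measurable
      finally show "(\<integral>\<^sup>+w. ennreal (?k w) \<partial>lborel) \<le> ennreal (8 * (jbracket v)^3) * moment 5 f" .
    qed simp
    finally show ?thesis .
  qed
  have "(\<lambda>n. ennreal ((F n)\<^sup>2)) \<longlonglongrightarrow> ennreal ((- (T * (b v \<bullet> c) + v \<bullet> c))\<^sup>2)"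
    by (intro tendsto_ennrealI tendsto_intros Flim)
  then have "ennreal ((- (T * (b v \<bullet> c) + v \<bullet> c))\<^sup>2) \<le> ennreal (8 * (jbracket v)^3) * moment 5 f * B"
    by (rule LIMSEQ_le_const2) (use bound in auto)
  then show ?thesis unfolding T_def[symmetric] B_def[symmetric] power2_minus .
qed

section \<open>Principal axes of the second moment\<close>

text \<open>
  First order condition: P(e + t y, e + t y) <= P(e, e) |e + t y|^2 for all real t forces the term of order t to vanish.
\<close>

lemma constrained_maximizer_orthogonal:
  fixes P :: "'a::real_inner \<Rightarrow> 'a \<Rightarrow> real"
  assumes P: "bilinear P" and sym: "\<And>x y. P x y = P y x"
    and S: "subspace S" and e: "e \<in> S" "norm e = 1"
    and max: "\<And>x. x \<in> S \<Longrightarrow> norm x = 1 \<Longrightarrow> P x x \<le> P e e"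
    and y: "y \<in> S" "y \<bullet> e = 0"
  shows "P e y = 0"
proof (rule ccontr)
  assume A: "P e y \<noteq> 0"
  define A where "A = P e y"
  define B where "B = P e e * (y \<bullet> y) - P y y"
  have ineq: "2 * t * A \<le> t\<^sup>2 * B" for t
  proof -
    define u where "u = e + t *\<^sub>R y"
    have uu: "u \<bullet> u = 1 + t\<^sup>2 * (y \<bullet> y)"
      using e y by (simp add: u_def inner_simps norm_eq_1 inner_commute power2_eq_square)
    then have upos: "u \<bullet> u > 0" by (simp add: add_pos_nonneg)
    then have u0: "norm u > 0" by auto
    have uS: "(1 / norm u) *\<^sub>R u \<in> S" unfolding u_def by (intro subspace_scale subspace_add S e y)
    have "P ((1 / norm u) *\<^sub>R u) ((1 / norm u) *\<^sub>R u) \<le> P e e"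
      by (rule max[OF uS]) (use u0 in simp)
    then have "P u u / (u \<bullet> u) \<le> P e e"
      by (simp add: bilinear_lmul[OF P] bilinear_rmul[OF P] power2_norm_eq_inner[symmetric] power2_eq_square)
    then have "P u u \<le> P e e * (1 + t\<^sup>2 * (y \<bullet> y))" using upos uu by (simp add: divide_le_eq)
    moreover have "P u u = P e e + 2 * t * P e y + t\<^sup>2 * P y y"
      unfolding u_def by (simp add: bilinear_ladd[OF P] bilinear_radd[OF P] bilinear_lmul[OF P] bilinear_rmul[OF P]
          sym[of y e] power2_eq_square algebra_simps)
    ultimately show ?thesis by (simp add: A_def B_def algebra_simps)
  qed
  define s where "s = \<bar>B\<bar> + 1"
  have s: "s > 0" "B < s" by (auto simp: s_def)
  have A2: "A\<^sup>2 > 0" using A by (simp add: A_def)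
  \<comment> \<open>For t = A / s the linear term exceeds the quadratic one, because s > |B|.\<close>
  have "2 * (A / s) * A \<le> (A / s)\<^sup>2 * B" by (rule ineq)
  then have "2 * (A\<^sup>2 * s) \<le> A\<^sup>2 * B"
    using s by (simp add: field_simps power2_eq_square)
  then have "2 * s \<le> B" using A2 by (simp add: mult.left_commute[of 2] mult_le_cancel_left_pos)
  with s show False by linarith
qed

text \<open>
  Gram's determinant identity: the square of the triple product x . (e1 x e2) is the Gram determinant of x, e1, e2.
\<close>

lemma norm_sq_orthonormal_cross3:
  fixes e1 e2 x :: "real^3"
  assumes "norm e1 = 1" "norm e2 = 1" "e1 \<bullet> e2 = 0"
  shows "x \<bullet> x = (x \<bullet> e1)\<^sup>2 + (x \<bullet> e2)\<^sup>2 + (x \<bullet> cross3 e1 e2)\<^sup>2"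
proof -
  have gram: "(x \<bullet> cross3 e1 e2)\<^sup>2 = (e1 \<bullet> e1) * (e2 \<bullet> e2) * (x \<bullet> x) + 2 * (e1 \<bullet> e2) * (e2 \<bullet> x) * (e1 \<bullet> x)
     - (e1 \<bullet> e1) * (e2 \<bullet> x)\<^sup>2 - (e2 \<bullet> e2) * (e1 \<bullet> x)\<^sup>2 - (x \<bullet> x) * (e1 \<bullet> e2)\<^sup>2"
    by (simp add: cross3_def inner_3 power2_eq_square) algebra
  have "e1 \<bullet> e1 = 1" "e2 \<bullet> e2 = 1" using assms by (simp_all add: norm_eq_1)
  with gram assms(3) show ?thesis by (simp add: inner_commute)
qed

text \<open>
  e 0 maximises the quadratic form on the unit sphere, e 1 maximises it on the unit circle orthogonal to
  e 0, and e 2 is their cross product.  Indices are natural numbers below 3.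
\<close>

lemma orthonormal_eigenbasis:
  fixes P :: "real^3 \<Rightarrow> real^3 \<Rightarrow> real"
  assumes P: "bilinear P" and sym: "\<And>x y. P x y = P y x"
  obtains e :: "nat \<Rightarrow> real^3"
    where "\<And>i. i < 3 \<Longrightarrow> norm (e i) = 1" "\<And>i j. i < 3 \<Longrightarrow> j < 3 \<Longrightarrow> i \<noteq> j \<Longrightarrow> e i \<bullet> e j = 0"
      "\<And>i j. i < 3 \<Longrightarrow> j < 3 \<Longrightarrow> i \<noteq> j \<Longrightarrow> P (e i) (e j) = 0"
      "\<And>x. x \<bullet> x = (x \<bullet> e 0)\<^sup>2 + (x \<bullet> e 1)\<^sup>2 + (x \<bullet> e 2)\<^sup>2"
proof -
  have cP: "continuous_on S (\<lambda>x. P x x)" for S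
    using bilinear_conv_bounded_bilinear P bounded_bilinear.continuous_on[of P S "\<lambda>x. x" "\<lambda>x. x"]
    by (auto intro: continuous_on_id)
  obtain e1 where e1: "e1 \<in> sphere 0 1" "\<And>x. x \<in> sphere 0 1 \<Longrightarrow> P x x \<le> P e1 e1"
    using continuous_attains_sup[of "sphere (0::real^3) 1" "\<lambda>x. P x x"] cP by auto
  let ?S = "{x. e1 \<bullet> x = 0}"
  have S: "subspace ?S" by (rule subspace_hyperplane)
  have ne: "sphere 0 1 \<inter> ?S \<noteq> {}"
  proof -
    obtain x where "x \<noteq> 0" "orthogonal e1 x" using vector_in_orthogonal_basis[of e1] orthogonal_to_vector_exists[of e1]
      by (auto simp: orthogonal_commute)
    then have "(1 / norm x) *\<^sub>R x \<in> sphere 0 1 \<inter> ?S" by (auto simp: orthogonal_def)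
    then show ?thesis by blast
  qed
  have "compact (sphere 0 1 \<inter> ?S)" by (intro compact_Int_closed compact_sphere closed_hyperplane)
  then obtain e2 where e2: "e2 \<in> sphere 0 1 \<inter> ?S" "\<And>x. x \<in> sphere 0 1 \<inter> ?S \<Longrightarrow> P x x \<le> P e2 e2"
    using continuous_attains_sup[OF _ ne cP] by blast
  define e3 where "e3 = cross3 e1 e2"
  have n: "norm e1 = 1" "norm e2 = 1" "e1 \<bullet> e2 = 0" using e1 e2 by auto
  have o: "e1 \<bullet> e3 = 0" "e2 \<bullet> e3 = 0" by (simp_all add: e3_def dot_cross_self)
  have n3: "norm e3 = 1"
    using norm_cross[of e1 e2] n power2_eq_1_iff[of "norm e3"] norm_ge_zero[of e3]
    by (simp add: e3_def del: norm_ge_zero)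
  have z1: "P e1 y = 0" if "y \<bullet> e1 = 0" for y
    by (rule constrained_maximizer_orthogonal[OF P sym subspace_UNIV]) (use n e1 that in auto)
  have z2: "P e2 y = 0" if "y \<bullet> e1 = 0" "y \<bullet> e2 = 0" for y
    by (rule constrained_maximizer_orthogonal[OF P sym S]) (use n e2 that in \<open>auto simp: inner_commute\<close>)
  define e where "e i = (if i = 0 then e1 else if i = 1 then e2 else e3)" for i :: nat
  have i3: "i < 3 \<longleftrightarrow> i = 0 \<or> i = 1 \<or> i = (2::nat)" for i by auto
  show ?thesis
  proof (rule that[of e])
    show "norm (e i) = 1" if "i < 3" for i using n n3 by (simp add: e_def)
    show "e i \<bullet> e j = 0" if "i < 3" "j < 3" "i \<noteq> j" for i j
      using that n o unfolding i3 e_def by (auto simp: inner_commute)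
    show "P (e i) (e j) = 0" if "i < 3" "j < 3" "i \<noteq> j" for i j
      using that n o z1[of e2] z1[of e3] z2[of e3] sym[of e2 e1] sym[of e3 e1] sym[of e3 e2]
      unfolding i3 e_def by (auto simp: inner_commute)
    show "x \<bullet> x = (x \<bullet> e 0)\<^sup>2 + (x \<bullet> e 1)\<^sup>2 + (x \<bullet> e 2)\<^sup>2" for x
      using norm_sq_orthonormal_cross3[OF n, of x] by (simp add: e_def e3_def)
  qed
qed

section \<open>Lower bounds for the spread in every direction\<close>

text \<open>
  The Maxwellian is the product of three standard normal densities.
\<close>

lemma maxwellian_integral: "has_bochner_integral lborel maxwellian 1"
proof (rule has_bochner_integral_nn_integral)
  have [measurable]: "maxwellian \<in> borel_measurable borel"
    unfolding maxwellian_def[abs_def] by measurable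
  show "maxwellian \<in> borel_measurable lborel" by measurable
  show "AE v in lborel. 0 \<le> maxwellian v" by (simp add: maxwellian_def)
  have factor: "maxwellian v = (\<Prod>b\<in>Basis. std_normal_density (v \<bullet> b))" for v
  proof -
    have "(norm v)\<^sup>2 = (\<Sum>b\<in>Basis. (v \<bullet> b)\<^sup>2)"
      unfolding power2_norm_eq_inner by (subst euclidean_inner) (simp add: power2_eq_square)
    then have "exp (- (norm v)\<^sup>2 / 2) = (\<Prod>b\<in>Basis. exp (- (v \<bullet> b)\<^sup>2 / 2))"
      by (simp add: exp_sum[symmetric] sum_negf sum_divide_distrib)
    moreover have "(2 * pi) powr (-3/2) = (1 / sqrt (2 * pi)) ^ card (Basis :: (real^3) set)"
    proof -
      have "(1 / sqrt (2 * pi)) ^ 3 = ((2 * pi) powr (-1/2)) ^ 3"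
        by (simp add: powr_half_sqrt[symmetric] powr_minus_divide)
      also have "\<dots> = (2 * pi) powr (-3/2)" by (simp add: powr_power)
      finally show ?thesis by simp
    qed
    ultimately show ?thesis
      unfolding maxwellian_def std_normal_density_def by (simp only: prod.distrib prod_constant)
  qed
  have "(\<integral>\<^sup>+v. ennreal (maxwellian v) \<partial>lborel) =
      (\<integral>\<^sup>+v. (\<Prod>b\<in>Basis. ennreal (std_normal_density (v \<bullet> b))) \<partial>(lborel :: (real^3) measure))"
    unfolding factor by (simp add: prod_ennreal)
  also have "\<dots> = (\<Prod>b\<in>(Basis :: (real^3) set). \<integral>\<^sup>+x. ennreal (std_normal_density x) \<partial>lborel)"
    by (rule nn_integral_lborel_prod) auto
  also have "(\<integral>\<^sup>+x. ennreal (std_normal_density x) \<partial>lborel) = 1"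
    using nn_integral_eq_integral[OF integrable_normal_density[of 1 0]] by simp
  finally show "(\<integral>\<^sup>+v. ennreal (maxwellian v) \<partial>lborel) = ennreal 1" by simp
qed simp

lemma lborel_orthogonal_transformation:
  fixes T :: "real^3 \<Rightarrow> real^3"
  assumes T: "orthogonal_transformation T"
  shows "distr lborel borel T = lborel"
proof (rule lborel_eqI[symmetric])
  have lin: "linear T" using T by (rule orthogonal_transformation_linear)
  have [measurable]: "T \<in> borel_measurable borel"
    by (intro borel_measurable_continuous_onI linear_continuous_on linear_conv_bounded_linear[THEN iffD1] lin)
  fix l u :: "real^3" assume le: "\<And>b. b \<in> Basis \<Longrightarrow> l \<bullet> b \<le> u \<bullet> b"
  have T': "orthogonal_transformation (inv T)" using T by (rule orthogonal_transformation_inv)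
  have bij: "bij T" using T by (rule orthogonal_transformation_bij)
  have pre: "T -` box l u = inv T ` box l u" using bij by (simp add: bij_vimage_eq_inv_image)
  have lm: "box l u \<in> lmeasurable" by simp
  have lm': "inv T ` box l u \<in> lmeasurable" by (rule measurable_orthogonal_image[OF T' lm])
  have bs: "T -` box l u \<in> sets borel" using measurable_sets_borel[of T borel "box l u"] by simp
  have "emeasure (distr lborel borel T) (box l u) = emeasure lborel (T -` box l u)"
    by (simp add: emeasure_distr)
  also have "\<dots> = emeasure lebesgue (inv T ` box l u)"
    using bs by (simp add: pre emeasure_completion)
  also have "\<dots> = ennreal (measure lebesgue (inv T ` box l u))"
    using lm' by (simp add: emeasure_eq_measure2)
  also have "measure lebesgue (inv T ` box l u) = measure lebesgue (box l u)"
    by (rule measure_orthogonal_image[OF T' lm])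
  also have "\<dots> = (\<Prod>b\<in>Basis. (u - l) \<bullet> b)"
    using le by (simp add: measure_lborel_box_eq)
  finally show "emeasure (distr lborel borel T) (box l u) = ennreal (\<Prod>b\<in>Basis. (u - l) \<bullet> b)" .
qed simp

text \<open>
  The Gaussian integral with an extra weight that suppresses velocities with a component along e.
  It tends to zero as N grows, since only a plane remains, and uniformly in e because of rotation invariance.
\<close>

definition damped_gaussian_mass :: "real \<Rightarrow> real^3 \<Rightarrow> real" where
  "damped_gaussian_mass N e =
    (LINT v|lborel. exp (- N * ((v \<bullet> e)\<^sup>2 * jbracket v powr (-3)) - (norm v)\<^sup>2 / 2))"

lemma integrable_gaussian: "integrable lborel (\<lambda>v::real^3. exp (- (norm v)\<^sup>2 / 2))"
proof -
  have "integrable lborel (\<lambda>v. (1 / (2 * pi) powr (-3/2)) * maxwellian v)"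
    using maxwellian_integral by (intro integrable_mult_right) (auto simp: has_bochner_integral_iff)
  then show ?thesis by (simp add: maxwellian_def)
qed

lemma jbracket_powr_neg_bounds: "0 < jbracket v powr (-3)" "jbracket v powr (-3) \<le> 1"
proof -
  show "0 < jbracket v powr (-3)" using jbracket_facts(1)[of v] by simp
  show "jbracket v powr (-3) \<le> 1"
    using powr_mono[of "-3" 0 "jbracket v"] jbracket_facts(1)[of v] by simp
qed

lemma jbracket_measurable [measurable]: "jbracket \<in> borel_measurable borel"
  by (rule jbracket_facts(5))

lemma damped_gaussian_integrable:
  assumes "N \<ge> 0"
  shows "integrable lborel (\<lambda>v. exp (- N * ((v \<bullet> e)\<^sup>2 * jbracket v powr (-3)) - (norm v)\<^sup>2 / 2))"
proof (rule Bochner_Integration.integrable_bound[OF integrable_gaussian])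
  show "AE v in lborel. norm (exp (- N * ((v \<bullet> e)\<^sup>2 * jbracket v powr (-3)) - (norm v)\<^sup>2 / 2)) \<le> norm (exp (- (norm v)\<^sup>2 / 2))"
    using assms by (auto intro!: AE_I2 mult_nonneg_nonneg)
qed measurable

lemma damped_gaussian_mass_rotation:
  assumes e: "norm e = 1" "norm e' = 1"
  shows "damped_gaussian_mass N e = damped_gaussian_mass N e'"
proof -
  obtain T where T: "orthogonal_transformation T" "T e = e'"
    using orthogonal_transformation_exists[of e e'] e by auto
  have Tn: "norm (T v) = norm v" and Ti: "T v \<bullet> T w = v \<bullet> w" for v w
    using T(1) by (auto simp: orthogonal_transformation_norm orthogonal_transformation_def)
  have jT: "jbracket (T v) = jbracket v" for v by (simp add: jbracket_def Tn)
  have lin: "linear T" using T(1) by (rule orthogonal_transformation_linear)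
  have [measurable]: "T \<in> borel_measurable borel"
    by (intro borel_measurable_continuous_onI linear_continuous_on linear_conv_bounded_linear[THEN iffD1] lin)
  have "damped_gaussian_mass N e' = (LINT v|lborel. exp (- N * ((T v \<bullet> e')\<^sup>2 * jbracket (T v) powr (-3)) - (norm (T v))\<^sup>2 / 2))"
    unfolding damped_gaussian_mass_def
    by (subst lborel_orthogonal_transformation[OF T(1), symmetric], subst integral_distr) auto
  also have "\<dots> = damped_gaussian_mass N e"
    unfolding damped_gaussian_mass_def T(2)[symmetric] by (simp only: Tn Ti jT)
  finally show ?thesis by simp
qed

lemma damped_gaussian_mass_tendsto_0:
  assumes e: "norm e = 1"
  shows "(\<lambda>n. damped_gaussian_mass (real n) e) \<longlonglongrightarrow> 0"
proof -
  have "(\<lambda>n. damped_gaussian_mass (real n) e) \<longlonglongrightarrow> (LINT v|(lborel :: (real^3) measure). 0)"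
    unfolding damped_gaussian_mass_def
  proof (rule integral_dominated_convergence[where w="\<lambda>v. exp (- (norm v)\<^sup>2 / 2)"])
    have "negligible {v. e \<bullet> v = 0}" using e by (intro negligible_hyperplane) auto
    then have "AE v in lebesgue. e \<bullet> v \<noteq> 0"
      by (simp add: AE_iff_null_sets negligible_iff_null_sets AE_not_in[of "{v. e \<bullet> v = 0}", simplified])
    then have "AE v in lborel. e \<bullet> v \<noteq> 0" by (simp add: AE_completion_iff)
    then show "AE v in lborel. (\<lambda>n. exp (- real n * ((v \<bullet> e)\<^sup>2 * jbracket v powr (-3)) - (norm v)\<^sup>2 / 2)) \<longlonglongrightarrow> 0"
    proof eventually_elim
      case (elim v)
      define a where "a = (v \<bullet> e)\<^sup>2 * jbracket v powr (-3)"
      have a: "a > 0" using elim jbracket_powr_neg_bounds[of v] by (simp add: a_def inner_commute)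
      have "(\<lambda>n. exp (- (norm v)\<^sup>2 / 2) * exp (- a) ^ n) \<longlonglongrightarrow> exp (- (norm v)\<^sup>2 / 2) * 0"
        using a by (intro tendsto_mult tendsto_const LIMSEQ_realpow_zero) auto
      moreover have eq: "exp (- (norm v)\<^sup>2 / 2) * exp (- a) ^ n = exp (- real n * a - (norm v)\<^sup>2 / 2)" for n
        by (simp add: exp_of_nat_mult[symmetric] exp_add[symmetric])
      ultimately have "(\<lambda>n. exp (- real n * a - (norm v)\<^sup>2 / 2)) \<longlonglongrightarrow> 0" by (simp only: eq mult_zero_right)
      then show ?case by (simp only: a_def)
    qed
    show "AE v in lborel. norm (exp (- real n * ((v \<bullet> e)\<^sup>2 * jbracket v powr (-3)) - (norm v)\<^sup>2 / 2)) \<le> exp (- (norm v)\<^sup>2 / 2)" for n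
      by (auto intro!: AE_I2 mult_nonneg_nonneg)
  qed (use integrable_gaussian in auto)
  then show ?thesis by simp
qed

text \<open>
  Young's inequality for the convex conjugate functions s ln s - s and exp.
\<close>

lemma Young_entropy:
  fixes s l :: real
  assumes "s \<ge> 0" shows "s * l \<le> s * ln s - s + exp l"
proof (cases "s = 0")
  case False
  with assms have s: "s > 0" by simp
  have "s * (1 + (l - ln s)) \<le> s * exp (l - ln s)" using s by (intro mult_left_mono exp_ge_add_one_self) auto
  also have "\<dots> = exp l" using s by (simp add: exp_diff)
  finally show ?thesis by (simp add: algebra_simps)
qed simp

text \<open>
  Entropy duality.  Young's inequality is integrated with s = f and
  l = t - N a - |v|^2/2, where a = (v.e)^2 <v>^(-3); for t = Hbar + 5/2 the integral of exp l is at most 1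
  once N is so large that the damped Gaussian mass is below exp(-t).  The moments of f are known
  except for the integral of f a, for which 1 / N remains as lower bound.  N depends on Hbar only.
\<close>

lemma directional_spread_lower_bound:
  "\<exists>c>0. \<forall>f e. admissible Hbar f \<longrightarrow> norm e = 1 \<longrightarrow> c \<le> (LINT v|lborel. f v * ((v \<bullet> e)\<^sup>2 * jbracket v powr (-3)))"
proof -
  define e0 :: "real^3" where "e0 = axis 1 1"
  have e0: "norm e0 = 1" by (simp add: e0_def)
  have "eventually (\<lambda>n. damped_gaussian_mass (real n) e0 < exp (- Hbar - 5/2)) sequentially"
    by (rule order_tendstoD(2)[OF damped_gaussian_mass_tendsto_0[OF e0]]) simp
  then obtain n0 where n0: "\<And>n. n \<ge> n0 \<Longrightarrow> damped_gaussian_mass (real n) e0 < exp (- Hbar - 5/2)"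
    unfolding eventually_sequentially by auto
  define N where "N = real (Suc n0)"
  have N: "N \<ge> 1" "damped_gaussian_mass N e0 < exp (- Hbar - 5/2)" using n0[of "Suc n0"] by (auto simp: N_def)
  show ?thesis
  proof (intro exI[of _ "1 / N"] conjI allI impI)
    show "0 < 1 / N" using N by simp
    fix f and e :: "real^3" assume adm: "admissible Hbar f" and e: "norm e = 1"
    have f: "\<And>v. 0 \<le> f v" "integrable lborel f" "(LINT v|lborel. f v) = 1"
      "integrable lborel (\<lambda>v. f v * (norm v)\<^sup>2)" "(LINT v|lborel. f v * (norm v)\<^sup>2) = 3"
      "integrable lborel (\<lambda>v. f v * ln (f v))" "(LINT v|lborel. f v * ln (f v)) \<le> Hbar"
      using adm by (auto simp: admissible_def has_bochner_integral_iff entropy_def)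
    have [measurable]: "f \<in> borel_measurable borel" using f(2) by auto
    define a where "a v = (v \<bullet> e)\<^sup>2 * jbracket v powr (-3)" for v
    have [measurable]: "a \<in> borel_measurable borel" unfolding a_def[abs_def] by measurable
    have a: "0 \<le> a v" "a v \<le> (norm v)\<^sup>2" for v
    proof -
      show "0 \<le> a v" by (simp add: a_def)
      have "\<bar>v \<bullet> e\<bar> \<le> norm v" using Cauchy_Schwarz_ineq2[of v e] e by simp
      then have "(v \<bullet> e)\<^sup>2 \<le> (norm v)\<^sup>2" using power_mono[of "\<bar>v \<bullet> e\<bar>" "norm v" 2] by simp
      then have "a v \<le> (norm v)\<^sup>2 * 1" unfolding a_def using jbracket_powr_neg_bounds[of v] by (intro mult_mono) auto
      then show "a v \<le> (norm v)\<^sup>2" by simp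
    qed
    have ia: "integrable lborel (\<lambda>v. f v * a v)"
      by (rule Bochner_Integration.integrable_bound[OF f(4)]) (use f(1) a in \<open>auto intro!: AE_I2 mult_left_mono\<close>)
    define t where "t = Hbar + 5/2"
    define l where "l v = t - N * a v - (norm v)\<^sup>2 / 2" for v
    have iexp: "integrable lborel (\<lambda>v. exp (l v))" and eexp: "(LINT v|lborel. exp (l v)) = exp t * damped_gaussian_mass N e"
    proof -
      have eq: "exp (l v) = exp t * exp (- N * ((v \<bullet> e)\<^sup>2 * jbracket v powr (-3)) - (norm v)\<^sup>2 / 2)" for v
        by (simp add: l_def a_def exp_add[symmetric])
      show "integrable lborel (\<lambda>v. exp (l v))" unfolding eq using N by (intro integrable_mult_right damped_gaussian_integrable) auto
      show "(LINT v|lborel. exp (l v)) = exp t * damped_gaussian_mass N e" unfolding eq damped_gaussian_mass_def by simp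
    qed
    have "(LINT v|lborel. f v * l v) \<le> (LINT v|lborel. f v * ln (f v) - f v + exp (l v))"
    proof (rule integral_mono)
      have "integrable lborel (\<lambda>v. t * f v - N * (f v * a v) - (f v * (norm v)\<^sup>2) / 2)"
        using f ia by auto
      then show "integrable lborel (\<lambda>v. f v * l v)" by (simp add: l_def algebra_simps)
      show "integrable lborel (\<lambda>v. f v * ln (f v) - f v + exp (l v))" using f iexp by auto
      show "f v * l v \<le> f v * ln (f v) - f v + exp (l v)" for v by (rule Young_entropy[OF f(1)])
    qed
    also have "\<dots> = (LINT v|lborel. f v * ln (f v)) - 1 + exp t * damped_gaussian_mass N e"
      using f iexp eexp by simp
    also have "\<dots> \<le> Hbar - 1 + 1"
    proof -
      have "exp t * damped_gaussian_mass N e \<le> exp t * exp (- Hbar - 5/2)"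
        using N(2) damped_gaussian_mass_rotation[OF e e0, of N] by (intro mult_left_mono) auto
      also have "\<dots> = 1" by (simp add: t_def exp_add[symmetric])
      finally show ?thesis using f(7) by simp
    qed
    also have "(LINT v|lborel. f v * l v) = t - N * (LINT v|lborel. f v * a v) - 3 / 2"
    proof -
      have "(LINT v|lborel. f v * l v) = (LINT v|lborel. t * f v - N * (f v * a v) - (f v * (norm v)\<^sup>2) / 2)"
        by (rule Bochner_Integration.integral_cong) (auto simp: l_def algebra_simps)
      then show ?thesis using f ia by simp
    qed
    finally have "1 \<le> N * (LINT v|lborel. f v * a v)" by (simp add: t_def)
    then show "1 / N \<le> (LINT v|lborel. f v * ((v \<bullet> e)\<^sup>2 * jbracket v powr (-3)))"
      using N by (simp add: a_def divide_le_eq mult.commute)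
  qed
qed

section \<open>The weighted Fisher information bound\<close>

lemma nn_integral_square_combination:
  fixes u w :: "real^3 \<Rightarrow> real"
  assumes [measurable]: "\<rho> \<in> borel_measurable borel" "u \<in> borel_measurable borel" "w \<in> borel_measurable borel"
    and \<rho>: "\<And>v. 0 \<le> \<rho> v"
    and X: "(\<integral>\<^sup>+v. ennreal (\<rho> v * (u v)\<^sup>2) \<partial>lborel) \<le> ennreal X" "X \<ge> 0"
    and Y: "(\<integral>\<^sup>+v. ennreal (\<rho> v * (w v)\<^sup>2) \<partial>lborel) \<le> ennreal Y" "Y \<ge> 0"
  shows "(\<integral>\<^sup>+v. ennreal (\<rho> v * (\<alpha> * u v + \<beta> * w v)\<^sup>2) \<partial>lborel) \<le> ennreal (2 * \<alpha>\<^sup>2 * X + 2 * \<beta>\<^sup>2 * Y)"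
proof -
  have "(\<integral>\<^sup>+v. ennreal (\<rho> v * (\<alpha> * u v + \<beta> * w v)\<^sup>2) \<partial>lborel) \<le>
    (\<integral>\<^sup>+v. ennreal (2 * \<alpha>\<^sup>2) * ennreal (\<rho> v * (u v)\<^sup>2) + ennreal (2 * \<beta>\<^sup>2) * ennreal (\<rho> v * (w v)\<^sup>2) \<partial>lborel)"
  proof (rule nn_integral_mono)
    fix v
    have "(\<alpha> * u v + \<beta> * w v)\<^sup>2 \<le> 2 * \<alpha>\<^sup>2 * (u v)\<^sup>2 + 2 * \<beta>\<^sup>2 * (w v)\<^sup>2"
      using zero_le_power2[of "\<alpha> * u v - \<beta> * w v"] by (simp add: power2_sum power2_diff power_mult_distrib)
    from mult_left_mono[OF this \<rho>[of v]]
    have "\<rho> v * (\<alpha> * u v + \<beta> * w v)\<^sup>2 \<le> 2 * \<alpha>\<^sup>2 * (\<rho> v * (u v)\<^sup>2) + 2 * \<beta>\<^sup>2 * (\<rho> v * (w v)\<^sup>2)"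
      by (simp add: algebra_simps)
    then show "ennreal (\<rho> v * (\<alpha> * u v + \<beta> * w v)\<^sup>2) \<le>
      ennreal (2 * \<alpha>\<^sup>2) * ennreal (\<rho> v * (u v)\<^sup>2) + ennreal (2 * \<beta>\<^sup>2) * ennreal (\<rho> v * (w v)\<^sup>2)"
      using \<rho>[of v] by (simp add: ennreal_mult[symmetric] ennreal_plus[symmetric] ennreal_leI del: ennreal_plus)
  qed
  also have "\<dots> = ennreal (2 * \<alpha>\<^sup>2) * (\<integral>\<^sup>+v. ennreal (\<rho> v * (u v)\<^sup>2) \<partial>lborel)
      + ennreal (2 * \<beta>\<^sup>2) * (\<integral>\<^sup>+v. ennreal (\<rho> v * (w v)\<^sup>2) \<partial>lborel)"
    by (subst nn_integral_add; (subst nn_integral_cmult)?; (subst nn_integral_cmult)?; simp)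
  also have "\<dots> \<le> ennreal (2 * \<alpha>\<^sup>2) * ennreal X + ennreal (2 * \<beta>\<^sup>2) * ennreal Y"
    by (intro add_mono mult_left_mono X Y) auto
  also have "\<dots> = ennreal (2 * \<alpha>\<^sup>2 * X + 2 * \<beta>\<^sup>2 * Y)"
    using X Y by (simp add: ennreal_mult[symmetric] ennreal_plus[symmetric] del: ennreal_plus)
  finally show ?thesis .
qed

lemma entropy_dissipation_iterated:
  assumes w: "has_weak_gradient f (weak_gradient f)" and f: "\<And>v. 0 \<le> f v"
  defines "b \<equiv> \<lambda>v. (1 / f v) *\<^sub>R weak_gradient f v"
  shows "(\<integral>\<^sup>+v. ennreal (f v) * (\<integral>\<^sup>+w. ennreal (f w * landau_form (v - w) (b v - b w)) \<partial>lborel) \<partial>lborel)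
    = 2 * entropy_dissipation f"
proof -
  let ?l = "\<lambda>v w. f w * landau_form (v - w) (b v - b w)"
  note li = has_weak_gradient_locally_integrable[OF w]
  have [measurable]: "f \<in> borel_measurable borel" "weak_gradient f \<in> borel_measurable borel"
    using li by (auto intro: locally_integrable_measurable)
  have [measurable]: "b \<in> borel_measurable borel" unfolding b_def by measurable
  define J where "J = (\<lambda>(v, w). ennreal (f v) * ennreal (?l v w))"
  have [measurable]: "J \<in> borel_measurable (lborel \<Otimes>\<^sub>M lborel)"
    unfolding J_def landau_form_eq by measurable
  have "entropy_dissipation f = (\<integral>\<^sup>+p. ennreal (1/2) * J p \<partial>(lborel \<Otimes>\<^sub>M lborel))"
    unfolding entropy_dissipation_def
  proof (rule nn_integral_cong)
    have half: "(0::real) \<le> 1 / 2" by simp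
    fix p :: "(real^3) \<times> (real^3)"
    obtain v w where p: "p = (v, w)" by (cases p)
    have "(\<Sum>i\<in>UNIV. \<Sum>j\<in>UNIV. landau_kernel (v - w) i j
          * (weak_gradient f v $ i / f v - weak_gradient f w $ i / f w)
          * (weak_gradient f v $ j / f v - weak_gradient f w $ j / f w) * f v * f w)
      = f v * (?l v w)"
      unfolding landau_form_def sum_distrib_left by (intro sum.cong) (auto simp: b_def mult_ac)
    then show "(case p of (v, w) \<Rightarrow> ennreal (1/2 * (\<Sum>i\<in>UNIV. \<Sum>j\<in>UNIV. landau_kernel (v - w) i j
          * (weak_gradient f v $ i / f v - weak_gradient f w $ i / f w)
          * (weak_gradient f v $ j / f v - weak_gradient f w $ j / f w) * f v * f w))) = ennreal (1/2) * J p"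
      by (simp only: p J_def prod.case ennreal_mult'[OF half] ennreal_mult'[OF f])
  qed
  also have "\<dots> = ennreal (1/2) * (\<integral>\<^sup>+p. J p \<partial>(lborel \<Otimes>\<^sub>M lborel))" by (rule nn_integral_cmult) measurable
  also have "(\<integral>\<^sup>+p. J p \<partial>(lborel \<Otimes>\<^sub>M lborel)) = (\<integral>\<^sup>+v. \<integral>\<^sup>+w. J (v, w) \<partial>lborel \<partial>lborel)"
    by (rule lborel.nn_integral_fst[symmetric]) measurable
  also have "\<dots> = (\<integral>\<^sup>+v. ennreal (f v) * (\<integral>\<^sup>+w. ennreal (?l v w) \<partial>lborel) \<partial>lborel)"
    unfolding J_def prod.case
    by (intro nn_integral_cong nn_integral_cmult) (unfold landau_form_eq, measurable)
  finally have eq: "entropy_dissipation f = ennreal (1/2) *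
     (\<integral>\<^sup>+v. ennreal (f v) * (\<integral>\<^sup>+w. ennreal (?l v w) \<partial>lborel) \<partial>lborel)" .
  have "(2::ennreal) * ennreal (1/2) = ennreal (2 * (1/2))" by (subst ennreal_mult) auto
  then show ?thesis unfolding eq by (simp add: mult.assoc[symmetric])
qed

lemma bilinear_second_moment:
  fixes f :: "real^3 \<Rightarrow> real"
  assumes f: "\<And>v. 0 \<le> f v" "f \<in> borel_measurable borel" "integrable lborel (\<lambda>v. f v * (norm v)\<^sup>2)"
  shows "integrable lborel (\<lambda>w. f w * ((w \<bullet> x) * (w \<bullet> y)))"
    "bilinear (\<lambda>x y. LINT w|lborel. f w * ((w \<bullet> x) * (w \<bullet> y)))"
proof -
  note [measurable] = f(2)
  show i: "integrable lborel (\<lambda>w. f w * ((w \<bullet> x) * (w \<bullet> y)))" for x y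
  proof (rule Bochner_Integration.integrable_bound[OF integrable_mult_right[OF f(3), of "norm x * norm y"]])
    show "AE w in lborel. norm (f w * ((w \<bullet> x) * (w \<bullet> y))) \<le> norm (norm x * norm y * (f w * (norm w)\<^sup>2))"
    proof (rule AE_I2)
      fix w
      have "\<bar>w \<bullet> x\<bar> * \<bar>w \<bullet> y\<bar> \<le> (norm w * norm x) * (norm w * norm y)"
        by (intro mult_mono Cauchy_Schwarz_ineq2) auto
      from mult_left_mono[OF this f(1)[of w]]
      show "norm (f w * ((w \<bullet> x) * (w \<bullet> y))) \<le> norm (norm x * norm y * (f w * (norm w)\<^sup>2))"
        using f(1)[of w] by (simp add: abs_mult power2_eq_square mult_ac)
    qed
  qed measurable
  show "bilinear (\<lambda>x y. LINT w|lborel. f w * ((w \<bullet> x) * (w \<bullet> y)))"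
    unfolding bilinear_def
  proof (intro conjI allI linearI)
    fix x y b1 b2 :: "real^3" and r :: real
    show "(LINT w|lborel. f w * ((w \<bullet> x) * (w \<bullet> (b1 + b2)))) = (LINT w|lborel. f w * ((w \<bullet> x) * (w \<bullet> b1))) + (LINT w|lborel. f w * ((w \<bullet> x) * (w \<bullet> b2)))"
      by (subst Bochner_Integration.integral_add[OF i i, symmetric]) (simp add: inner_simps algebra_simps)
    show "(LINT w|lborel. f w * ((w \<bullet> (b1 + b2)) * (w \<bullet> y))) = (LINT w|lborel. f w * ((w \<bullet> b1) * (w \<bullet> y))) + (LINT w|lborel. f w * ((w \<bullet> b2) * (w \<bullet> y)))"
      by (subst Bochner_Integration.integral_add[OF i i, symmetric]) (simp add: inner_simps algebra_simps)
    show "(LINT w|lborel. f w * ((w \<bullet> x) * (w \<bullet> (r *\<^sub>R b1)))) = r *\<^sub>R (LINT w|lborel. f w * ((w \<bullet> x) * (w \<bullet> b1)))"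
      "(LINT w|lborel. f w * ((w \<bullet> (r *\<^sub>R b1)) * (w \<bullet> y))) = r *\<^sub>R (LINT w|lborel. f w * ((w \<bullet> b1) * (w \<bullet> y)))"
      by (simp_all add: mult.left_commute mult.assoc)
  qed
qed

lemma jbracket_powr_neg_cancel: "jbracket v powr (-3) * (jbracket v)^3 = 1"
proof -
  have j: "jbracket v > 0" using jbracket_facts(1)[of v] by simp
  then have "(jbracket v)^3 = jbracket v powr 3" using powr_realpow[of "jbracket v" 3] by simp
  then have "jbracket v powr (-3) * (jbracket v)^3 = jbracket v powr (-3 + 3)" by (simp only: powr_add)
  also have "\<dots> = 1" using j by simp
  finally show ?thesis .
qed

text \<open>
  The hypothesis is the squared norm of (t - s) (v.e), written as t U - s U', against the bounds X for U and U'.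
\<close>

lemma temperature_deviation_bound:
  fixes T A X :: real
  assumes "c > 0" "X \<ge> 0" "0 \<le> s" "s \<le> 3" "0 \<le> t" "t \<le> 3" "c \<le> A"
    and "(t - s)\<^sup>2 * A \<le> 2 * t\<^sup>2 * X + 2 * s\<^sup>2 * X"
  shows "(t - s)\<^sup>2 \<le> 36 * X / c"
proof -
  have "t\<^sup>2 \<le> 3\<^sup>2" "s\<^sup>2 \<le> 3\<^sup>2" using power_mono[of t 3 2] power_mono[of s 3 2] assms by simp_all
  then have "t\<^sup>2 * X \<le> 9 * X" "s\<^sup>2 * X \<le> 9 * X" using assms(2) by (auto intro!: mult_right_mono)
  moreover have "(t - s)\<^sup>2 * c \<le> (t - s)\<^sup>2 * A" using assms by (intro mult_left_mono) auto
  ultimately have "(t - s)\<^sup>2 * c \<le> 36 * X" using assms(8) by linarith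
  then show ?thesis using assms(1) by (simp add: le_divide_eq)
qed

text \<open>
  T i is the temperature along the axis e i, A i the weighted integral of f (v . e i)^2, and U i j = T i (b . e j) + v . e j
  the function whose weighted square integral is at most X = 16 M_5(f) D(f) for i distinct from j.
\<close>

theorem weighted_Fisher_information_bound:
  "\<exists>C>0. \<forall>f. admissible Hbar f \<longrightarrow> moment 5 f < \<infinity> \<longrightarrow> entropy_dissipation f < \<infinity> \<longrightarrow>
     has_weak_gradient f (weak_gradient f) \<and>
     (\<integral>\<^sup>+v. ennreal (f v * jbracket v powr (-3) * (norm ((1 / f v) *\<^sub>R weak_gradient f v + v))\<^sup>2) \<partial>lborel)
       \<le> ennreal C * moment 5 f * entropy_dissipation f"
proof -
  obtain c where c: "c > 0" and spread: "\<And>f e. admissible Hbar f \<Longrightarrow> norm e = 1 \<Longrightarrow>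
      c \<le> (LINT v|lborel. f v * ((v \<bullet> e)\<^sup>2 * jbracket v powr (-3)))"
    using directional_spread_lower_bound[of Hbar] by blast
  define C where "C = 48 * (2 + 96 / c) / c\<^sup>2"
  have C: "C > 0" using c by (simp add: C_def add_pos_pos)
  show ?thesis
  proof (intro exI[of _ C] conjI allI impI C)
    fix f assume adm: "admissible Hbar f" and M5: "moment 5 f < \<infinity>" and D: "entropy_dissipation f < \<infinity>"
    have f: "\<And>v. 0 \<le> f v" "integrable lborel f" "(LINT v|lborel. f v) = 1"
      "integrable lborel (\<lambda>v. f v * (norm v)\<^sup>2)" "(LINT v|lborel. f v * (norm v)\<^sup>2) = 3"
      "has_bochner_integral lborel f 1" "has_bochner_integral lborel (\<lambda>v. f v *\<^sub>R v) 0"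
      using adm by (auto simp: admissible_def has_bochner_integral_iff)
    show w: "has_weak_gradient f (weak_gradient f)"
    proof -
      obtain g where "has_weak_gradient f g" using adm by (auto simp: admissible_def weakly_differentiable_def)
      then show ?thesis unfolding weak_gradient_def by (rule someI[of "has_weak_gradient f" g])
    qed
    have [measurable]: "f \<in> borel_measurable borel" "weak_gradient f \<in> borel_measurable borel"
      using has_weak_gradient_locally_integrable[OF w] by (auto intro: locally_integrable_measurable)
    define b where "b v = (1 / f v) *\<^sub>R weak_gradient f v" for v
    have [measurable]: "b \<in> borel_measurable borel" unfolding b_def[abs_def] by measurable
    define \<rho> where "\<rho> v = f v * jbracket v powr (-3)" for v
    have [measurable]: "\<rho> \<in> borel_measurable borel" unfolding \<rho>_def[abs_def] by measurable
    have \<rho>: "0 \<le> \<rho> v" for v using f(1) by (simp add: \<rho>_def)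
    define P where "P x y = (LINT w|lborel. f w * ((w \<bullet> x) * (w \<bullet> y)))" for x y
    note P = bilinear_second_moment[OF f(1) _ f(4)]
    have bP: "bilinear P" unfolding P_def[abs_def] by (rule P(2)) measurable
    have symP: "P x y = P y x" for x y by (simp add: P_def mult.commute)
    obtain e :: "nat \<Rightarrow> real^3" where e: "\<And>i. i < 3 \<Longrightarrow> norm (e i) = 1" "\<And>i j. i < 3 \<Longrightarrow> j < 3 \<Longrightarrow> i \<noteq> j \<Longrightarrow> e i \<bullet> e j = 0"
      "\<And>i j. i < 3 \<Longrightarrow> j < 3 \<Longrightarrow> i \<noteq> j \<Longrightarrow> P (e i) (e j) = 0"
      "\<And>x. x \<bullet> x = (x \<bullet> e 0)\<^sup>2 + (x \<bullet> e 1)\<^sup>2 + (x \<bullet> e 2)\<^sup>2"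
      using orthonormal_eigenbasis[OF bP symP] by blast
    define T where "T i = (LINT w|lborel. f w * (w \<bullet> e i)\<^sup>2)" for i
    define A where "A i = (LINT v|lborel. \<rho> v * (v \<bullet> e i)\<^sup>2)" for i
    have iT: "integrable lborel (\<lambda>w. f w * (w \<bullet> e i)\<^sup>2)" for i
      using P(1)[of "e i" "e i"] by (simp add: power2_eq_square)
    have iA: "integrable lborel (\<lambda>v. \<rho> v * (v \<bullet> e i)\<^sup>2)" for i
    proof (rule Bochner_Integration.integrable_bound[OF iT[of i]])
      show "AE v in lborel. norm (\<rho> v * (v \<bullet> e i)\<^sup>2) \<le> norm (f v * (v \<bullet> e i)\<^sup>2)"
        using f(1) jbracket_powr_neg_bounds by (auto intro!: AE_I2 mult_right_mono mult_left_le simp: \<rho>_def abs_mult)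
    qed measurable
    have Ac: "c \<le> A i" if "i < 3" for i
      using spread[OF adm e(1)[OF that]] by (simp add: A_def \<rho>_def mult_ac)
    have AT: "A i \<le> T i" for i unfolding A_def T_def
      using f(1) jbracket_powr_neg_bounds
      by (intro integral_mono iA iT) (auto intro!: mult_right_mono mult_left_le simp: \<rho>_def)
    have sumT: "T 0 + T 1 + T 2 = 3"
    proof -
      have "3 = (LINT v|lborel. f v * (v \<bullet> e 0)\<^sup>2 + f v * (v \<bullet> e 1)\<^sup>2 + f v * (v \<bullet> e 2)\<^sup>2)"
        unfolding f(5)[symmetric] power2_norm_eq_inner e(4) by (simp add: distrib_left)
      then show ?thesis using iT by (simp add: T_def)
    qed
    have Tc: "c \<le> T i" if "i < 3" for i using Ac[OF that] AT[of i] by linarith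
    have Tnn: "0 \<le> T i" for i unfolding T_def using f(1) by simp
    have T3: "T i \<le> 3" if "i < 3" for i
    proof -
      have "i = 0 \<or> i = 1 \<or> i = 2" using that by auto
      then show ?thesis using sumT Tnn[of 0] Tnn[of 1] Tnn[of 2] by auto
    qed
    have nnA: "(\<integral>\<^sup>+v. ennreal (\<rho> v * (v \<bullet> e i)\<^sup>2) \<partial>lborel) = ennreal (A i)" for i
      unfolding A_def using \<rho> by (intro nn_integral_eq_integral iA) auto
    define X where "X = 16 * enn2real (moment 5 f) * enn2real (entropy_dissipation f)"
    have X0: "X \<ge> 0" by (simp add: X_def)
    have XE: "ennreal X = 16 * moment 5 f * entropy_dissipation f"
      using M5 D by (simp add: X_def ennreal_mult less_top)
    define U where "U i j v = T i * (b v \<bullet> e j) + v \<bullet> e j" for i j v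
    have [measurable]: "U i j \<in> borel_measurable borel" for i j unfolding U_def[abs_def] by measurable
    have EU: "(\<integral>\<^sup>+v. ennreal (\<rho> v * (U i j v)\<^sup>2) \<partial>lborel) \<le> ennreal X" if "i < 3" "j < 3" "i \<noteq> j" for i j
    proof -
      define B where "B v = (\<integral>\<^sup>+w. ennreal (f w * landau_form (v - w) (b v - b w)) \<partial>lborel)" for v
      have [measurable]: "B \<in> borel_measurable borel"
        unfolding B_def[abs_def] landau_form_eq by measurable
      have "(\<integral>\<^sup>+v. ennreal (\<rho> v * (U i j v)\<^sup>2) \<partial>lborel) \<le> (\<integral>\<^sup>+v. (8 * moment 5 f) * (ennreal (f v) * B v) \<partial>lborel)"
      proof (rule nn_integral_mono)
        fix v
        have "ennreal ((U i j v)\<^sup>2) \<le> ennreal (8 * (jbracket v)^3) * moment 5 f * B v"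
          unfolding U_def T_def B_def b_def
          by (rule pointwise_Landau_bound[OF w f(1) f(6,7) f(4) e(1,1,2)]) (use that e(3)[OF that] in \<open>auto simp: P_def\<close>)
        then have "ennreal (\<rho> v) * ennreal ((U i j v)\<^sup>2) \<le> ennreal (\<rho> v) * (ennreal (8 * (jbracket v)^3) * moment 5 f * B v)"
          by (rule mult_left_mono) simp
        also have "\<dots> = ennreal (\<rho> v * (8 * (jbracket v)^3)) * (moment 5 f * B v)"
          using \<rho>[of v] jbracket_facts(1)[of v] by (simp add: ennreal_mult mult_ac)
        also have "\<rho> v * (8 * (jbracket v)^3) = 8 * f v"
          using jbracket_powr_neg_cancel[of v] by (simp add: \<rho>_def mult_ac)
        also have "ennreal (8 * f v) * (moment 5 f * B v) = (8 * moment 5 f) * (ennreal (f v) * B v)"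
          using f(1)[of v] by (simp add: ennreal_mult mult_ac)
        finally show "ennreal (\<rho> v * (U i j v)\<^sup>2) \<le> (8 * moment 5 f) * (ennreal (f v) * B v)"
          using \<rho>[of v] by (simp add: ennreal_mult)
      qed
      also have "\<dots> = (8 * moment 5 f) * (\<integral>\<^sup>+v. ennreal (f v) * B v \<partial>lborel)" by (rule nn_integral_cmult) measurable
      also have "(\<integral>\<^sup>+v. ennreal (f v) * B v \<partial>lborel) = 2 * entropy_dissipation f"
        unfolding B_def b_def by (rule entropy_dissipation_iterated[OF w f(1)])
      also have "(8 * moment 5 f) * (2 * entropy_dissipation f) = (8 * 2) * (moment 5 f * entropy_dissipation f)"
        by (simp only: mult_ac)
      also have "(8 * 2 :: ennreal) = 16" by simp
      finally show ?thesis by (simp add: XE mult.assoc)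
    qed
    \<comment> \<open>T k U i j - T i U k j = (T k - T i) (v . e j): the unknown b drops out.\<close>
    have Tdiff: "(T k - T i)\<^sup>2 \<le> 36 * X / c" if "i < 3" "j < 3" "k < 3" "i \<noteq> j" "k \<noteq> j" for i j k
    proof (rule temperature_deviation_bound[OF c X0 Tnn T3[OF that(1)] Tnn T3[OF that(3)] Ac[OF that(2)]])
      have "(\<integral>\<^sup>+v. ennreal (\<rho> v * (T k * U i j v + (- T i) * U k j v)\<^sup>2) \<partial>lborel) \<le> ennreal (2 * (T k)\<^sup>2 * X + 2 * (- T i)\<^sup>2 * X)"
        using that by (intro nn_integral_square_combination \<rho> EU X0) auto
      also have "(\<lambda>v. T k * U i j v + (- T i) * U k j v) = (\<lambda>v. (T k - T i) * (v \<bullet> e j))"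
        by (simp add: fun_eq_iff U_def algebra_simps)
      then have "(\<integral>\<^sup>+v. ennreal (\<rho> v * (T k * U i j v + (- T i) * U k j v)\<^sup>2) \<partial>lborel)
         = (\<integral>\<^sup>+v. ennreal ((T k - T i)\<^sup>2) * ennreal (\<rho> v * (v \<bullet> e j)\<^sup>2) \<partial>lborel)"
        using \<rho> by (simp add: fun_eq_iff power_mult_distrib ennreal_mult[symmetric] mult_ac)
      also have "\<dots> = ennreal ((T k - T i)\<^sup>2 * A j)"
        using Ac[OF that(2)] c by (subst nn_integral_cmult) (auto simp: nnA ennreal_mult)
      finally have "ennreal ((T k - T i)\<^sup>2 * A j) \<le> ennreal (2 * (T k)\<^sup>2 * X + 2 * (- T i)\<^sup>2 * X)" .
      moreover have "0 \<le> 2 * (T k)\<^sup>2 * X + 2 * (- T i)\<^sup>2 * X" using X0 by simp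
      ultimately show "(T k - T i)\<^sup>2 * A j \<le> 2 * (T k)\<^sup>2 * X + 2 * (T i)\<^sup>2 * X"
        by (simp add: ennreal_le_iff)
    qed
    have Tdiff': "(T k - T i)\<^sup>2 \<le> 36 * X / c" if "i < 3" "k < 3" for i k
    proof -
      have "\<exists>j<3. i \<noteq> j \<and> k \<noteq> j"
        using that by presburger
      then show ?thesis using Tdiff that by blast
    qed
    \<comment> \<open>The temperatures sum to 3, so 3 (T i - 1) is the sum of the two differences to the others.\<close>
    have T1: "(T i - 1)\<^sup>2 \<le> 16 * X / c" if i: "i < 3" for i
    proof -
      have sq: "(x + y)\<^sup>2 \<le> 2 * x\<^sup>2 + 2 * y\<^sup>2" for x y :: real
        using zero_le_power2[of "x - y"] by (simp add: power2_sum power2_diff)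
      have "9 * (T i - 1)\<^sup>2 \<le> 144 * X / c"
      proof -
        obtain k l where kl: "k < 3" "l < 3" "T i + T k + T l = 3"
        proof -
          have "i = 0 \<or> i = 1 \<or> i = 2" using i by auto
          then have "(\<exists>k<3. \<exists>l<3. T i + T k + T l = 3)"
          proof (elim disjE)
            assume "i = 0" then show ?thesis
              using sumT by (intro exI[of _ 1] exI[of _ 2] conjI) auto
          next
            assume "i = 1" then show ?thesis
              using sumT by (intro exI[of _ 0] exI[of _ 2] conjI) auto
          next
            assume "i = 2" then show ?thesis
              using sumT by (intro exI[of _ 0] exI[of _ 1] conjI) auto
          qed
          then show ?thesis using that by blast
        qed
        have "9 * (T i - 1)\<^sup>2 = (3 * (T i - 1))\<^sup>2" unfolding power_mult_distrib by simp
        also have "3 * (T i - 1) = (T i - T k) + (T i - T l)" using kl(3) by simp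
        also have "\<dots>\<^sup>2 \<le> 2 * (T i - T k)\<^sup>2 + 2 * (T i - T l)\<^sup>2" by (rule sq)
        also have "\<dots> \<le> 2 * (36 * X / c) + 2 * (36 * X / c)"
          using Tdiff'[OF kl(1) i] Tdiff'[OF kl(2) i] by linarith
        finally show ?thesis by simp
      qed
      then show ?thesis by simp
    qed
    define Y where "Y = (2 + 96 / c) / c\<^sup>2 * X"
    have Y0: "Y \<ge> 0" using X0 c by (simp add: Y_def)
    have EB: "(\<integral>\<^sup>+v. ennreal (\<rho> v * ((b v + v) \<bullet> e j)\<^sup>2) \<partial>lborel) \<le> ennreal Y" if j: "j < 3" for j
    proof -
      have "\<exists>i<3. i \<noteq> j" by presburger
      then obtain i where i: "i < 3" "i \<noteq> j" by blast
      have Ti: "T i > 0" using Tc[OF i(1)] c by linarith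
      \<comment> \<open>Any axis i other than j serves.\<close>
      have "(b v + v) \<bullet> e j = (1 / T i) * U i j v + (1 - 1 / T i) * (v \<bullet> e j)" for v
        using Ti by (simp add: U_def inner_simps field_simps)
      then have "(\<integral>\<^sup>+v. ennreal (\<rho> v * ((b v + v) \<bullet> e j)\<^sup>2) \<partial>lborel) =
          (\<integral>\<^sup>+v. ennreal (\<rho> v * ((1 / T i) * U i j v + (1 - 1 / T i) * (v \<bullet> e j))\<^sup>2) \<partial>lborel)"
        by simp
      also have "\<dots> \<le> ennreal (2 * (1 / T i)\<^sup>2 * X + 2 * (1 - 1 / T i)\<^sup>2 * A j)"
        using i j Ac[OF j] c by (intro nn_integral_square_combination \<rho> EU X0) (auto simp: nnA)
      also have "\<dots> \<le> ennreal Y"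
      proof (rule ennreal_leI)
        have inv: "(1 / T i)\<^sup>2 \<le> 1 / c\<^sup>2"
          using Tc[OF i(1)] c by (simp add: power_divide frac_le power_mono)
        have "(1 - 1 / T i)\<^sup>2 = (T i - 1)\<^sup>2 * (1 / T i)\<^sup>2" using Ti by (simp add: field_simps power2_eq_square)
        also have "\<dots> \<le> (16 * X / c) * (1 / c\<^sup>2)" using X0 c by (intro mult_mono T1[OF i(1)] inv) auto
        finally have "(1 - 1 / T i)\<^sup>2 * A j \<le> (16 * X / c) * (1 / c\<^sup>2) * 3"
          using AT[of j] T3[OF j] Ac[OF j] c X0 by (intro mult_mono) auto
        moreover have "(1 / T i)\<^sup>2 * X \<le> 1 / c\<^sup>2 * X" by (rule mult_right_mono[OF inv X0])
        ultimately have "2 * (1 / T i)\<^sup>2 * X + 2 * (1 - 1 / T i)\<^sup>2 * A j \<le> 2 * (1 / c\<^sup>2 * X) + 2 * ((16 * X / c) * (1 / c\<^sup>2) * 3)"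
          by linarith
        also have "\<dots> = Y" using c by (simp add: Y_def field_simps)
        finally show "2 * (1 / T i)\<^sup>2 * X + 2 * (1 - 1 / T i)\<^sup>2 * A j \<le> Y" .
      qed
      finally show ?thesis .
    qed
    have "(\<integral>\<^sup>+v. ennreal (\<rho> v * (norm (b v + v))\<^sup>2) \<partial>lborel) =
       (\<integral>\<^sup>+v. ennreal (\<rho> v * ((b v + v) \<bullet> e 0)\<^sup>2) + ennreal (\<rho> v * ((b v + v) \<bullet> e 1)\<^sup>2) + ennreal (\<rho> v * ((b v + v) \<bullet> e 2)\<^sup>2) \<partial>lborel)"
      unfolding power2_norm_eq_inner e(4)
      using \<rho> by (intro nn_integral_cong) (simp add: ennreal_plus[symmetric] distrib_left del: ennreal_plus)
    also have "\<dots> = (\<integral>\<^sup>+v. ennreal (\<rho> v * ((b v + v) \<bullet> e 0)\<^sup>2) \<partial>lborel) + (\<integral>\<^sup>+v. ennreal (\<rho> v * ((b v + v) \<bullet> e 1)\<^sup>2) \<partial>lborel)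
        + (\<integral>\<^sup>+v. ennreal (\<rho> v * ((b v + v) \<bullet> e 2)\<^sup>2) \<partial>lborel)"
      by (simp add: nn_integral_add)
    also have "\<dots> \<le> ennreal Y + ennreal Y + ennreal Y" by (intro add_mono EB) auto
    also have "\<dots> = ennreal (3 * Y)" using Y0 by (simp add: ennreal_plus[symmetric] del: ennreal_plus)
    also have "3 * Y = C * (enn2real (moment 5 f) * enn2real (entropy_dissipation f))"
      by (simp add: Y_def X_def C_def)
    also have "ennreal \<dots> = ennreal C * moment 5 f * entropy_dissipation f"
      using M5 D C by (simp add: ennreal_mult less_top mult.assoc)
    finally show "(\<integral>\<^sup>+v. ennreal (f v * jbracket v powr (-3) * (norm ((1 / f v) *\<^sub>R weak_gradient f v + v))\<^sup>2) \<partial>lborel)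
       \<le> ennreal C * moment 5 f * entropy_dissipation f"
      by (simp add: \<rho>_def b_def)
  qed
qed

section \<open>Weighted relative entropy\<close>

text \<open>
  Tangent of the convex function s^(-3/2) at s = 4, the mean value of 1 + |v|^2: with y = <v> the claim is
  3 y^5 - 20 y^3 + 64 >= 0, and y = 2 is a double root.
\<close>

lemma jbracket_powr_neg_tangent: "1/8 - 3/64 * ((norm v)\<^sup>2 - 3) \<le> jbracket v powr (-3)"
proof -
  define y where "y = jbracket v"
  have y: "y \<ge> 1" "y\<^sup>2 = 1 + (norm v)\<^sup>2" using jbracket_facts by (auto simp: y_def)
  have eq: "jbracket v powr (-3) * y^3 = 1" unfolding y_def by (rule jbracket_powr_neg_cancel)
  have "0 \<le> (y - 2)\<^sup>2 * (3 * y^3 + 12 * y\<^sup>2 + 16 * y + 16)" using y by (intro mult_nonneg_nonneg) auto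
  also have "\<dots> = 64 - (20 - 3 * y\<^sup>2) * y^3" by (simp add: power2_eq_square power3_eq_cube algebra_simps)
  finally have "(5/16 - 3/64 * y\<^sup>2) * y^3 \<le> jbracket v powr (-3) * y^3" using eq by (simp add: algebra_simps)
  then have "5/16 - 3/64 * y\<^sup>2 \<le> jbracket v powr (-3)" using y(1) by (simp add: mult_le_cancel_right)
  then show ?thesis unfolding y(2) by (simp add: field_simps)
qed

lemma GDERIV_exp_half_norm_sq:
  "GDERIV (\<lambda>v. exp ((norm v)\<^sup>2 / 2)) v :> exp ((norm v)\<^sup>2 / 2) *\<^sub>R v"
proof -
  have "((\<lambda>s. exp (s / 2)) has_real_derivative exp ((norm v)\<^sup>2 / 2) * (1/2)) (at ((norm v)\<^sup>2))"
    by (auto intro!: derivative_eq_intros)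
  from GDERIV_DERIV_compose[OF GDERIV_norm_sq this] show ?thesis by simp
qed

lemma maxwellian_pos: "maxwellian v > 0" by (simp add: maxwellian_def)

lemma ln_maxwellian: "ln (maxwellian v) = - (3/2 * ln (2 * pi)) - (norm v)\<^sup>2 / 2"
  by (simp add: maxwellian_def ln_mult ln_powr)

definition weighted_mass :: "(real^3 \<Rightarrow> real) \<Rightarrow> real" where
  "weighted_mass f = (LINT v|lborel. jbracket v powr (-3) * f v)"

definition weighted_relative_entropy :: "(real^3 \<Rightarrow> real) \<Rightarrow> real" where
  "weighted_relative_entropy f =
     (LINT v|lborel. (f v * ln (weighted_mass maxwellian / weighted_mass f * (f v / maxwellian v))
        + weighted_mass f / weighted_mass maxwellian * maxwellian v - f v) * jbracket v powr (-3))"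

definition truncated_relative_entropy :: "real \<Rightarrow> real \<Rightarrow> (real^3 \<Rightarrow> real) \<Rightarrow> real" where
  "truncated_relative_entropy C R f = (LINT v|lborel. f v * ln (f v / maxwellian v))
     - (LINT v:{v. jbracket v \<ge> R}|lborel. f v * ln (f v))
     - C * (LINT v:{v. jbracket v \<ge> R}|lborel. (jbracket v)\<^sup>2 * f v)
     - C * (LINT v:{v. jbracket v \<ge> R}|lborel. maxwellian v)"

text \<open>
  The first summand serves the Maxwellian part of the tail, the others the part with <v>^2 f: ln f - ln mu
  contributes |v|^2/2 and (3/2) ln(2 pi), and ln(Z_1/Z_2) <= ln 8.
\<close>

definition tail_constant :: real where
  "tail_constant = 1 / weighted_mass maxwellian + 1 / 2 + 3 / 2 * ln (2 * pi) + ln 8"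

lemma integrable_weighted:
  fixes u :: "real^3 \<Rightarrow> real"
  assumes u: "integrable lborel u"
  shows "integrable lborel (\<lambda>v. jbracket v powr (-3) * u v)"
proof (rule Bochner_Integration.integrable_bound[OF u])
  show "(\<lambda>v. jbracket v powr (-3) * u v) \<in> borel_measurable lborel" using u by measurable
  show "AE v in lborel. norm (jbracket v powr (-3) * u v) \<le> norm (u v)"
    by (rule AE_I2)
      (use jbracket_powr_neg_bounds in \<open>auto simp: abs_mult less_imp_le intro!: mult_left_le_one_le\<close>)
qed

lemma integrable_maxwellian: "integrable lborel maxwellian"
  using maxwellian_integral by (simp add: has_bochner_integral_iff)

lemma weighted_mass_maxwellian: "0 < weighted_mass maxwellian" "weighted_mass maxwellian \<le> 1"
proof -
  note i = integrable_maxwellian and j = integrable_weighted[OF integrable_maxwellian]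
  have pos: "0 < jbracket v powr (-3) * maxwellian v" for v
    using jbracket_powr_neg_bounds maxwellian_pos by simp
  have "weighted_mass maxwellian \<le> (LINT v|lborel. maxwellian v)" unfolding weighted_mass_def
    by (intro integral_mono i j)
      (use jbracket_powr_neg_bounds maxwellian_pos in \<open>auto intro!: mult_left_le_one_le simp: less_imp_le\<close>)
  then show "weighted_mass maxwellian \<le> 1"
    using maxwellian_integral by (simp add: has_bochner_integral_iff)
  have "weighted_mass maxwellian \<noteq> 0"
  proof
    assume "weighted_mass maxwellian = 0"
    then have "AE v in lborel. jbracket v powr (-3) * maxwellian v = 0"
      unfolding weighted_mass_def
      using pos by (subst (asm) integral_nonneg_eq_0_iff_AE[OF j]) (auto simp: less_imp_le)
    then have "AE v::real^3 in lborel. False"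
      by eventually_elim (use pos in \<open>metis less_irrefl\<close>)
    then show False by (simp add: eventually_False ae_filter_eq_bot_iff)
  qed
  moreover have "weighted_mass maxwellian \<ge> 0"
    unfolding weighted_mass_def using pos by (simp add: less_imp_le)
  ultimately show "0 < weighted_mass maxwellian" by simp
qed

text \<open>
  The logarithmic Sobolev inequality for h = f exp(|v|^2/2) and V = |v|^2/2 + (3/2) ln(1 + |v|^2), whose
  Fisher information is that of f.  The constant (2 pi)^(3/2) by which exp(-V) differs from <v>^(-3) mu occurs both in ln h - ln (f / mu)
  and in the logarithm of the mass of exp(-V), and cancels.  With c = 5/8 the factor 1 / (2 c) is 4/5.
\<close>

lemma weighted_log_Sobolev:
  assumes w: "has_weak_gradient f g" and f: "\<And>v. 0 \<le> f v" "integrable lborel f"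
    "integrable lborel (\<lambda>v. f v * (norm v)\<^sup>2)" "integrable lborel (\<lambda>v. f v * ln (f v))"
    and I: "(\<integral>\<^sup>+v. ennreal (f v * jbracket v powr (-3) * (norm ((1 / f v) *\<^sub>R g v + v))\<^sup>2) \<partial>lborel) \<le> ennreal I" "I \<ge> 0"
    and mass: "weighted_mass f > 0"
  shows "weighted_relative_entropy f \<le> 4 / 5 * I"
proof -
  define Z1 where "Z1 = weighted_mass maxwellian"
  define Z2 where "Z2 = weighted_mass f"
  have Z1: "Z1 > 0" and Z2: "Z2 > 0" using weighted_mass_maxwellian mass by (simp_all add: Z1_def Z2_def)
  define \<omega> where "\<omega> v = jbracket v powr (-3)" for v
  have weight: "integrable lborel (\<lambda>v. \<omega> v * u v)" if "integrable lborel u" for u :: "real^3 \<Rightarrow> real"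
    unfolding \<omega>_def by (rule integrable_weighted[OF that])
  define E where "E v = exp ((norm v)\<^sup>2 / 2)" for v :: "real^3"
  define h where "h v = E v * f v" for v
  define k where "k v = E v *\<^sub>R g v + f v *\<^sub>R (E v *\<^sub>R v)" for v
  have E: "E v > 0" for v by (simp add: E_def)
  have invE: "exp (- (norm v)\<^sup>2 / 2) = inverse (E v)" for v :: "real^3"
    unfolding E_def exp_minus[symmetric] by simp
  have expV: "exp (- weighted_potential v) = \<omega> v / E v" for v
    unfolding exp_weighted_potential invE by (simp add: \<omega>_def divide_inverse)
  have wh: "has_weak_gradient h k"
    unfolding h_def[abs_def] k_def[abs_def] E_def[abs_def]
    by (rule has_weak_gradient_mult[OF w GDERIV_exp_half_norm_sq]) (auto intro!: continuous_intros)
  define \<kappa> where "\<kappa> = (2 * pi) powr (3/2)"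
  have \<kappa>: "\<kappa> > 0" "ln \<kappa> = 3/2 * ln (2 * pi)" by (auto simp: \<kappa>_def ln_powr)
  have invk: "(2 * pi) powr (-3/2) = inverse \<kappa>"
    unfolding \<kappa>_def powr_minus[symmetric] by simp
  have \<mu>: "maxwellian v = 1 / (\<kappa> * E v)" for v
    unfolding maxwellian_def invE invk by (simp only: inverse_eq_divide times_divide_times_eq mult_1)
  have eG: "exp (- weighted_potential v) = \<kappa> * (jbracket v powr (-3) * maxwellian v)" for v
    using \<kappa> E[of v] by (simp add: expV \<mu> \<omega>_def)
  have eZ: "h v * exp (- weighted_potential v) = jbracket v powr (-3) * f v" for v
    using E[of v] by (simp add: h_def expV \<omega>_def)
  have eE: "h v * ln (h v) * exp (- weighted_potential v) = \<omega> v * (f v * ln (f v) + f v * (norm v)\<^sup>2 / 2)" for v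
  proof (cases "f v = 0")
    case False
    then have "ln (h v) = ln (f v) + (norm v)\<^sup>2 / 2" using f(1)[of v] E[of v]
      by (simp add: h_def ln_mult E_def)
    then show ?thesis using E[of v] by (simp add: h_def expV algebra_simps)
  qed (simp add: h_def)
  have eI: "(norm (k v))\<^sup>2 / h v * exp (- weighted_potential v) = f v * jbracket v powr (-3) * (norm ((1 / f v) *\<^sub>R g v + v))\<^sup>2" for v
  proof (cases "f v = 0")
    case False
    have "k v = (E v * f v) *\<^sub>R ((1 / f v) *\<^sub>R g v + v)" using False by (simp add: k_def algebra_simps)
    then have "(norm (k v))\<^sup>2 = (E v * f v)\<^sup>2 * (norm ((1 / f v) *\<^sub>R g v + v))\<^sup>2" by (simp add: power_mult_distrib)
    then show ?thesis using False E[of v] by (simp add: h_def expV \<omega>_def[symmetric] field_simps power2_eq_square)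
  qed (simp add: h_def)
  have iE: "integrable lborel (\<lambda>v. \<omega> v * (f v * ln (f v) + f v * (norm v)\<^sup>2 / 2))"
    by (intro weight Bochner_Integration.integrable_add f integrable_divide)
  have LS: "(LINT v|lborel. h v * ln (h v) * exp (- weighted_potential v))
    \<le> (LINT v|lborel. h v * exp (- weighted_potential v)) * ln (LINT v|lborel. h v * exp (- weighted_potential v))
      - (LINT v|lborel. h v * exp (- weighted_potential v)) * ln (LINT v|lborel. exp (- weighted_potential v)) + I / (2 * (5/8))"
  proof (rule log_Sobolev_weak[OF _ GDERIV_weighted_potential continuous_on_weighted_force weighted_potential_strongly_convex wh])
    show "0 \<le> h v" for v using f(1) E[of v] by (simp add: h_def less_imp_le)
    show "integrable lborel (\<lambda>v. exp (- weighted_potential v))"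
      unfolding eG by (intro integrable_mult_right integrable_weighted integrable_maxwellian)
    show "integrable lborel (\<lambda>v. h v * exp (- weighted_potential v))"
      unfolding eZ using weight[OF f(2)] by (simp add: \<omega>_def)
    show "integrable lborel (\<lambda>v. h v * ln (h v) * exp (- weighted_potential v))" unfolding eE by (rule iE)
    show "(\<integral>\<^sup>+v. ennreal ((norm (k v))\<^sup>2 / h v * exp (- weighted_potential v)) \<partial>lborel) \<le> ennreal I"
      unfolding eI by (rule I)
    show "0 < (LINT v|lborel. exp (- weighted_potential v))" unfolding eG using Z1 \<kappa> by (simp add: Z1_def weighted_mass_def)
  qed (use I in auto)
  have "(LINT v|lborel. exp (- weighted_potential v)) = \<kappa> * Z1" unfolding eG Z1_def weighted_mass_def by simp
  then have LS': "(LINT v|lborel. \<omega> v * (f v * ln (f v) + f v * (norm v)\<^sup>2 / 2)) \<le> Z2 * ln Z2 - Z2 * (ln \<kappa> + ln Z1) + 4 / 5 * I"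
    using LS Z1 \<kappa>(1) unfolding eE eZ weighted_mass_def[symmetric] Z2_def[symmetric] by (simp add: ln_mult)
  have eL: "(f v * ln (Z1 / Z2 * (f v / maxwellian v)) + Z2 / Z1 * maxwellian v - f v) * jbracket v powr (-3)
     = \<omega> v * (f v * ln (f v) + f v * (norm v)\<^sup>2 / 2) + (ln Z1 - ln Z2 + ln \<kappa> - 1) * (jbracket v powr (-3) * f v)
       + Z2 / Z1 * (jbracket v powr (-3) * maxwellian v)" for v
  proof -
    have eq: "f v * ln (Z1 / Z2 * (f v / maxwellian v)) = f v * (ln Z1 - ln Z2 + ln (f v) + ln \<kappa> + (norm v)\<^sup>2 / 2)"
    proof (cases "f v = 0")
      case False
      then have "f v > 0" using f(1)[of v] by simp
      then have "ln (Z1 / Z2 * (f v / maxwellian v)) = ln Z1 - ln Z2 + (ln (f v) - ln (maxwellian v))"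
        using Z1 Z2 maxwellian_pos[of v] by (simp add: ln_mult ln_div)
      then show ?thesis by (simp add: ln_maxwellian \<kappa>)
    qed simp
    show ?thesis unfolding eq \<omega>_def by (simp add: algebra_simps)
  qed
  have iZ: "has_bochner_integral lborel (\<lambda>v. jbracket v powr (-3) * f v) Z2"
    "has_bochner_integral lborel (\<lambda>v. jbracket v powr (-3) * maxwellian v) Z1"
    unfolding Z1_def Z2_def weighted_mass_def
    by (intro has_bochner_integral_integrable integrable_weighted integrable_maxwellian f(2))+
  have "weighted_relative_entropy f
    = (LINT v|lborel. \<omega> v * (f v * ln (f v) + f v * (norm v)\<^sup>2 / 2)) + (ln Z1 - ln Z2 + ln \<kappa> - 1) * Z2 + Z2 / Z1 * Z1"
    unfolding weighted_relative_entropy_def Z1_def[symmetric] Z2_def[symmetric] eL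
    by (intro has_bochner_integral_integral_eq has_bochner_integral_add has_bochner_integral_mult_right
        has_bochner_integral_integrable iE iZ)
  also have "\<dots> \<le> 4 / 5 * I" using LS' Z1 by (simp add: algebra_simps)
  finally show ?thesis .
qed

text \<open>
  Let psi be the integrand of the weighted relative entropy without its weight.  It is nonnegative by
  Young's inequality, so the weight may be replaced by R^(-3) on the set <v> < R and by 0 outside.  The integral of psi is the
  relative entropy of f plus r - 1 - ln r with r = Z_2/Z_1, hence at least the relative entropy,
  and on the tail psi is bounded pointwise with the tail constant.  The lower bound for Z_2 is Jensen's inequality.
\<close>

lemma weighted_relative_entropy_ge_truncated:
  assumes adm: "admissible Hbar f" and R: "R > 0"
  shows "R powr (-3) * truncated_relative_entropy tail_constant R f \<le> weighted_relative_entropy f"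
    and "1 / 8 \<le> weighted_mass f"
proof -
  define Z1 where "Z1 = weighted_mass maxwellian"
  define Z2 where "Z2 = weighted_mass f"
  define C where "C = tail_constant"
  have C_def': "C = 1 / Z1 + 1 / 2 + 3 / 2 * ln (2 * pi) + ln 8" by (simp add: C_def Z1_def tail_constant_def)
  have f: "\<And>v. 0 \<le> f v" "integrable lborel f" "(LINT v|lborel. f v) = 1"
      "integrable lborel (\<lambda>v. f v * (norm v)\<^sup>2)" "(LINT v|lborel. f v * (norm v)\<^sup>2) = 3"
      "integrable lborel (\<lambda>v. f v * ln (f v))"
    using adm by (auto simp: admissible_def has_bochner_integral_iff)
  have [measurable]: "f \<in> borel_measurable borel" "maxwellian \<in> borel_measurable borel"
    using f(2) integrable_maxwellian by auto
  define \<omega> where "\<omega> v = jbracket v powr (-3)" for v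
  have [measurable]: "\<omega> \<in> borel_measurable borel" unfolding \<omega>_def[abs_def] by measurable
  have \<omega>: "0 < \<omega> v" "\<omega> v \<le> 1" for v using jbracket_powr_neg_bounds by (auto simp: \<omega>_def)
  have weight: "integrable lborel (\<lambda>v. \<omega> v * u v)" if "integrable lborel u" for u :: "real^3 \<Rightarrow> real"
    unfolding \<omega>_def by (rule integrable_weighted[OF that])
  have Z1: "0 < Z1" "Z1 \<le> 1" unfolding Z1_def by (rule weighted_mass_maxwellian)+
  have i\<mu>: "integrable lborel maxwellian" "(LINT v|lborel. maxwellian v) = 1"
    using maxwellian_integral by (auto simp: has_bochner_integral_iff)
  have iZ2: "integrable lborel (\<lambda>v. \<omega> v * f v)" by (rule weight[OF f(2)])
  have "(LINT v|lborel. (1/8 + 9/64) * f v - 3/64 * (f v * (norm v)\<^sup>2)) \<le> (LINT v|lborel. \<omega> v * f v)"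
  proof (rule integral_mono)
    show "integrable lborel (\<lambda>v. (1/8 + 9/64) * f v - 3/64 * (f v * (norm v)\<^sup>2))" using f by auto
    have "(1/8 + 9/64) * f v - 3/64 * (f v * (norm v)\<^sup>2) = (1/8 - 3/64 * ((norm v)\<^sup>2 - 3)) * f v" for v
      by (simp add: field_simps)
    then show "(1/8 + 9/64) * f v - 3/64 * (f v * (norm v)\<^sup>2) \<le> \<omega> v * f v" for v
      using mult_right_mono[OF jbracket_powr_neg_tangent[of v] f(1)[of v]] by (simp only: \<omega>_def)
  qed (rule iZ2)
  then have Z2: "1 / 8 \<le> Z2" using f by (simp add: Z2_def weighted_mass_def \<omega>_def)
  then show "1 / 8 \<le> weighted_mass f" by (simp add: Z2_def)
  have "Z2 \<le> (LINT v|lborel. f v)" unfolding Z2_def weighted_mass_def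
    using iZ2 \<omega> f by (intro integral_mono) (auto simp: \<omega>_def intro!: mult_left_le_one_le)
  then have Z2': "Z2 \<le> 1" using f by simp
  define S where "S = {v. jbracket v \<ge> R}"
  have [measurable]: "S \<in> sets borel"
  proof -
    have "S = {v \<in> space borel. jbracket v \<ge> R}" by (simp add: S_def)
    also have "\<dots> \<in> sets borel" by measurable
    finally show ?thesis .
  qed
  have si: "set_integrable lborel S u" if "integrable lborel u" for u :: "real^3 \<Rightarrow> real"
    unfolding set_integrable_def by (rule integrable_mult_indicator[OF _ that]) simp
  define L where "L v = f v * ln (f v) + (1/2) * (f v * (norm v)\<^sup>2) + 3 / 2 * ln (2 * pi) * f v" for v
  have L: "f v * ln (f v / maxwellian v) = L v" for v
  proof (cases "f v = 0")
    case False
    then have "ln (f v / maxwellian v) = ln (f v) + 3 / 2 * ln (2 * pi) + (norm v)\<^sup>2 / 2"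
      using f(1)[of v] maxwellian_pos[of v] by (simp add: ln_div ln_maxwellian)
    then show ?thesis by (simp add: L_def algebra_simps)
  qed (simp add: L_def)
  have iL: "integrable lborel L" unfolding L_def by (intro Bochner_Integration.integrable_add integrable_mult_right f)
  define \<psi> where "\<psi> v = f v * ln (Z1 / Z2 * (f v / maxwellian v)) + Z2 / Z1 * maxwellian v - f v" for v
  have \<psi>: "\<psi> v = L v + (ln (Z1 / Z2) - 1) * f v + Z2 / Z1 * maxwellian v" for v
  proof -
    have "f v * ln (Z1 / Z2 * (f v / maxwellian v)) = f v * ln (Z1 / Z2) + f v * ln (f v / maxwellian v)"
    proof (cases "f v = 0")
      case False
      then have "0 < f v / maxwellian v" using f(1)[of v] maxwellian_pos[of v] by simp
      then show ?thesis using Z1 Z2 by (subst ln_mult) (auto simp: algebra_simps)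
    qed simp
    then show ?thesis unfolding \<psi>_def L[symmetric] by (simp add: algebra_simps)
  qed
  have \<psi>0: "0 \<le> \<psi> v" for v
  proof -
    have m: "0 < Z2 / Z1 * maxwellian v" using Z1 Z2 maxwellian_pos[of v] by simp
    have "f v * ln (Z2 / Z1 * maxwellian v) \<le> f v * ln (f v) - f v + exp (ln (Z2 / Z1 * maxwellian v))"
      by (rule Young_entropy[OF f(1)])
    moreover have "f v * ln (Z1 / Z2 * (f v / maxwellian v)) = f v * ln (f v) - f v * ln (Z2 / Z1 * maxwellian v)"
    proof (cases "f v = 0")
      case False
      then have "ln (f v / (Z2 / Z1 * maxwellian v)) = ln (f v) - ln (Z2 / Z1 * maxwellian v)"
        using f(1)[of v] m by (intro ln_divide_pos) auto
      moreover have "f v / (Z2 / Z1 * maxwellian v) = Z1 / Z2 * (f v / maxwellian v)" by simp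
      ultimately show ?thesis by (simp only: right_diff_distrib)
    qed simp
    ultimately show ?thesis unfolding \<psi>_def using m by simp
  qed
  have \<psi>': "\<psi> = (\<lambda>v. L v + (ln (Z1 / Z2) - 1) * f v + Z2 / Z1 * maxwellian v)"
    using \<psi> by blast
  have i\<psi>: "integrable lborel \<psi>" unfolding \<psi>'
    by (intro Bochner_Integration.integrable_add integrable_mult_right iL f i\<mu>)
  have int\<psi>: "(LINT v|lborel. L v) \<le> (LINT v|lborel. \<psi> v)"
  proof -
    have "(LINT v|lborel. \<psi> v) = (LINT v|lborel. L v) + (ln (Z1 / Z2) - 1) * 1 + Z2 / Z1 * 1"
      unfolding \<psi>' using iL f(2,3) i\<mu> by simp
    moreover have "ln (Z2 / Z1) \<le> Z2 / Z1 - 1" using Z1 Z2 by (intro ln_le_minus_one) auto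
    moreover have "ln (Z2 / Z1) = - ln (Z1 / Z2)" using Z1 Z2 by (simp add: ln_div)
    ultimately show ?thesis by simp
  qed
  have ij: "integrable lborel (\<lambda>v. (jbracket v)\<^sup>2 * f v)"
    using Bochner_Integration.integrable_add[OF f(2,4)] unfolding jbracket_facts(2) by (simp add: algebra_simps)
  have C: "\<psi> v \<le> f v * ln (f v) + C * ((jbracket v)\<^sup>2 * f v) + C * maxwellian v" for v
  proof -
    have l0: "0 \<le> ln (2 * pi)" using pi_ge_two by (intro ln_ge_zero) simp
    have "Z1 / Z2 \<le> 1 / (1/8)" using Z1 Z2 by (intro frac_le) auto
    then have "ln (Z1 / Z2) \<le> ln 8" using Z1 Z2 by (subst ln_le_cancel_iff) auto
    then have "(ln (Z1 / Z2) - 1) * f v \<le> ln 8 * f v" using f(1)[of v] by (intro mult_right_mono) auto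
    moreover have "Z2 / Z1 * maxwellian v \<le> C * maxwellian v"
    proof (rule mult_right_mono)
      have "Z2 / Z1 \<le> 1 / Z1" using Z1 Z2' by (intro divide_right_mono) auto
      moreover have "0 \<le> ln (8::real)" by simp
      ultimately show "Z2 / Z1 \<le> C" using l0 unfolding C_def' by linarith
    qed (use maxwellian_pos[of v] in simp)
    moreover have "ln 8 * f v + (1/2) * (f v * (norm v)\<^sup>2) + 3 / 2 * ln (2 * pi) * f v \<le> C * ((jbracket v)\<^sup>2 * f v)"
    proof -
      have j1: "f v \<le> (jbracket v)\<^sup>2 * f v" "(norm v)\<^sup>2 * f v \<le> (jbracket v)\<^sup>2 * f v"
        using f(1)[of v] unfolding jbracket_facts(2) by (simp_all add: distrib_right)
      have "ln 8 * f v \<le> ln 8 * ((jbracket v)\<^sup>2 * f v)" by (rule mult_left_mono[OF j1(1)]) simp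
      moreover have "3 / 2 * ln (2 * pi) * f v \<le> 3 / 2 * ln (2 * pi) * ((jbracket v)\<^sup>2 * f v)"
        by (rule mult_left_mono[OF j1(1)]) (use l0 in simp)
      moreover have "(1/2) * (f v * (norm v)\<^sup>2) \<le> (1/2) * ((jbracket v)\<^sup>2 * f v)" using j1(2) by (simp add: mult.commute)
      moreover have "0 \<le> 1 / Z1 * ((jbracket v)\<^sup>2 * f v)" using Z1 f(1)[of v] by simp
      moreover have "C * ((jbracket v)\<^sup>2 * f v) = 1 / Z1 * ((jbracket v)\<^sup>2 * f v) + (1/2) * ((jbracket v)\<^sup>2 * f v)
         + 3 / 2 * ln (2 * pi) * ((jbracket v)\<^sup>2 * f v) + ln 8 * ((jbracket v)\<^sup>2 * f v)"
        unfolding C_def' by (simp only: distrib_right)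
      ultimately show ?thesis by linarith
    qed
    ultimately show ?thesis unfolding \<psi> L_def by linarith
  qed
  have SC: "(LINT v:S|lborel. \<psi> v) \<le> (LINT v:S|lborel. f v * ln (f v)) + C * (LINT v:S|lborel. (jbracket v)\<^sup>2 * f v)
      + C * (LINT v:S|lborel. maxwellian v)"
  proof -
    have "(LINT v:S|lborel. \<psi> v) \<le> (LINT v:S|lborel. f v * ln (f v) + C * ((jbracket v)\<^sup>2 * f v) + C * maxwellian v)"
      using C by (intro set_integral_mono si i\<psi> Bochner_Integration.integrable_add integrable_mult_right f ij i\<mu>) auto
    also have "\<dots> = (LINT v:S|lborel. f v * ln (f v)) + (LINT v:S|lborel. C * ((jbracket v)\<^sup>2 * f v)) + (LINT v:S|lborel. C * maxwellian v)"
      by (subst set_integral_add(2), (intro si Bochner_Integration.integrable_add integrable_mult_right f ij i\<mu>)+)+ simp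
    finally show ?thesis by (simp only: set_integral_mult_right)
  qed
  have "R powr (-3) * ((LINT v|lborel. \<psi> v) - (LINT v:S|lborel. \<psi> v)) \<le> (LINT v|lborel. \<psi> v * jbracket v powr (-3))"
  proof -
    have "R powr (-3) * ((LINT v|lborel. \<psi> v) - (LINT v:S|lborel. \<psi> v)) = (LINT v|lborel. R powr (-3) * (\<psi> v - indicator S v *\<^sub>R \<psi> v))"
      unfolding set_lebesgue_integral_def using i\<psi> si[OF i\<psi>] by (simp add: set_integrable_def)
    also have "\<dots> \<le> (LINT v|lborel. \<psi> v * jbracket v powr (-3))"
    proof (rule integral_mono)
      show "integrable lborel (\<lambda>v. R powr (-3) * (\<psi> v - indicator S v *\<^sub>R \<psi> v))"
        using i\<psi> si[OF i\<psi>] by (simp add: set_integrable_def)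
      show "integrable lborel (\<lambda>v. \<psi> v * jbracket v powr (-3))"
        using weight[OF i\<psi>] by (simp add: \<omega>_def mult.commute)
      fix v
      show "R powr (-3) * (\<psi> v - indicator S v *\<^sub>R \<psi> v) \<le> \<psi> v * jbracket v powr (-3)"
      proof (cases "v \<in> S")
        case False
        then have "jbracket v \<le> R" by (simp add: S_def)
        then have "R powr (-3) \<le> jbracket v powr (-3)"
          using jbracket_facts(1)[of v] by (intro powr_mono2') auto
        from mult_right_mono[OF this \<psi>0[of v]] False show ?thesis by (simp add: mult.commute)
      qed (simp add: \<psi>0)
    qed
    finally show ?thesis .
  qed
  moreover have "R powr (-3) * ((LINT v|lborel. L v) - (LINT v:S|lborel. f v * ln (f v)) - C * (LINT v:S|lborel. (jbracket v)\<^sup>2 * f v)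
      - C * (LINT v:S|lborel. maxwellian v)) \<le> R powr (-3) * ((LINT v|lborel. \<psi> v) - (LINT v:S|lborel. \<psi> v))"
    using SC int\<psi> by (intro mult_left_mono) auto
  ultimately show "R powr (-3) * truncated_relative_entropy tail_constant R f \<le> weighted_relative_entropy f"
    unfolding truncated_relative_entropy_def weighted_relative_entropy_def L S_def[symmetric]
      Z1_def[symmetric] Z2_def[symmetric] C_def[symmetric] \<psi>_def by simp
qed

text \<open>
  If the fifth moment or the dissipation is infinite, the inequality holds trivially, since the inverse of infinity is 0.
\<close>

theorem dissipation_ge_weighted_relative_entropy:
  "\<exists>K>0. \<forall>f x. admissible Hbar f \<longrightarrow> x \<le> weighted_relative_entropy f \<longrightarrow>
     ereal K * inverse (enn2ereal (moment 5 f)) * ereal x \<le> enn2ereal (entropy_dissipation f)"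
proof -
  obtain B where B: "B > 0" and Fisher: "\<And>f. admissible Hbar f \<Longrightarrow> moment 5 f < \<infinity> \<Longrightarrow> entropy_dissipation f < \<infinity> \<Longrightarrow>
   has_weak_gradient f (weak_gradient f) \<and>
   (\<integral>\<^sup>+v. ennreal (f v * jbracket v powr (-3) * (norm ((1 / f v) *\<^sub>R weak_gradient f v + v))\<^sup>2) \<partial>lborel)
     \<le> ennreal B * moment 5 f * entropy_dissipation f"
    using weighted_Fisher_information_bound[of Hbar] by blast
  show ?thesis
  proof (intro exI[of _ "5 / (4 * B)"] conjI allI impI)
    show "0 < 5 / (4 * B)" using B by simp
    fix f x assume adm: "admissible Hbar f"
      and x: "x \<le> weighted_relative_entropy f"
    have f: "\<And>v. 0 \<le> f v" "integrable lborel f" "integrable lborel (\<lambda>v. f v * (norm v)\<^sup>2)"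
      "integrable lborel (\<lambda>v. f v * ln (f v))" "(LINT v|lborel. f v) = 1"
      using adm by (auto simp: admissible_def has_bochner_integral_iff)
    show "ereal (5 / (4 * B)) * inverse (enn2ereal (moment 5 f)) * ereal x \<le> enn2ereal (entropy_dissipation f)"
    proof (cases "moment 5 f < \<infinity> \<and> entropy_dissipation f < \<infinity>")
      case False
      then have "moment 5 f = top \<or> entropy_dissipation f = top" by (auto simp: less_top[symmetric])
      then show ?thesis by (elim disjE) (simp_all add: top_ennreal.rep_eq)
    next
      case True
      define m where "m = enn2real (moment 5 f)"
      define d where "d = enn2real (entropy_dissipation f)"
      have md: "moment 5 f = ennreal m" "entropy_dissipation f = ennreal d" "m \<ge> 0" "d \<ge> 0"
        using True by (auto simp: m_def d_def less_top)
      have m1: "m \<ge> 1"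
      proof -
        have "ennreal 1 = (\<integral>\<^sup>+v. ennreal (f v) \<partial>lborel)"
          using f by (subst nn_integral_eq_integral) auto
        also have "\<dots> \<le> moment 5 f" unfolding moment_def
        proof (intro nn_integral_mono ennreal_leI)
          fix v
          have "1 \<le> jbracket v powr 5" using jbracket_facts(1)[of v] by (intro ge_one_powr_ge_zero) auto
          from mult_right_mono[OF this f(1)[of v]] show "f v \<le> jbracket v powr 5 * f v" by simp
        qed
        finally show ?thesis unfolding md(1) using md(3) by (simp only: ennreal_le_iff)
      qed
      have I: "(\<integral>\<^sup>+v. ennreal (f v * jbracket v powr (-3) * (norm ((1 / f v) *\<^sub>R weak_gradient f v + v))\<^sup>2) \<partial>lborel)
         \<le> ennreal (B * m * d)"
        using Fisher[OF adm] True B md by (simp add: ennreal_mult)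
      have "x \<le> 4 / 5 * (B * m * d)"
      proof (rule order.trans[OF x])
        have "0 < weighted_mass f"
          using weighted_relative_entropy_ge_truncated(2)[OF adm zero_less_one] by linarith
        then show "weighted_relative_entropy f \<le> 4 / 5 * (B * m * d)"
          using Fisher[OF adm] True B md(3,4) by (intro weighted_log_Sobolev[OF _ f(1-4) I]) auto
      qed
      then have "5 / (4 * B) * inverse m * x \<le> d"
        using B m1 by (simp add: field_simps)
      then show ?thesis using md m1 by (simp add: enn2ereal_ennreal)
    qed
  qed
qed

theorem corollary1p1:
  shows "\<exists>C>0. \<forall>Hbar::real. \<exists>K>0. \<forall>f::real^3 \<Rightarrow> real. admissible Hbar f \<longrightarrow>
    (let Z1 = (LINT v|lborel. jbracket v powr (-3) * maxwellian v);
         Z2 = (LINT v|lborel. jbracket v powr (-3) * f v)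
     in enn2ereal (entropy_dissipation f) \<ge>
        ereal K * inverse (enn2ereal (moment 5 f)) *
        ereal (LINT v|lborel. (f v * ln (Z1 / Z2 * (f v / maxwellian v))
                 + Z2 / Z1 * maxwellian v - f v) * jbracket v powr (-3)))
    \<and> (\<forall>R>0. enn2ereal (entropy_dissipation f) \<ge>
        ereal K * inverse (enn2ereal (moment 5 f)) * ereal (R powr (-3)) *
        ereal ((LINT v|lborel. f v * ln (f v / maxwellian v))
          - (LINT v:{v. jbracket v \<ge> R}|lborel. f v * ln (f v))
          - C * (LINT v:{v. jbracket v \<ge> R}|lborel. (jbracket v)\<^sup>2 * f v)
          - C * (LINT v:{v. jbracket v \<ge> R}|lborel. maxwellian v)))"
  unfolding Let_def weighted_mass_def[symmetric] weighted_relative_entropy_def[symmetric]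
    truncated_relative_entropy_def[symmetric]
proof (rule exI[of _ tail_constant], intro conjI allI)
  have "0 \<le> ln (2 * pi)" using pi_ge_two by (intro ln_ge_zero) simp
  moreover have "0 \<le> ln (8::real)" by simp
  moreover have "0 < 1 / weighted_mass maxwellian" using weighted_mass_maxwellian by simp
  ultimately show "tail_constant > 0" unfolding tail_constant_def by linarith
  fix Hbar :: real
  obtain K where K: "K > 0"
    and bound: "\<And>f x. admissible Hbar f \<Longrightarrow> x \<le> weighted_relative_entropy f \<Longrightarrow>
      ereal K * inverse (enn2ereal (moment 5 f)) * ereal x \<le> enn2ereal (entropy_dissipation f)"
    using dissipation_ge_weighted_relative_entropy[of Hbar] by blast
  show "\<exists>K>0. \<forall>f. admissible Hbar f \<longrightarrow>
      enn2ereal (entropy_dissipation f) \<ge>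
        ereal K * inverse (enn2ereal (moment 5 f)) * ereal (weighted_relative_entropy f) \<and>
      (\<forall>R>0. enn2ereal (entropy_dissipation f) \<ge> ereal K * inverse (enn2ereal (moment 5 f)) *
        ereal (R powr (-3)) * ereal (truncated_relative_entropy tail_constant R f))"
  proof (intro exI[of _ K] conjI allI impI K)
    fix f R assume adm: "admissible Hbar f" and R: "(R::real) > 0"
    show "enn2ereal (entropy_dissipation f) \<ge> ereal K * inverse (enn2ereal (moment 5 f)) *
        ereal (R powr (-3)) * ereal (truncated_relative_entropy tail_constant R f)"
      using bound[OF adm weighted_relative_entropy_ge_truncated(1)[OF adm R]]
      by (simp only: times_ereal.simps(1)[symmetric] mult.assoc)
  qed (use bound in auto)
qed

end
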